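(* Let $\overline X=(X_0,X_1)$ be a compatible (quasi-)Banach couple and $0<\theta<1$. Let $E,F,G$ be r.i. spaces and let $a,\mathrm b,c\in SV$ be such that $\mathrm b(t^2)\sim \mathrm b(t)$ and $c(t^2)\sim c(t)$. For $0<u\le1$ put $B_0(u)=\mathrm b(e^{1-\frac1u})$, $B_\infty(u)=\mathrm b(e^{\frac1u-1})$, $C_0(u)=c(e^{1-\frac1u})$, $C_\infty(u)=c(e^{\frac1u-1})$. i) If $\rho_{B_\infty}<\pi_{\varphi_F}\le\rho_{\varphi_F}<\pi_{B_0}$ and $\rho_{C_0}<0<\pi_{C_\infty}$, then $$\overline X^{\mathcal R,\mathcal L}_{\theta,d,\widehat E,\mathrm b,F,a,G}=\overline X^{\mathcal L}_{\theta,c,\widehat E,a,G},$$ where $d(u)=c(u)/\|\mathrm b\|_{\widetilde F(0,u)}$, $u>0$. ii) If $\rho_{B_0}<\pi_{\varphi_F}\le\rho_{\varphi_F}<\pi_{B_\infty}$ and $\rho_{C_\infty}<0<\pi_{C_0}$, then $$\overline X^{\mathcal L,\mathcal R}_{\theta,d,\widehat E,\mathrm b,F,a,G}=\overline X^{\mathcal R}_{\theta,c,\widehat E,a,G},$$ where $d(u)=c(u)/\|\mathrm b\|_{\widetilde F(u,\infty)}$, $u>0$.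
   Context: General notation. $f\lesssim g$ means $f\le Cg$ pointwise with a constant $C>0$ independent of the variable; $f\sim g$ means $f\lesssim g$ and $g\lesssim f$. A function is almost increasing (decreasing) if it is equivalent ($\sim$) to a non-decreasing (non-increasing) function. Equality of (quasi-)Banach spaces means equality as sets with equivalent (quasi-)norms. $\ell(t)=1+|\log t|$, $t>0$. Peetre's functional. For $f\in X_0+X_1$, $t>0$: $K(t,f)=\inf\{\|f_0\|_{X_0}+t\|f_1\|_{X_1}: f=f_0+f_1,\ f_i\in X_i\}$. r.i. spaces. An r.i. space is a rearrangement invariant Banach function space (in the sense of Bennett and Sharpley, with the Fatou property) on $((0,\infty),dt)$; $\varphi_E(\lambda)=\|\chi_{(0,\lambda)}\|_E$ is its fundamental function. Every r.i. space is of the form $E=(L_1,L_\infty)^K_D$, i.e. $\|f\|_E=\|K(t,f;L_1,L_\infty)\|_D$, for some Banach lattice $D$ of measurable functions on $(0,\infty)$ containing $\min(1,t)$. One defines $\widetilde E=(\widetilde L_1,L_\infty)^K_D$ and $\widehat E=(\widehat L_1,L_\infty)^K_D$, where $\widetilde L_1=L_1((0,\infty),\frac{dt}{t})$ and $\widehat L_1=L_1((0,\infty),\frac{dt}{t\ell(t)})$; these do not depend on $D$ and are the versions of $E$ for the measures $\frac{dt}{t}$ and $\frac{dt}{t\ell(t)}$. For an interval $(c,d)$, $\|f\|_{\widetilde E(c,d)}=\|f\chi_{(c,d)}\|_{\widetilde E}$. Extension indices. For a function $\varphi$ on $(0,a)$, $0<a\le\infty$, let $m_\varphi(t)=\sup_{0<s<\min\{a,a/t\}}\varphi(ts)/\varphi(s)$.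 If $m_\varphi$ is finite everywhere, $\pi_\varphi=\lim_{t\to0}\frac{\ln m_\varphi(t)}{\ln t}$ and $\rho_\varphi=\lim_{t\to\infty}\frac{\ln m_\varphi(t)}{\ln t}$. Slowly varying functions. A positive Lebesgue measurable $\mathrm b$ on $(0,\infty)$ is slowly varying, $\mathrm b\in SV$, if for each $\varepsilon>0$ the function $t^{\varepsilon}\mathrm b(t)$ is almost increasing and $t^{-\varepsilon}\mathrm b(t)$ is almost decreasing on $(0,\infty)$. If $\mathrm b(t)\sim\mathrm b(t^2)$, then $B_0,B_\infty$ (functions on $(0,1)$) have finite extension indices. Interpolation spaces. Each space consists of all $f\in X_0+X_1$ with finite indicated (quasi-)norm (inner to outer norms in $s$, $t$, $u$): - $\overline X^{\mathcal R}_{\theta,c,\widehat E,a,G}$: $\big\|c(u)\|s^{-\theta}a(s)K(s,f)\|_{\widetilde G(u,\infty)}\big\|_{\widehat E}$; - $\overline X^{\mathcal L}_{\theta,c,\widehat E,a,G}$: $\big\|c(u)\|s^{-\theta}a(s)K(s,f)\|_{\widetilde G(0,u)}\big\|_{\widehat E}$; - $\overline X^{\mathcal R,\mathcal L}_{\theta,d,\widehat E,\mathrm b,F,a,G}$: $\Big\|d(u)\big\|\mathrm b(t)\|s^{-\theta}a(s)K(s,f)\|_{\widetilde G(t,u)}\big\|_{\widetilde F(0,u)}\Big\|_{\widehat E}$; - $\overline X^{\mathcal L,\mathcal R}_{\theta,d,\widehat E,\mathrm b,F,a,G}$: $\Big\|d(u)\big\|\mathrm b(t)\|s^{-\theta}a(s)K(s,f)\|_{\widetilde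 G(u,t)}\big\|_{\widetilde F(u,\infty)}\Big\|_{\widehat E}$.
   Formalization: The finiteness of m_φ for φ = B_0, B_∞, C_0, C_∞, without which their extension indices are undefined, is an explicit hypothesis, because it does not follow from b(t²)∼b(t) and c(t²)∼c(t) for slowly varying b and c. *)

theory Defs
  imports "HOL-Analysis.Analysis" "HOL-Probability.Essential_Supremum"
begin

definition lesssim_on :: "real set \<Rightarrow> (real \<Rightarrow> real) \<Rightarrow> (real \<Rightarrow> real) \<Rightarrow> bool" where
  "lesssim_on S f g \<longleftrightarrow> (\<exists>C>0. \<forall>t\<in>S. f t \<le> C * g t)"

definition equiv_on :: "real set \<Rightarrow> (real \<Rightarrow> real) \<Rightarrow> (real \<Rightarrow> real) \<Rightarrow> bool" where
  "equiv_on S f g \<longleftrightarrow> lesssim_on S f g \<and> lesssim_on S g f"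

definition almost_increasing_on :: "real set \<Rightarrow> (real \<Rightarrow> real) \<Rightarrow> bool" where
  "almost_increasing_on S f \<longleftrightarrow> (\<exists>g. mono_on S g \<and> equiv_on S f g)"

definition almost_decreasing_on :: "real set \<Rightarrow> (real \<Rightarrow> real) \<Rightarrow> bool" where
  "almost_decreasing_on S f \<longleftrightarrow> (\<exists>g. antimono_on S g \<and> equiv_on S f g)"

text \<open>The measure spaces $(0,\infty)$ with $dt$, $dt/t$ and $dt/(t\,\ell(t))$. They have the same
  measurable sets and the same null sets.\<close>

definition ell :: "real \<Rightarrow> real" where
  "ell t = 1 + \<bar>ln t\<bar>"

definition halfline :: "real measure" where
  "halfline = lebesgue_on {0<..}"

definition tilde_measure :: "real measure" where
  "tilde_measure = density halfline (\<lambda>t. ennreal (1 / t))"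

definition hat_measure :: "real measure" where
  "hat_measure = density halfline (\<lambda>t. ennreal (1 / (t * ell t)))"

definition slowly_varying :: "(real \<Rightarrow> real) \<Rightarrow> bool" where
  "slowly_varying b \<longleftrightarrow>
     b \<in> borel_measurable halfline \<and> (\<forall>t>0. b t > 0) \<and>
     (\<forall>\<epsilon>>0. almost_increasing_on {0<..} (\<lambda>t. t powr \<epsilon> * b t) \<and>
             almost_decreasing_on {0<..} (\<lambda>t. t powr (- \<epsilon>) * b t))"

text \<open>The function $m_\varphi$ of a positive function $\varphi$ on $(0,a)$, $0 < a \le \infty$; the
  supremum may be infinite.\<close>

definition dilation_sup :: "ereal \<Rightarrow> (real \<Rightarrow> real) \<Rightarrow> real \<Rightarrow> ennreal" where
  "dilation_sup a \<phi> t =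
     (SUP s\<in>{s. 0 < s \<and> ereal s < min a (a / ereal t)}. ennreal (\<phi> (t * s) / \<phi> s))"

text \<open>The extension indices are defined (and then real numbers) only if $m_\varphi$ is finite
  everywhere; otherwise the values below are meaningless. For $\varphi(u) = b(e^{1/u-1})$ this
  does not follow from $b$ being slowly varying with $b(t^2) \sim b(t)$ alone: consider
  $b(e^y) = y^{\sin(2\pi\log_2 y)}$ for $y \ge 1$ and $b = 1$ on $(0,e)$.\<close>

definition has_extension_indices :: "ereal \<Rightarrow> (real \<Rightarrow> real) \<Rightarrow> bool" where
  "has_extension_indices a \<phi> \<longleftrightarrow> (\<forall>t>0. dilation_sup a \<phi> t < \<infinity>)"

definition pi_index :: "ereal \<Rightarrow> (real \<Rightarrow> real) \<Rightarrow> real" where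
  "pi_index a \<phi> = Lim (at_right 0) (\<lambda>t. ln (enn2real (dilation_sup a \<phi> t)) / ln t)"

definition rho_index :: "ereal \<Rightarrow> (real \<Rightarrow> real) \<Rightarrow> real" where
  "rho_index a \<phi> = Lim at_top (\<lambda>t. ln (enn2real (dilation_sup a \<phi> t)) / ln t)"

text \<open>As in Bennett and Sharpley, a space of measurable functions is given by its norm on the cone
  of measurable functions with values in $[0,\infty]$; a real function $f$ belongs to the space iff
  the norm of $|f|$ is finite.\<close>

type_synonym fnorm = "(real \<Rightarrow> ennreal) \<Rightarrow> ennreal"

definition lattice_norm :: "real measure \<Rightarrow> fnorm \<Rightarrow> bool" where
  "lattice_norm M \<rho> \<longleftrightarrow>
     (\<forall>f\<in>borel_measurable M. \<rho> f = 0 \<longleftrightarrow> (AE x in M. f x = 0)) \<and>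
     (\<forall>f\<in>borel_measurable M. \<forall>c\<ge>0. \<rho> (\<lambda>x. ennreal c * f x) = ennreal c * \<rho> f) \<and>
     (\<forall>f\<in>borel_measurable M. \<forall>g\<in>borel_measurable M. \<rho> (\<lambda>x. f x + g x) \<le> \<rho> f + \<rho> g) \<and>
     (\<forall>f\<in>borel_measurable M. \<forall>g\<in>borel_measurable M. (AE x in M. g x \<le> f x) \<longrightarrow> \<rho> g \<le> \<rho> f)"

definition banach_lattice :: "real measure \<Rightarrow> fnorm \<Rightarrow> bool" where
  "banach_lattice M \<rho> \<longleftrightarrow>
     lattice_norm M \<rho> \<and>
     (\<forall>f\<in>borel_measurable M. \<rho> f < \<infinity> \<longrightarrow> (AE x in M. f x < \<infinity>)) \<and>
     (\<forall>f :: nat \<Rightarrow> real \<Rightarrow> real.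
        (\<forall>n. f n \<in> borel_measurable M \<and> \<rho> (\<lambda>x. ennreal \<bar>f n x\<bar>) < \<infinity>) \<and>
        (\<forall>e>0. \<exists>N. \<forall>m\<ge>N. \<forall>n\<ge>N. \<rho> (\<lambda>x. ennreal \<bar>f m x - f n x\<bar>) < ennreal e) \<longrightarrow>
        (\<exists>g :: real \<Rightarrow> real.
           g \<in> borel_measurable M \<and> \<rho> (\<lambda>x. ennreal \<bar>g x\<bar>) < \<infinity> \<and>
           (\<lambda>n. \<rho> (\<lambda>x. ennreal \<bar>f n x - g x\<bar>)) \<longlonglongrightarrow> 0))"

text \<open>The axioms (P1)--(P5) of a Banach function norm in the sense of Bennett and Sharpley;
  the third clause is the Fatou property.\<close>

definition banach_function_norm :: "real measure \<Rightarrow> fnorm \<Rightarrow> bool" where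
  "banach_function_norm M \<rho> \<longleftrightarrow>
     lattice_norm M \<rho> \<and>
     (\<forall>F f. (\<forall>n::nat. F n \<in> borel_measurable M) \<and> f \<in> borel_measurable M \<and>
        (AE x in M. incseq (\<lambda>n. F n x) \<and> (\<lambda>n. F n x) \<longlonglongrightarrow> f x) \<longrightarrow>
        (\<lambda>n. \<rho> (F n)) \<longlonglongrightarrow> \<rho> f) \<and>
     (\<forall>A\<in>sets M. emeasure M A < \<infinity> \<longrightarrow> \<rho> (indicator A) < \<infinity>) \<and>
     (\<forall>A\<in>sets M. emeasure M A < \<infinity> \<longrightarrow>
        (\<exists>C>0. \<forall>f\<in>borel_measurable M. (\<integral>\<^sup>+x\<in>A. f x \<partial>M) \<le> ennreal C * \<rho> f))"

definition equimeasurable :: "real measure \<Rightarrow> (real \<Rightarrow> ennreal) \<Rightarrow> (real \<Rightarrow> ennreal) \<Rightarrow> bool" where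
  "equimeasurable M f g \<longleftrightarrow>
     (\<forall>r\<ge>0. emeasure M {x \<in> space M. ennreal r < f x} = emeasure M {x \<in> space M. ennreal r < g x})"

definition ri_norm :: "fnorm \<Rightarrow> bool" where
  "ri_norm E \<longleftrightarrow>
     banach_function_norm halfline E \<and>
     (\<forall>f\<in>borel_measurable halfline. \<forall>g\<in>borel_measurable halfline.
        (AE x in halfline. f x < \<infinity>) \<and> (AE x in halfline. g x < \<infinity>) \<and> equimeasurable halfline f g
        \<longrightarrow> E f = E g)"

definition fundamental_function :: "fnorm \<Rightarrow> real \<Rightarrow> real" where
  "fundamental_function E r = enn2real (E (indicator {0<..<r}))"

text \<open>$K(t,f;L_1(M),L_\infty(M))$ for a measurable $f \ge 0$. It is infinite if
  $f \notin L_1 + L_\infty$; note that \<open>esssup\<close> and the integral here are taken of measurable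
  functions only.\<close>

definition K_L1_Linf :: "real measure \<Rightarrow> real \<Rightarrow> (real \<Rightarrow> ennreal) \<Rightarrow> ennreal" where
  "K_L1_Linf M t f =
     (INF (g, h)\<in>{(g, h). g \<in> borel_measurable M \<and> h \<in> borel_measurable M \<and>
                     (AE x in M. 0 \<le> g x + h x \<and> f x = ennreal (g x + h x))}.
        (\<integral>\<^sup>+x. ennreal \<bar>g x\<bar> \<partial>M) + ennreal t * esssup M (\<lambda>x. ennreal \<bar>h x\<bar>))"

definition K_space_norm :: "real measure \<Rightarrow> fnorm \<Rightarrow> fnorm" where
  "K_space_norm M D f = D (\<lambda>t. K_L1_Linf M t f)"

text \<open>\<open>D\<close> is a parameter with $E = (L_1,L_\infty)^K_D$. Such a \<open>D\<close> exists for every r.i. space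
  \<open>E\<close>, and the norms of $\widetilde E$ and $\widehat E$, which are given in terms of \<open>D\<close> below, do
  not depend on its choice.\<close>

definition is_K_parameter :: "fnorm \<Rightarrow> fnorm \<Rightarrow> bool" where
  "is_K_parameter D E \<longleftrightarrow>
     banach_lattice halfline D \<and> D (\<lambda>t. ennreal (min 1 t)) < \<infinity> \<and>
     (\<forall>f\<in>borel_measurable halfline. E f = K_space_norm halfline D f)"

definition tilde_norm :: "fnorm \<Rightarrow> real set \<Rightarrow> fnorm" where
  "tilde_norm D I f = K_space_norm tilde_measure D (\<lambda>t. f t * indicator I t)"

definition hat_norm :: "fnorm \<Rightarrow> fnorm" where
  "hat_norm D f = K_space_norm hat_measure D f"

definition quasi_banach_space :: "'a::real_vector set \<Rightarrow> ('a \<Rightarrow> real) \<Rightarrow> bool" where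
  "quasi_banach_space X n \<longleftrightarrow>
     subspace X \<and>
     (\<forall>x\<in>X. 0 \<le> n x \<and> (n x = 0 \<longleftrightarrow> x = 0)) \<and>
     (\<forall>x\<in>X. \<forall>r. n (r *\<^sub>R x) = \<bar>r\<bar> * n x) \<and>
     (\<exists>C\<ge>1. \<forall>x\<in>X. \<forall>y\<in>X. n (x + y) \<le> C * (n x + n y)) \<and>
     (\<forall>f :: nat \<Rightarrow> 'a.
        (\<forall>i. f i \<in> X) \<and> (\<forall>e>0. \<exists>N. \<forall>i\<ge>N. \<forall>j\<ge>N. n (f i - f j) < e) \<longrightarrow>
        (\<exists>x\<in>X. (\<lambda>i. n (f i - x)) \<longlonglongrightarrow> 0))"

text \<open>Both spaces are continuously embedded in the Hausdorff topological vector space \<open>'a\<close>;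
  by linearity it suffices to require continuity of the embeddings at 0. Complex spaces are
  covered by restriction of scalars.\<close>

definition continuously_embedded ::
    "'a::{real_vector,t2_space,topological_ab_group_add} set \<Rightarrow> ('a \<Rightarrow> real) \<Rightarrow> bool" where
  "continuously_embedded X n \<longleftrightarrow>
     (\<forall>U. open U \<and> 0 \<in> U \<longrightarrow> (\<exists>\<delta>>0. \<forall>x\<in>X. n x < \<delta> \<longrightarrow> x \<in> U))"

definition compatible_couple ::
    "'a::{real_vector,t2_space,topological_ab_group_add} set \<Rightarrow> ('a \<Rightarrow> real) \<Rightarrow>
     'a set \<Rightarrow> ('a \<Rightarrow> real) \<Rightarrow> bool" where
  "compatible_couple X0 n0 X1 n1 \<longleftrightarrow>
     continuous_on UNIV (\<lambda>p :: real \<times> 'a. fst p *\<^sub>R snd p) \<and>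
     quasi_banach_space X0 n0 \<and> continuously_embedded X0 n0 \<and>
     quasi_banach_space X1 n1 \<and> continuously_embedded X1 n1"

definition K_functional ::
    "'a::plus set \<Rightarrow> ('a \<Rightarrow> real) \<Rightarrow> 'a set \<Rightarrow> ('a \<Rightarrow> real) \<Rightarrow> real \<Rightarrow> 'a \<Rightarrow> ennreal" where
  "K_functional X0 n0 X1 n1 t f =
     (INF (f0, f1)\<in>{(f0, f1). f0 \<in> X0 \<and> f1 \<in> X1 \<and> f = f0 + f1}. ennreal (n0 f0 + t * n1 f1))"

text \<open>The functionals below are applied to $k(s) = K(s,f)$; the arguments \<open>E\<close>, \<open>F\<close>, \<open>G\<close> stand
  for K-parameters of the respective r.i. spaces.\<close>

definition R_norm ::
    "real \<Rightarrow> (real \<Rightarrow> real) \<Rightarrow> fnorm \<Rightarrow> (real \<Rightarrow> real) \<Rightarrow> fnorm \<Rightarrow> fnorm" where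
  "R_norm \<theta> c E a G k =
     hat_norm E (\<lambda>u. ennreal (c u) *
       tilde_norm G {u<..} (\<lambda>s. ennreal (s powr (- \<theta>) * a s) * k s))"

definition L_norm ::
    "real \<Rightarrow> (real \<Rightarrow> real) \<Rightarrow> fnorm \<Rightarrow> (real \<Rightarrow> real) \<Rightarrow> fnorm \<Rightarrow> fnorm" where
  "L_norm \<theta> c E a G k =
     hat_norm E (\<lambda>u. ennreal (c u) *
       tilde_norm G {0<..<u} (\<lambda>s. ennreal (s powr (- \<theta>) * a s) * k s))"

definition RL_norm ::
    "real \<Rightarrow> (real \<Rightarrow> real) \<Rightarrow> fnorm \<Rightarrow> (real \<Rightarrow> real) \<Rightarrow> fnorm \<Rightarrow> (real \<Rightarrow> real) \<Rightarrow> fnorm \<Rightarrow> fnorm" where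
  "RL_norm \<theta> d E b F a G k =
     hat_norm E (\<lambda>u. ennreal (d u) *
       tilde_norm F {0<..<u} (\<lambda>t. ennreal (b t) *
         tilde_norm G {t<..<u} (\<lambda>s. ennreal (s powr (- \<theta>) * a s) * k s)))"

definition LR_norm ::
    "real \<Rightarrow> (real \<Rightarrow> real) \<Rightarrow> fnorm \<Rightarrow> (real \<Rightarrow> real) \<Rightarrow> fnorm \<Rightarrow> (real \<Rightarrow> real) \<Rightarrow> fnorm \<Rightarrow> fnorm" where
  "LR_norm \<theta> d E b F a G k =
     hat_norm E (\<lambda>u. ennreal (d u) *
       tilde_norm F {u<..} (\<lambda>t. ennreal (b t) *
         tilde_norm G {u<..<t} (\<lambda>s. ennreal (s powr (- \<theta>) * a s) * k s)))"

text \<open>An interpolation space is a set together with its (quasi-)norm.\<close>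

definition interpolation_space ::
    "'a::plus set \<Rightarrow> ('a \<Rightarrow> real) \<Rightarrow> 'a set \<Rightarrow> ('a \<Rightarrow> real) \<Rightarrow> fnorm \<Rightarrow> 'a set \<times> ('a \<Rightarrow> ennreal)" where
  "interpolation_space X0 n0 X1 n1 \<Phi> =
     ({f. (\<exists>f0\<in>X0. \<exists>f1\<in>X1. f = f0 + f1) \<and> \<Phi> (\<lambda>s. K_functional X0 n0 X1 n1 s f) < \<infinity>},
      \<lambda>f. \<Phi> (\<lambda>s. K_functional X0 n0 X1 n1 s f))"

definition same_space :: "'a set \<times> ('a \<Rightarrow> ennreal) \<Rightarrow> 'a set \<times> ('a \<Rightarrow> ennreal) \<Rightarrow> bool" where
  "same_space Y Z \<longleftrightarrow>
     fst Y = fst Z \<and>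
     (\<exists>C>0. \<forall>f\<in>fst Y. snd Y f \<le> ennreal C * snd Z f \<and> snd Z f \<le> ennreal C * snd Y f)"

end

theory Submission
  imports Defs
begin

text \<open>Write $x=\ln u$ and $\sigma=\mathrm{sgn}(x)\ln(1+|x|)$. In the coordinate $\sigma$ the measure
  $du/(u\,\ell(u))$ is Lebesgue measure, while a unit $\sigma$-interval at $\sigma$ has
  $du/u$-measure of order $e^{|\sigma|}$. Dilations of $B_0,B_\infty,C_0,C_\infty$ are translations
  in $\sigma$, so the index conditions of i) say two things: $c$ decays exponentially in $\sigma$,
  and $h=\mathrm b\cdot\varphi_F(e^{|\sigma|})$ grows exponentially in $\sigma$ (lemmas
  \<open>exp_decay_of_indices\<close> and \<open>exp_decay_of_index_gap\<close>). Case ii) is case i) after the reflection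
  $\sigma\mapsto-\sigma$. Both cases are treated at once by a sign \<open>e\<close>, with
  \<open>tail_set e u\<close> equal to $(0,u)$ or $(u,\infty)$.

  Cut the half-line into unit $\sigma$-cells $I_j$. Let $g(s)=s^{-\theta}a(s)K(s,f)$ and
  $e_j=\|g\chi_{I_j}\|_{\widetilde G}$. Bounding the inner norm by the norm over $(0,u)$ shows that
  the iterated norm is at most the simple one. For the converse let $u\in I_j$. Since $c$ decays,
  $$c(u)\|g\|_{\widetilde G(0,u)}\lesssim\sum_{n\ge0}e^{-\delta n}\,c_{j-n}e_{j-n},$$
  and the $\widehat E$ norm of a step function on the cells is invariant under the shift
  $j\mapsto j-n$, because all cells have measure 1. So the simple norm is controlled by the norm of
  the step function with values $c_je_j$, or, after one more shift, $c_{j-1}e_{j-1}$. On the other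
  hand, for $t$ in a cell before $I_{j-1}$ the interval $(t,u)$ contains $I_{j-1}$. Hence the inner
  expression at $u$ is at least $e_{j-1}\|\mathrm b\chi_{I_{j-2}}\|_{\widetilde F}$. Because $h$
  grows exponentially, both $\|\mathrm b\chi_{I_{j-2}}\|_{\widetilde F}$ and
  $\|\mathrm b\|_{\widetilde F(0,u)}$ are of the order of $h$ on $I_j$, so the quotient is at least a
  multiple of $c_{j-1}e_{j-1}$. This is carried out in \<open>iterated_norm_le\<close>,
  \<open>iterated_norm_ge\<close> and \<open>cumulative_weight_norm\<close>.

  Two general facts carry the argument. The norms of $\widetilde E$ and $\widehat E$ are given
  through the $K$-functional of $(L_1,L_\infty)$, which depends on the distribution of a function
  only (\<open>K_L1_Linf_eq_truncation\<close>); with the completeness of the parameter lattice this yields the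
  countable triangle inequality (\<open>K_space_norm_suminf\<close>) and the shift invariance
  (\<open>K_space_norm_shift\<close>). The indices are limits of quotients of a subadditive function, which exist
  by Fekete's lemma once the function is known to be bounded on some interval
  (\<open>subadditive_limit\<close>, \<open>dilation_locally_boundedI\<close>); only then do strict inequalities between
  indices turn into power bounds (\<open>rho_index_bound\<close>, \<open>pi_index_bound\<close>).\<close>

section \<open>The $K$-functional of $(L_1,L_\infty)$\<close>

lemma space_halfline [simp]: "space halfline = {0<..}"
  by (simp add: halfline_def)

lemma sets_tilde_measure [measurable_cong, simp]: "sets tilde_measure = sets halfline"
  by (simp add: tilde_measure_def)

lemma sets_hat_measure [measurable_cong, simp]: "sets hat_measure = sets halfline"
  by (simp add: hat_measure_def)

lemma space_tilde_measure [simp]: "space tilde_measure = {0<..}"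
  by (simp add: tilde_measure_def)

lemma space_hat_measure [simp]: "space hat_measure = {0<..}"
  by (simp add: hat_measure_def)

lemma AE_halflineI:
  assumes "\<And>x. 0 < x \<Longrightarrow> P x"
  shows "AE x in halfline. P x"
  using assms by (intro AE_I2) simp

lemma sets_halfline_borel: "A \<in> sets borel \<Longrightarrow> A \<subseteq> {0<..} \<Longrightarrow> A \<in> sets halfline"
  by (auto simp: halfline_def sets_restrict_space)

lemma measurable_halfline_borel: "f \<in> borel_measurable borel \<Longrightarrow> f \<in> borel_measurable halfline"
  unfolding halfline_def
  by (intro measurable_restrict_space1 measurable_completion) simp

text \<open>Superlevel sets of a monotone function are intervals. The sign \<open>e\<close> stands for the direction of
  monotonicity.\<close>

lemma measurable_oriented_mono:
  fixes f :: "real \<Rightarrow> ennreal"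
  assumes sg: "e = 1 \<or> e = - 1"
    and mono: "\<And>u v. 0 < u \<Longrightarrow> 0 < v \<Longrightarrow> e * u \<le> e * v \<Longrightarrow> f u \<le> f v"
  shows "f \<in> borel_measurable halfline"
proof (rule borel_measurableI_greater)
  fix y
  have "is_interval {x. 0 < x \<and> y < f x}"
    unfolding is_interval_1
  proof (intro ballI allI impI)
    fix p q x
    assume p: "p \<in> {x. 0 < x \<and> y < f x}" and q: "q \<in> {x. 0 < x \<and> y < f x}" and xx: "p \<le> x \<and> x \<le> q"
    then have x: "p \<le> x" "x \<le> q" by auto
    have "f p \<le> f x \<or> f q \<le> f x" using mono[of p x] mono[of q x] sg p q x by auto
    then show "x \<in> {x. 0 < x \<and> y < f x}" using p q x by (auto intro: less_le_trans)
  qed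
  then have "{x. 0 < x \<and> y < f x} \<in> sets borel" by (rule real_interval_borel_measurable)
  then show "{x \<in> space halfline. y < f x} \<in> sets halfline"
    by (intro sets_halfline_borel) auto
qed

lemma measurable_mono_halfline:
  fixes f :: "real \<Rightarrow> ennreal"
  assumes "\<And>s t. 0 < s \<Longrightarrow> s \<le> t \<Longrightarrow> f s \<le> f t"
  shows "f \<in> borel_measurable halfline"
  by (rule measurable_oriented_mono[of 1]) (use assms in auto)

text \<open>Truncation at a level is the optimal decomposition: if $f=g+h$ and $l$ is the essential supremum of
  $|h|$, then $(f-l)_+\le|g|$; conversely $(f-l)_+$ and $\min(f,l)$ are an admissible pair. So
  $K(t,f)$ depends only on the integrals of $(f-l)_+$, that is, on the distribution of $f$. The level
  $l=\infty$ is harmless because it contributes the value $\infty$.\<close>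

lemma K_L1_Linf_eq_truncation:
  assumes f: "f \<in> borel_measurable M" and t: "0 < t"
  shows "K_L1_Linf M t f = (INF l. (\<integral>\<^sup>+x. f x - l \<partial>M) + ennreal t * l)"
proof (rule antisym)
  show "K_L1_Linf M t f \<le> (INF l. (\<integral>\<^sup>+x. f x - l \<partial>M) + ennreal t * l)"
  proof (rule INF_greatest)
    fix l :: ennreal
    show "K_L1_Linf M t f \<le> (\<integral>\<^sup>+x. f x - l \<partial>M) + ennreal t * l"
    proof (cases "l = top \<or> (\<integral>\<^sup>+x. f x - l \<partial>M) = top")
      case True
      then show ?thesis using t by (auto simp: ennreal_mult_top)
    next
      case False
      then have l: "l < top" and fin: "(\<integral>\<^sup>+x. f x - l \<partial>M) \<noteq> \<infinity>" by (auto simp: less_top)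
      have "AE x in M. f x - l \<noteq> \<infinity>"
        by (rule nn_integral_PInf_AE[OF _ fin]) (use f in measurable)
      then have ae: "AE x in M. f x < top"
        by eventually_elim (use l in \<open>auto simp: less_top[symmetric]\<close>)
      define g h where "g = (\<lambda>x. enn2real (f x - l))" and "h = (\<lambda>x. enn2real (min (f x) l))"
      have gm: "g \<in> borel_measurable M" and hm: "h \<in> borel_measurable M"
        unfolding g_def h_def using f by measurable
      have g: "ennreal \<bar>g x\<bar> = f x - l" if "f x < top" for x
        using that by (auto simp: g_def ennreal_enn2real_if diff_less_top_ennreal)
      have h: "ennreal \<bar>h x\<bar> = min (f x) l" for x
        using l by (auto simp: h_def ennreal_enn2real_if min_def)
      have sum: "AE x in M. 0 \<le> g x + h x \<and> f x = ennreal (g x + h x)"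
        using ae
      proof eventually_elim
        case (elim x)
        have "ennreal (g x + h x) = ennreal \<bar>g x\<bar> + ennreal \<bar>h x\<bar>"
          by (simp add: g_def h_def)
        also have "\<dots> = (f x - l) + min (f x) l" using g h elim by simp
        also have "\<dots> = f x"
        proof (cases "l \<le> f x")
          case True
          then show ?thesis by (simp add: min_def diff_add_cancel_ennreal)
        next
          case False
          then show ?thesis using elim by (simp add: min_def diff_eq_0_iff_ennreal less_imp_le)
        qed
        finally show ?case by (simp add: g_def h_def)
      qed
      have "K_L1_Linf M t f \<le> (\<integral>\<^sup>+x. ennreal \<bar>g x\<bar> \<partial>M) + ennreal t * esssup M (\<lambda>x. ennreal \<bar>h x\<bar>)"
        unfolding K_L1_Linf_def
        by (rule INF_lower2[of "(g, h)"]) (use gm hm sum in auto)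
      also have "(\<integral>\<^sup>+x. ennreal \<bar>g x\<bar> \<partial>M) = (\<integral>\<^sup>+x. f x - l \<partial>M)"
        by (rule nn_integral_cong_AE) (use ae in \<open>eventually_elim, simp add: g\<close>)
      also have "esssup M (\<lambda>x. ennreal \<bar>h x\<bar>) \<le> l"
        proof (rule esssup_I)
        show "(\<lambda>x. ennreal \<bar>h x\<bar>) \<in> borel_measurable M" using hm by measurable
      qed (simp add: h)
      finally show ?thesis by (simp add: add_left_mono mult_left_mono)
    qed
  qed
  show "(INF l. (\<integral>\<^sup>+x. f x - l \<partial>M) + ennreal t * l) \<le> K_L1_Linf M t f"
    unfolding K_L1_Linf_def
  proof (rule INF_greatest, clarify)
    fix g h
    assume gm: "g \<in> borel_measurable M" and hm: "h \<in> borel_measurable M"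
      and ae: "AE x in M. 0 \<le> g x + h x \<and> f x = ennreal (g x + h x)"
    define l where "l = esssup M (\<lambda>x. ennreal \<bar>h x\<bar>)"
    show "(INF l. (\<integral>\<^sup>+x. f x - l \<partial>M) + ennreal t * l)
      \<le> (\<integral>\<^sup>+x. ennreal \<bar>g x\<bar> \<partial>M) + ennreal t * esssup M (\<lambda>x. ennreal \<bar>h x\<bar>)"
    proof (cases "l = top")
      case True
      then show ?thesis using t by (simp add: l_def ennreal_mult_top)
    next
      case False
      have "AE x in M. ennreal \<bar>h x\<bar> \<le> l" unfolding l_def by (rule esssup_AE)
      then have "AE x in M. f x - l \<le> ennreal \<bar>g x\<bar>"
        using ae
      proof eventually_elim
        case (elim x)
        have "f x \<le> ennreal (\<bar>g x\<bar> + \<bar>h x\<bar>)"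
          using elim by (auto intro!: ennreal_leI simp del: ennreal_plus)
        also have "\<dots> = ennreal \<bar>h x\<bar> + ennreal \<bar>g x\<bar>" by (simp add: add.commute)
        also have "\<dots> \<le> l + ennreal \<bar>g x\<bar>" using elim by (auto intro: add_right_mono)
        finally show ?case using False by (simp add: ennreal_minus_le_iff)
      qed
      then have "(\<integral>\<^sup>+x. f x - l \<partial>M) \<le> (\<integral>\<^sup>+x. ennreal \<bar>g x\<bar> \<partial>M)" by (rule nn_integral_mono_AE)
      then show ?thesis
        by (intro INF_lower2[of l]) (auto simp: l_def intro!: add_right_mono)
    qed
  qed
qed

lemma measurable_K_L1_Linf [measurable]: "(\<lambda>t. K_L1_Linf M t f) \<in> borel_measurable halfline"
proof (rule measurable_mono_halfline)
  fix s t :: real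
  assume "0 < s" "s \<le> t"
  then show "K_L1_Linf M s f \<le> K_L1_Linf M t f"
    unfolding K_L1_Linf_def
    by (intro INF_superset_mono) (auto intro!: add_left_mono mult_right_mono ennreal_leI)
qed

lemma K_L1_Linf_mono:
  assumes "f \<in> borel_measurable M" "g \<in> borel_measurable M" "0 < t" "AE x in M. f x \<le> g x"
  shows "K_L1_Linf M t f \<le> K_L1_Linf M t g"
  unfolding K_L1_Linf_eq_truncation[OF assms(1,3)] K_L1_Linf_eq_truncation[OF assms(2,3)]
  by (intro INF_superset_mono order_refl add_right_mono nn_integral_mono_AE)
     (use assms(4) in \<open>auto elim!: eventually_mono intro: ennreal_minus_mono\<close>)

lemma K_L1_Linf_zero:
  assumes "0 < t"
  shows "K_L1_Linf M t (\<lambda>x. 0) = 0"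
proof -
  have "K_L1_Linf M t (\<lambda>x. 0) \<le> (\<integral>\<^sup>+x. 0 - 0 \<partial>M) + ennreal t * 0"
    unfolding K_L1_Linf_eq_truncation[OF borel_measurable_const assms] by (rule INF_lower) simp
  then show ?thesis by simp
qed

lemma K_L1_Linf_cmult:
  assumes f: "f \<in> borel_measurable M" and t: "0 < t" and c: "0 \<le> c"
  shows "K_L1_Linf M t (\<lambda>x. ennreal c * f x) \<le> ennreal c * K_L1_Linf M t f"
proof (cases "c = 0")
  case True
  then show ?thesis using K_L1_Linf_zero[OF t] by simp
next
  case False
  with c have c: "0 < c" by simp
  have cf: "(\<lambda>x. ennreal c * f x) \<in> borel_measurable M" using f by measurable
  have inv: "ennreal (1 / c) * (ennreal c * y) = y" "ennreal c * (ennreal (1 / c) * y) = y" for y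
    using c by (simp_all add: mult.assoc[symmetric] ennreal_mult[symmetric])
  have "ennreal (1 / c) * K_L1_Linf M t (\<lambda>x. ennreal c * f x) \<le> K_L1_Linf M t f"
    unfolding K_L1_Linf_eq_truncation[OF f t]
  proof (rule INF_greatest)
    fix l
    have "K_L1_Linf M t (\<lambda>x. ennreal c * f x)
      \<le> (\<integral>\<^sup>+x. ennreal c * f x - ennreal c * l \<partial>M) + ennreal t * (ennreal c * l)"
      unfolding K_L1_Linf_eq_truncation[OF cf t] by (rule INF_lower) simp
    also have "\<dots> = ennreal c * ((\<integral>\<^sup>+x. f x - l \<partial>M) + ennreal t * l)"
      using f by (subst ennreal_right_diff_distrib[symmetric])
        (auto simp: nn_integral_cmult distrib_left ac_simps)
    finally show "ennreal (1 / c) * K_L1_Linf M t (\<lambda>x. ennreal c * f x)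
        \<le> (\<integral>\<^sup>+x. f x - l \<partial>M) + ennreal t * l"
      using mult_left_mono inv(1) by (metis zero_le)
  qed
  then have "ennreal c * (ennreal (1 / c) * K_L1_Linf M t (\<lambda>x. ennreal c * f x))
      \<le> ennreal c * K_L1_Linf M t f" by (rule mult_left_mono) simp
  then show ?thesis by (simp only: inv)
qed

text \<open>Nearly optimal levels $l_n$ for the summands are added up, using
  $\big(\sum f_n-\sum l_n\big)_+\le\sum(f_n-l_n)_+$.\<close>

lemma K_L1_Linf_suminf:
  assumes f: "\<And>n::nat. f n \<in> borel_measurable M" and t: "0 < t"
  shows "K_L1_Linf M t (\<lambda>x. \<Sum>n. f n x) \<le> (\<Sum>n. K_L1_Linf M t (f n))"
proof (cases "(\<Sum>n. K_L1_Linf M t (f n)) = top")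
  case False
  let ?v = "\<lambda>n l. (\<integral>\<^sup>+x. f n x - l \<partial>M) + ennreal t * l"
  have sm: "(\<lambda>x. \<Sum>n. f n x) \<in> borel_measurable M" using f by measurable
  have fin: "K_L1_Linf M t (f n) < top" for n
    using False by (metis ennreal_suminf_lessD less_top)
  show ?thesis
  proof (rule ennreal_le_epsilon)
    fix e :: real
    assume "0 < e"
    have "\<exists>l. ?v n l < K_L1_Linf M t (f n) + ennreal (e * (1/2) ^ Suc n)" for n
    proof -
      have "K_L1_Linf M t (f n) < K_L1_Linf M t (f n) + ennreal (e * (1/2) ^ Suc n)"
        using fin[of n] \<open>0 < e\<close>
        by (cases "K_L1_Linf M t (f n)") (auto simp flip: ennreal_plus intro!: ennreal_lessI add_nonneg_pos)
      then show ?thesis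
        unfolding K_L1_Linf_eq_truncation[OF f t] INF_less_iff by auto
    qed
    then obtain l where l: "\<And>n. ?v n (l n) < K_L1_Linf M t (f n) + ennreal (e * (1/2) ^ Suc n)"
      by metis
    have "(\<lambda>n. e * (1/2) ^ Suc n) sums (e * 1)"
      by (intro sums_mult power_half_series)
    then have e: "(\<Sum>n. ennreal (e * (1/2) ^ Suc n)) = ennreal e"
      using \<open>0 < e\<close> by (intro suminf_ennreal_eq) auto
    have "(\<Sum>n. ?v n (l n)) \<le> (\<Sum>n. K_L1_Linf M t (f n) + ennreal (e * (1/2) ^ Suc n))"
      by (intro suminf_le) (use l in \<open>auto intro: less_imp_le\<close>)
    also have "\<dots> = (\<Sum>n. K_L1_Linf M t (f n)) + ennreal e"
      by (subst suminf_add[symmetric]) (auto simp only: e summableI)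
    finally have le: "(\<Sum>n. ?v n (l n)) \<le> (\<Sum>n. K_L1_Linf M t (f n)) + ennreal e" .
    have v: "(\<Sum>n. ?v n (l n)) = (\<integral>\<^sup>+x. (\<Sum>n. f n x - l n) \<partial>M) + ennreal t * (\<Sum>n. l n)"
      using f by (simp add: suminf_add[symmetric] nn_integral_suminf ennreal_suminf_cmult)
    have "(\<Sum>n. K_L1_Linf M t (f n)) + ennreal e < top"
      using False by (simp add: less_top[symmetric])
    with le have "(\<Sum>n. ?v n (l n)) < top" by (rule order_le_less_trans)
    then have lfin: "(\<Sum>n. l n) \<noteq> top" using t unfolding v by (auto simp: ennreal_mult_top)
    have "K_L1_Linf M t (\<lambda>x. \<Sum>n. f n x)
      \<le> (\<integral>\<^sup>+x. (\<Sum>n. f n x) - (\<Sum>n. l n) \<partial>M) + ennreal t * (\<Sum>n. l n)"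
      unfolding K_L1_Linf_eq_truncation[OF sm t] by (rule INF_lower) simp
    also have "\<dots> \<le> (\<integral>\<^sup>+x. (\<Sum>n. f n x - l n) \<partial>M) + ennreal t * (\<Sum>n. l n)"
    proof (intro add_right_mono nn_integral_mono)
      fix x
      have "(\<Sum>n. f n x) \<le> (\<Sum>n. l n + (f n x - l n))"
        by (intro suminf_le) (auto simp: add_diff_self_ennreal)
      also have "\<dots> = (\<Sum>n. l n) + (\<Sum>n. f n x - l n)" by (simp add: suminf_add)
      finally show "(\<Sum>n. f n x) - (\<Sum>n. l n) \<le> (\<Sum>n. f n x - l n)"
        using lfin by (simp add: ennreal_minus_le_iff)
    qed
    finally show "K_L1_Linf M t (\<lambda>x. \<Sum>n. f n x) \<le> (\<Sum>n. K_L1_Linf M t (f n)) + ennreal e"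
      using le unfolding v by (rule order_trans)
  qed
qed simp

lemma K_L1_Linf_indicator:
  assumes A: "A \<in> sets M" and t: "0 < t"
  shows "K_L1_Linf M t (indicator A) = (INF l. (1 - l) * emeasure M A + ennreal t * l)"
proof -
  have "(\<integral>\<^sup>+x. indicator A x - l \<partial>M) = (1 - l) * emeasure M A" for l
  proof -
    have "(\<integral>\<^sup>+x. indicator A x - l \<partial>M) = (\<integral>\<^sup>+x. (1 - l) * indicator A x \<partial>M)"
      by (intro nn_integral_cong) (auto simp: indicator_def)
    then show ?thesis using A by (simp add: nn_integral_cmult_indicator)
  qed
  then show ?thesis
    using A t by (subst K_L1_Linf_eq_truncation) auto
qed

text \<open>If all level sets of an integer-valued function have measure 1, it transports the measure to the
  counting measure on the integers, which is invariant under translations.\<close>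

lemma K_L1_Linf_level_sets:
  fixes J :: "real \<Rightarrow> int"
  assumes J: "J \<in> M \<rightarrow>\<^sub>M count_space UNIV" and t: "0 < t"
    and m: "\<And>j. emeasure M {x \<in> space M. J x = j} = 1"
  shows "K_L1_Linf M t (\<lambda>x. s (J x))
    = (INF l. (\<integral>\<^sup>+j. s j - l \<partial>count_space UNIV) + ennreal t * l)"
proof -
  have "(\<integral>\<^sup>+x. s (J x) - l \<partial>M) = (\<integral>\<^sup>+j. s j - l \<partial>count_space UNIV)" for l
  proof -
    have "(\<integral>\<^sup>+x. s (J x) - l \<partial>M) = (\<integral>\<^sup>+j. s j - l \<partial>distr M (count_space UNIV) J)"
      using J by (subst nn_integral_distr) auto
    also have "distr M (count_space UNIV) J = count_space UNIV"
    proof (rule measure_eqI_countable[of _ UNIV])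
      fix j :: int
      have "J -` {j} \<inter> space M = {x \<in> space M. J x = j}" by auto
      then show "emeasure (distr M (count_space UNIV) J) {j} = emeasure (count_space UNIV) {j}"
        using J m[of j] by (simp add: emeasure_distr)
    qed auto
    finally show ?thesis .
  qed
  moreover have "(\<lambda>x. s (J x)) \<in> borel_measurable M" using J by measurable
  ultimately show ?thesis
    using t by (subst K_L1_Linf_eq_truncation) auto
qed

lemma K_L1_Linf_shift:
  fixes J :: "real \<Rightarrow> int"
  assumes J: "J \<in> M \<rightarrow>\<^sub>M count_space UNIV" and t: "0 < t"
    and m: "\<And>j. emeasure M {x \<in> space M. J x = j} = 1"
  shows "K_L1_Linf M t (\<lambda>x. s (J x - i)) = K_L1_Linf M t (\<lambda>x. s (J x))"
proof -
  have "(\<integral>\<^sup>+j. s (j - i) - l \<partial>count_space UNIV) = (\<integral>\<^sup>+j. s j - l \<partial>count_space UNIV)" for l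
    by (rule nn_integral_bij_count_space[of "\<lambda>j. j - i" UNIV UNIV "\<lambda>j. s j - l"])
       (auto intro!: bij_betw_byWitness[where f' = "\<lambda>j. j + i"])
  then show ?thesis
    using K_L1_Linf_level_sets[OF J t m, of s] K_L1_Linf_level_sets[OF J t m, of "\<lambda>j. s (j - i)"]
    by simp
qed

section \<open>Norms given by a parameter lattice\<close>

lemma banach_latticeD:
  assumes "banach_lattice halfline D"
  shows banach_lattice_zero_iff:
      "f \<in> borel_measurable halfline \<Longrightarrow> D f = 0 \<longleftrightarrow> (AE x in halfline. f x = 0)"
    and banach_lattice_cmult:
      "f \<in> borel_measurable halfline \<Longrightarrow> 0 \<le> c \<Longrightarrow> D (\<lambda>x. ennreal c * f x) = ennreal c * D f"
    and banach_lattice_add: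
      "f \<in> borel_measurable halfline \<Longrightarrow> g \<in> borel_measurable halfline \<Longrightarrow>
        D (\<lambda>x. f x + g x) \<le> D f + D g"
    and banach_lattice_mono:
      "f \<in> borel_measurable halfline \<Longrightarrow> g \<in> borel_measurable halfline \<Longrightarrow>
        AE x in halfline. f x \<le> g x \<Longrightarrow> D f \<le> D g"
    and banach_lattice_finite:
      "f \<in> borel_measurable halfline \<Longrightarrow> D f < \<infinity> \<Longrightarrow> AE x in halfline. f x < \<infinity>"
  using assms unfolding banach_lattice_def lattice_norm_def by blast+

lemma banach_lattice_complete:
  assumes "banach_lattice halfline D"
    and "\<And>n::nat. f n \<in> borel_measurable halfline" "\<And>n. D (\<lambda>x. ennreal \<bar>f n x\<bar>) < \<infinity>"
    and "\<And>e. 0 < e \<Longrightarrow> \<exists>N. \<forall>m\<ge>N. \<forall>n\<ge>N. D (\<lambda>x. ennreal \<bar>f m x - f n x\<bar>) < ennreal e"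
  obtains g :: "real \<Rightarrow> real" where "g \<in> borel_measurable halfline"
    "(\<lambda>n. D (\<lambda>x. ennreal \<bar>f n x - g x\<bar>)) \<longlonglongrightarrow> 0"
  using assms unfolding banach_lattice_def by blast

lemma banach_lattice_sum:
  assumes D: "banach_lattice halfline D" and f: "\<And>n. f n \<in> borel_measurable halfline"
    and "finite I"
  shows "D (\<lambda>x. \<Sum>n\<in>I. f n x) \<le> (\<Sum>n\<in>I. D (f n))"
  using \<open>finite I\<close>
proof (induction I)
  case empty
  have "D (\<lambda>x. 0) = 0" by (subst banach_lattice_zero_iff[OF D]) auto
  then show ?case by simp
next
  case (insert i I)
  have "D (\<lambda>x. f i x + (\<Sum>n\<in>I. f n x)) \<le> D (f i) + D (\<lambda>x. \<Sum>n\<in>I. f n x)"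
    by (rule banach_lattice_add[OF D]) (use f in measurable)
  also have "\<dots> \<le> D (f i) + (\<Sum>n\<in>I. D (f n))" using insert by (intro add_left_mono)
  finally show ?case using insert by simp
qed

lemma ennreal_suminf_tail_small:
  fixes a :: "nat \<Rightarrow> ennreal"
  assumes "(\<Sum>n. a n) < top" "0 < e"
  obtains N where "\<And>m n. N \<le> m \<Longrightarrow> sum a {m..<n} < ennreal e"
proof -
  have fin: "a n < top" for n using assms(1) by (rule ennreal_suminf_lessD)
  define r where "r = (\<lambda>n. enn2real (a n))"
  have a: "a n = ennreal (r n)" for n using fin by (simp add: r_def)
  have r: "0 \<le> r n" for n by (simp add: r_def)
  have "summable r"
    using assms(1) r unfolding a by (intro summable_suminf_not_top) auto
  then obtain N where N: "\<And>m n. N \<le> m \<Longrightarrow> norm (sum r {m..<n}) < e"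
    using \<open>0 < e\<close> unfolding summable_Cauchy by blast
  have "sum a {m..<n} < ennreal e" if "N \<le> m" for m n
  proof -
    have "sum a {m..<n} = ennreal (sum r {m..<n})" unfolding a using r by (simp add: sum_ennreal)
    also have "\<dots> < ennreal e"
      using N[OF that, of n] r \<open>0 < e\<close> by (intro ennreal_lessI) (auto simp: abs_less_iff)
    finally show ?thesis .
  qed
  then show ?thesis using that by blast
qed

text \<open>A Riesz--Fischer argument. No Fatou property is at hand for a parameter lattice, but completeness
  replaces it: the partial sums converge in norm to some $g$, the function $g$ dominates every partial
  sum almost everywhere, and its norm is at most the sum of the norms.\<close>

lemma banach_lattice_suminf:
  assumes D: "banach_lattice halfline D" and f: "\<And>n::nat. f n \<in> borel_measurable halfline"
  shows "D (\<lambda>x. \<Sum>n. f n x) \<le> (\<Sum>n. D (f n))"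
proof (cases "(\<Sum>n. D (f n)) = top")
  case False
  then have fin: "(\<Sum>n. D (f n)) < top" by (simp add: less_top)
  have Df: "D (f n) < \<infinity>" for n using ennreal_suminf_lessD[OF fin] by simp
  define r where "r = (\<lambda>n x. enn2real (f n x))"
  define s where "s = (\<lambda>N x. \<Sum>n<N. r n x)"
  have [measurable]: "f n \<in> borel_measurable halfline" for n by (rule f)
  have [measurable]: "r n \<in> borel_measurable halfline" for n unfolding r_def by measurable
  have [measurable]: "s n \<in> borel_measurable halfline" for n unfolding s_def by measurable
  have r0: "0 \<le> r n x" for n x by (simp add: r_def)
  have "AE x in halfline. \<forall>n. f n x < top"
    using banach_lattice_finite[OF D f Df] by (simp add: AE_all_countable)
  then have ae: "AE x in halfline. \<forall>n. f n x = ennreal (r n x)"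
    by eventually_elim (simp add: r_def)
  have diff: "D (\<lambda>x. ennreal \<bar>s n x - s m x\<bar>) \<le> (\<Sum>k\<in>{m..<n}. D (f k))" if "m \<le> n" for m n
  proof -
    have "D (\<lambda>x. ennreal \<bar>s n x - s m x\<bar>) \<le> D (\<lambda>x. \<Sum>k\<in>{m..<n}. f k x)"
    proof (rule banach_lattice_mono[OF D])
      show "AE x in halfline. ennreal \<bar>s n x - s m x\<bar> \<le> (\<Sum>k\<in>{m..<n}. f k x)"
        using ae
      proof eventually_elim
        case (elim x)
        have "s n x - s m x = (\<Sum>k\<in>{m..<n}. r k x)"
          unfolding s_def using that by (simp add: sum_diff_nat_ivl lessThan_atLeast0)
        then have "ennreal \<bar>s n x - s m x\<bar> = ennreal (\<Sum>k\<in>{m..<n}. r k x)"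
          using r0 by (simp add: sum_nonneg)
        also have "\<dots> = (\<Sum>k\<in>{m..<n}. f k x)" using r0 elim by (simp add: sum_ennreal)
        finally show ?case by simp
      qed
    qed measurable
    also have "\<dots> \<le> (\<Sum>k\<in>{m..<n}. D (f k))" by (rule banach_lattice_sum[OF D]) auto
    finally show ?thesis .
  qed
  have diff': "D (\<lambda>x. ennreal \<bar>s m x - s n x\<bar>) \<le> (\<Sum>k\<in>{m..<n}. D (f k))" if "m \<le> n" for m n
    using diff[OF that] by (simp add: abs_minus_commute)
  have s0: "s 0 x = 0" for x by (simp add: s_def)
  have partial: "D (\<lambda>x. ennreal \<bar>s n x\<bar>) \<le> (\<Sum>n. D (f n))" for n
  proof -
    have "D (\<lambda>x. ennreal \<bar>s n x\<bar>) \<le> (\<Sum>k\<in>{0..<n}. D (f k))"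
      using diff[of 0 n] by (simp add: s0)
    also have "\<dots> \<le> (\<Sum>n. D (f n))" by (rule sum_le_suminf) auto
    finally show ?thesis .
  qed
  obtain g where [measurable]: "g \<in> borel_measurable halfline"
    and g: "(\<lambda>n. D (\<lambda>x. ennreal \<bar>s n x - g x\<bar>)) \<longlonglongrightarrow> 0"
  proof (rule banach_lattice_complete[OF D, of s])
    show "D (\<lambda>x. ennreal \<bar>s n x\<bar>) < \<infinity>" for n using partial[of n] fin by (simp add: order_le_less_trans)
    fix e :: real
    assume "0 < e"
    obtain N where N: "\<And>m n. N \<le> m \<Longrightarrow> (\<Sum>k\<in>{m..<n}. D (f k)) < ennreal e"
      using ennreal_suminf_tail_small[OF fin \<open>0 < e\<close>] by metis
    have "D (\<lambda>x. ennreal \<bar>s m x - s n x\<bar>) < ennreal e" if "N \<le> m" "N \<le> n" for m n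
      using diff'[of m n] diff[of n m] N[OF that(1), of n] N[OF that(2), of m]
      by (cases "m \<le> n") (auto intro: order_le_less_trans)
    then show "\<exists>N. \<forall>m\<ge>N. \<forall>n\<ge>N. D (\<lambda>x. ennreal \<bar>s m x - s n x\<bar>) < ennreal e" by blast
  qed auto
  have le_g: "AE x in halfline. s n x \<le> g x" for n
  proof -
    have "D (\<lambda>x. ennreal (s n x - g x)) \<le> D (\<lambda>x. ennreal \<bar>s m x - g x\<bar>)" if "n \<le> m" for m
    proof (intro banach_lattice_mono[OF D] AE_I2 ennreal_leI)
      fix x
      have "s n x \<le> s m x"
        unfolding s_def using that r0 by (intro sum_mono2) auto
      then show "s n x - g x \<le> \<bar>s m x - g x\<bar>" by simp
    qed measurable
    then have "D (\<lambda>x. ennreal (s n x - g x)) \<le> 0"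
      by (intro tendsto_lowerbound[OF g]) (auto simp: eventually_sequentially)
    then have "AE x in halfline. ennreal (s n x - g x) = 0"
      by (subst banach_lattice_zero_iff[OF D, symmetric]) auto
    then show ?thesis by eventually_elim (simp add: ennreal_eq_0_iff)
  qed
  have "D (\<lambda>x. \<Sum>n. f n x) \<le> D (\<lambda>x. ennreal \<bar>g x\<bar>)"
  proof (rule banach_lattice_mono[OF D])
    have "AE x in halfline. \<forall>n. s n x \<le> g x" using le_g by (simp add: AE_all_countable)
    then show "AE x in halfline. (\<Sum>n. f n x) \<le> ennreal \<bar>g x\<bar>"
      using ae
    proof eventually_elim
      case (elim x)
      have "(\<Sum>k<n. f k x) \<le> ennreal \<bar>g x\<bar>" for n
      proof -
        have "(\<Sum>k<n. f k x) = ennreal (s n x)" using elim r0 by (simp add: s_def sum_ennreal)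
        also have "\<dots> \<le> ennreal \<bar>g x\<bar>" using elim by (intro ennreal_leI) (simp add: abs_le_iff le_max_iff_disj order_trans[OF _ abs_ge_self])
        finally show ?thesis .
      qed
      then show ?case by (simp add: suminf_eq_SUP SUP_least)
    qed
  qed measurable
  also have "\<dots> \<le> (\<Sum>n. D (f n))"
  proof -
    have "D (\<lambda>x. ennreal \<bar>g x\<bar>) \<le> (\<Sum>n. D (f n)) + D (\<lambda>x. ennreal \<bar>s n x - g x\<bar>)" for n
    proof -
      have "D (\<lambda>x. ennreal \<bar>g x\<bar>) \<le> D (\<lambda>x. ennreal \<bar>s n x\<bar> + ennreal \<bar>s n x - g x\<bar>)"
      proof (intro banach_lattice_mono[OF D] AE_I2)
        fix x
        have "ennreal \<bar>g x\<bar> \<le> ennreal (\<bar>s n x\<bar> + \<bar>s n x - g x\<bar>)"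
          by (intro ennreal_leI) linarith
        then show "ennreal \<bar>g x\<bar> \<le> ennreal \<bar>s n x\<bar> + ennreal \<bar>s n x - g x\<bar>" by simp
      qed measurable
      also have "\<dots> \<le> D (\<lambda>x. ennreal \<bar>s n x\<bar>) + D (\<lambda>x. ennreal \<bar>s n x - g x\<bar>)"
        by (rule banach_lattice_add[OF D]) measurable
      finally show ?thesis using partial[of n] by (meson add_right_mono order_trans)
    qed
    moreover have "(\<lambda>n. (\<Sum>n. D (f n)) + D (\<lambda>x. ennreal \<bar>s n x - g x\<bar>)) \<longlonglongrightarrow> (\<Sum>n. D (f n)) + 0"
      by (intro tendsto_add tendsto_const g)
    ultimately show ?thesis by (intro LIMSEQ_le_const) auto
  qed
  finally show ?thesis .
qed simp

lemma K_space_norm_mono: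
  assumes D: "banach_lattice halfline D"
    and "f \<in> borel_measurable M" "g \<in> borel_measurable M" "AE x in M. f x \<le> g x"
  shows "K_space_norm M D f \<le> K_space_norm M D g"
  unfolding K_space_norm_def
  by (intro banach_lattice_mono[OF D] AE_halflineI K_L1_Linf_mono assms(2-)) auto

lemma K_space_norm_cmult:
  assumes D: "banach_lattice halfline D" and f: "f \<in> borel_measurable M" and c: "0 \<le> c"
  shows "K_space_norm M D (\<lambda>x. ennreal c * f x) \<le> ennreal c * K_space_norm M D f"
proof -
  have "K_space_norm M D (\<lambda>x. ennreal c * f x) \<le> D (\<lambda>t. ennreal c * K_L1_Linf M t f)"
    unfolding K_space_norm_def
    by (intro banach_lattice_mono[OF D] AE_halflineI K_L1_Linf_cmult[OF f _ c]) auto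
  then show ?thesis
    unfolding K_space_norm_def by (subst (asm) banach_lattice_cmult[OF D _ c]) auto
qed

lemma K_space_norm_suminf:
  assumes D: "banach_lattice halfline D" and f: "\<And>n::nat. f n \<in> borel_measurable M"
  shows "K_space_norm M D (\<lambda>x. \<Sum>n. f n x) \<le> (\<Sum>n. K_space_norm M D (f n))"
proof -
  have "K_space_norm M D (\<lambda>x. \<Sum>n. f n x) \<le> D (\<lambda>t. \<Sum>n. K_L1_Linf M t (f n))"
    unfolding K_space_norm_def
    by (intro banach_lattice_mono[OF D] AE_halflineI K_L1_Linf_suminf f) auto
  also have "\<dots> \<le> (\<Sum>n. K_space_norm M D (f n))"
    unfolding K_space_norm_def by (intro banach_lattice_suminf[OF D]) auto
  finally show ?thesis .
qed

lemma K_space_norm_indicator_mono: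
  assumes D: "banach_lattice halfline D"
    and A: "A \<in> sets M" and B: "B \<in> sets N" and le: "emeasure M A \<le> emeasure N B"
  shows "K_space_norm M D (indicator A) \<le> K_space_norm N D (indicator B)"
  unfolding K_space_norm_def
proof (intro banach_lattice_mono[OF D] AE_halflineI)
  fix t :: real
  assume "0 < t"
  then show "K_L1_Linf M t (indicator A) \<le> K_L1_Linf N t (indicator B)"
    unfolding K_L1_Linf_indicator[OF A \<open>0 < t\<close>] K_L1_Linf_indicator[OF B \<open>0 < t\<close>]
    by (intro INF_superset_mono order_refl add_right_mono mult_left_mono le) auto
qed auto

lemma K_space_norm_shift:
  fixes J :: "real \<Rightarrow> int"
  assumes D: "banach_lattice halfline D"
    and J: "J \<in> M \<rightarrow>\<^sub>M count_space UNIV"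
    and m: "\<And>j. emeasure M {x \<in> space M. J x = j} = 1"
  shows "K_space_norm M D (\<lambda>x. s (J x - i)) \<le> K_space_norm M D (\<lambda>x. s (J x))"
  unfolding K_space_norm_def
  by (intro banach_lattice_mono[OF D] AE_halflineI) (auto simp: K_L1_Linf_shift[OF J _ m])

section \<open>The logarithmic coordinate\<close>

text \<open>The coordinate $\sigma$ and its inverse \<open>exp_scale\<close>. The functions $B_0,B_\infty$ are \<open>b\<close> at
  $\sigma=\mp\ln(1/u)$: $\mathrm b(e^{1-1/u})$ and $\mathrm b(e^{1/u-1})$ with $u=e^{-r}$ are the
  values of \<open>b\<close> at \<open>exp_scale (- r)\<close> and \<open>exp_scale r\<close>.\<close>

definition log_scale :: "real \<Rightarrow> real" where
  "log_scale u = sgn (ln u) * ln (ell u)"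

definition signed_expm1 :: "real \<Rightarrow> real" where
  "signed_expm1 x = sgn x * (exp \<bar>x\<bar> - 1)"

definition exp_scale :: "real \<Rightarrow> real" where
  "exp_scale x = exp (signed_expm1 x)"

lemma signed_expm1_minus: "signed_expm1 (- x) = - signed_expm1 x"
  by (simp add: signed_expm1_def sgn_minus)

lemma signed_expm1_nonneg: "0 \<le> x \<Longrightarrow> signed_expm1 x = exp x - 1"
  by (cases "x = 0") (auto simp: signed_expm1_def)

lemma signed_expm1_nonpos: "x \<le> 0 \<Longrightarrow> signed_expm1 x = 1 - exp (- x)"
  by (cases "x = 0") (auto simp: signed_expm1_def)

lemma strict_mono_signed_expm1: "strict_mono signed_expm1"
proof (rule strict_monoI)
  fix x y :: real
  assume "x < y"
  then consider "0 \<le> x" | "y \<le> 0" | "x < 0" "0 < y" by linarith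
  then show "signed_expm1 x < signed_expm1 y"
  proof cases
    case 3
    then have "signed_expm1 x < 0" "0 < signed_expm1 y"
      by (simp_all add: signed_expm1_nonpos signed_expm1_nonneg)
    then show ?thesis by simp
  qed (use \<open>x < y\<close> in \<open>auto simp: signed_expm1_nonpos signed_expm1_nonneg\<close>)
qed

lemma exp_scale_pos [simp]: "0 < exp_scale x"
  by (simp add: exp_scale_def)

lemma ln_exp_scale: "ln (exp_scale x) = signed_expm1 x"
  by (simp add: exp_scale_def)

lemma strict_mono_exp_scale: "strict_mono exp_scale"
  using strict_mono_signed_expm1 by (auto simp: strict_mono_def exp_scale_def)

lemma exp_scale_less_iff [simp]: "exp_scale x < exp_scale y \<longleftrightarrow> x < y"
  using strict_mono_less[OF strict_mono_exp_scale] .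

lemma exp_scale_log_scale [simp]: "0 < u \<Longrightarrow> exp_scale (log_scale u) = u"
proof -
  assume u: "0 < u"
  consider "ln u = 0" | "0 < ln u" | "ln u < 0" by linarith
  then have "signed_expm1 (log_scale u) = ln u"
  proof cases
    case 2
    then have "log_scale u = ln (1 + ln u)" "0 \<le> ln (1 + ln u)"
      by (simp_all add: log_scale_def ell_def)
    then show ?thesis using 2 by (simp add: signed_expm1_nonneg)
  next
    case 3
    then have "log_scale u = - ln (1 - ln u)" "0 \<le> ln (1 - ln u)"
      by (simp_all add: log_scale_def ell_def)
    then show ?thesis using 3 by (simp add: signed_expm1_nonpos)
  qed (simp add: log_scale_def signed_expm1_def)
  then show ?thesis using u by (simp add: exp_scale_def)
qed

lemma log_less_exp_scale_iff: "0 < u \<Longrightarrow> u < exp_scale x \<longleftrightarrow> log_scale u < x"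
  using exp_scale_less_iff[of "log_scale u" x] by simp

lemma exp_scale_less_log_iff: "0 < u \<Longrightarrow> exp_scale x < u \<longleftrightarrow> x < log_scale u"
  using exp_scale_less_iff[of x "log_scale u"] by simp

lemma log_scale_less_iff: "0 < u \<Longrightarrow> 0 < v \<Longrightarrow> log_scale u < log_scale v \<longleftrightarrow> u < v"
  using exp_scale_less_iff[of "log_scale u" "log_scale v"] by simp

lemma measurable_log_scale [measurable]: "log_scale \<in> borel_measurable halfline"
proof -
  have "log_scale \<in> borel_measurable borel"
    unfolding log_scale_def[abs_def] ell_def[abs_def] by measurable
  then show ?thesis by (rule measurable_halfline_borel)
qed

lemma AE_halfline_neq: "AE x in halfline. x \<noteq> (p::real)"
proof -
  have "AE x in lborel. x \<noteq> p" by (rule AE_lborel_singleton)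
  then have "AE x in lebesgue. x \<noteq> p" by (simp add: AE_completion)
  then show ?thesis unfolding halfline_def by (subst AE_restrict_space_iff) auto
qed

text \<open>The set \<open>S\<close> is an interval with or without its end points; which of them belong to a cell depends
  on the orientation.\<close>

lemma emeasure_density_halfline_FTC:
  fixes f F :: "real \<Rightarrow> real"
  assumes f: "f \<in> borel_measurable borel" and pq: "0 < p" "p \<le> q"
    and F: "\<And>x. p \<le> x \<Longrightarrow> x \<le> q \<Longrightarrow> (F has_real_derivative f x) (at x)"
    and f0: "\<And>x. p \<le> x \<Longrightarrow> x \<le> q \<Longrightarrow> 0 \<le> f x"
    and S: "S \<in> sets halfline" "{p<..<q} \<subseteq> S" "S \<subseteq> {p..q}"
  shows "emeasure (density halfline (\<lambda>x. ennreal (f x))) S = ennreal (F q - F p)"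
proof -
  have fl: "(\<lambda>x. ennreal (f x)) \<in> borel_measurable halfline"
    using f by (intro measurable_halfline_borel) measurable
  have "emeasure (density halfline (\<lambda>x. ennreal (f x))) S
      = (\<integral>\<^sup>+x. ennreal (f x) * indicator S x \<partial>halfline)"
    using fl S by (simp add: emeasure_density)
  also have "\<dots> = (\<integral>\<^sup>+x. ennreal (f x) * indicator {p..q} x \<partial>halfline)"
  proof (rule nn_integral_cong_AE)
    show "AE x in halfline. ennreal (f x) * indicator S x = ennreal (f x) * indicator {p..q} x"
      using AE_halfline_neq[of p] AE_halfline_neq[of q]
    proof eventually_elim
      case (elim x)
      then have "x \<in> S \<longleftrightarrow> x \<in> {p..q}" using S(2,3) by force
      then show ?case by (simp add: indicator_def)
    qed
  qed
  also have "\<dots> = (\<integral>\<^sup>+x. ennreal (f x) * indicator {p..q} x * indicator {0<..} x \<partial>lebesgue)"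
    unfolding halfline_def by (subst nn_integral_restrict_space) auto
  also have "\<dots> = (\<integral>\<^sup>+x. ennreal (f x) * indicator {p..q} x \<partial>lebesgue)"
    using pq by (intro nn_integral_cong) (auto simp: indicator_def)
  also have "\<dots> = (\<integral>\<^sup>+x. ennreal (f x) * indicator {p..q} x \<partial>lborel)"
    by (rule nn_integral_completion)
  also have "\<dots> = ennreal (F q - F p)"
    using F f0 pq
    by (intro nn_integral_FTC_Icc f)
       (auto intro: has_vector_derivative_at_within
             simp: has_real_derivative_iff_has_vector_derivative[symmetric])
  finally show ?thesis .
qed

lemma emeasure_tilde_interval:
  assumes "0 < p" "p \<le> q" "S \<in> sets halfline" "{p<..<q} \<subseteq> S" "S \<subseteq> {p..q}"
  shows "emeasure tilde_measure S = ennreal (ln q - ln p)"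
  unfolding tilde_measure_def
  by (rule emeasure_density_halfline_FTC[OF _ assms(1,2) _ _ assms(3-)])
     (use assms(1) in \<open>auto intro!: derivative_eq_intros simp: divide_simps\<close>)

lemma emeasure_halfline_interval:
  assumes "0 < r"
  shows "emeasure halfline {0<..<r} = ennreal r"
proof -
  have "emeasure halfline {0<..<r} = emeasure lebesgue {0<..<r}"
    unfolding halfline_def by (subst emeasure_restrict_space) auto
  then show ?thesis using assms by simp
qed

text \<open>The antiderivative of $1/(t\,\ell(t))$ is $\ln(1+\ln t)$ for $t\ge1$ and $-\ln(1-\ln t)$ for
  $t\le1$; an interval that does not cross 0 needs only one of the two formulas.\<close>

lemma emeasure_hat_interval:
  assumes xy: "x \<le> y" "0 \<le> x \<or> y \<le> 0"
    and S: "S \<in> sets halfline" "{exp_scale x<..<exp_scale y} \<subseteq> S" "S \<subseteq> {exp_scale x..exp_scale y}"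
  shows "emeasure hat_measure S = ennreal (y - x)"
proof -
  let ?p = "exp_scale x" and ?q = "exp_scale y"
  have pq: "?p \<le> ?q" using xy(1) exp_scale_less_iff[of y x] by linarith
  have f: "(\<lambda>t. 1 / (t * ell t)) \<in> borel_measurable borel" unfolding ell_def[abs_def] by measurable
  have f0: "0 \<le> 1 / (t * ell t)" if "?p \<le> t" for t
    using that order_less_le_trans[OF exp_scale_pos[of x] that] by (simp add: ell_def)
  show ?thesis
  proof (cases "0 \<le> x")
    case True
    have "emeasure hat_measure S = ennreal (ln (1 + ln ?q) - ln (1 + ln ?p))"
      unfolding hat_measure_def
    proof (rule emeasure_density_halfline_FTC[OF f exp_scale_pos pq _ f0 S])
      fix t assume t: "?p \<le> t"
      have "1 \<le> ?p" using True by (simp add: exp_scale_def signed_expm1_nonneg)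
      with t have t1: "1 \<le> t" by simp
      then have "((\<lambda>t. ln (1 + ln t)) has_real_derivative (1 / t) / (1 + ln t)) (at t)"
        by (auto intro!: derivative_eq_intros simp: add_pos_nonneg)
      then show "((\<lambda>t. ln (1 + ln t)) has_real_derivative 1 / (t * ell t)) (at t)"
        using t1 by (simp add: ell_def)
    qed
    then show ?thesis using True xy by (simp add: ln_exp_scale signed_expm1_nonneg)
  next
    case False
    then have y0: "y \<le> 0" and x0: "x \<le> 0" using xy by auto
    have "emeasure hat_measure S = ennreal ((- ln (1 - ln ?q)) - (- ln (1 - ln ?p)))"
      unfolding hat_measure_def
    proof (rule emeasure_density_halfline_FTC[OF f exp_scale_pos pq _ f0 S])
      fix t assume t: "?p \<le> t" "t \<le> ?q"
      have "?q \<le> 1" using y0 by (simp add: exp_scale_def signed_expm1_nonpos)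
      with t have t1: "t \<le> 1" by simp
      have t0: "0 < t" using t by (meson exp_scale_pos order_less_le_trans)
      have l: "ln t \<le> 0" using t0 t1 by simp
      have "((\<lambda>t. - ln (1 - ln t)) has_real_derivative - ((- (1 / t)) / (1 - ln t))) (at t)"
      proof -
        have "0 < 1 - ln t" using l by simp
        then show ?thesis using t0 by (auto intro!: derivative_eq_intros simp del: diff_gt_0_iff_gt)
      qed
      then show "((\<lambda>t. - ln (1 - ln t)) has_real_derivative 1 / (t * ell t)) (at t)"
        using l by (simp add: ell_def)
    qed
    then show ?thesis using y0 x0 by (simp add: ln_exp_scale signed_expm1_nonpos)
  qed
qed

section \<open>Subadditive functions and extension indices\<close>

lemma subadditive_multiple:
  fixes w :: "real \<Rightarrow> real"
  assumes sub: "\<And>x y. 0 < x \<Longrightarrow> 0 < y \<Longrightarrow> w (x + y) \<le> w x + w y" and "0 < x"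
  shows "w (real (Suc n) * x) \<le> real (Suc n) * w x"
proof (induction n)
  case (Suc n)
  have "real (Suc (Suc n)) * x = real (Suc n) * x + x" by (simp add: algebra_simps)
  then have "w (real (Suc (Suc n)) * x) \<le> w (real (Suc n) * x) + w x"
    using sub[of "real (Suc n) * x" x] \<open>0 < x\<close> by simp
  also have "\<dots> \<le> real (Suc n) * w x + w x" using Suc by simp
  finally show ?case by (simp add: algebra_simps)
qed simp

text \<open>The multiples $[n\alpha,n\beta]$ of an interval eventually overlap and cover a neighbourhood of
  infinity.\<close>

lemma subadditive_linear_bound:
  fixes w :: "real \<Rightarrow> real"
  assumes sub: "\<And>x y. 0 < x \<Longrightarrow> 0 < y \<Longrightarrow> w (x + y) \<le> w x + w y"
    and ab: "0 < \<alpha>" "\<alpha> < \<beta>" and bd: "\<And>x. \<alpha> \<le> x \<Longrightarrow> x \<le> \<beta> \<Longrightarrow> w x \<le> M"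
  obtains A K where "0 < A" "0 \<le> K" "\<And>x. A \<le> x \<Longrightarrow> w x \<le> K * x"
proof -
  obtain k :: nat where k: "\<alpha> / (\<beta> - \<alpha>) < real k" using reals_Archimedean2 by blast
  have k': "\<alpha> < real k * (\<beta> - \<alpha>)" using k ab by (simp add: divide_simps)
  have "0 < real k" using order_less_trans[OF _ k, of 0] ab by simp
  have "w x \<le> (\<bar>M\<bar> / \<alpha>) * x" if x: "real k * \<alpha> \<le> x" for x
  proof -
    \<comment> \<open>\<open>n\<close> is chosen so that \<open>x / n\<close> lies in the interval where \<open>w\<close> is bounded.\<close>
    define n where "n = nat \<lfloor>x / \<alpha>\<rfloor>"
    have x0: "0 < x" using x \<open>0 < real k\<close> ab by (meson mult_pos_pos order_less_le_trans)
    have "real k \<le> x / \<alpha>" using x ab by (simp add: divide_simps mult.commute)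
    then have kn: "k \<le> n" unfolding n_def by (simp add: le_nat_floor)
    have n: "real n \<le> x / \<alpha>" "x / \<alpha> < real n + 1"
      unfolding n_def using x0 ab by auto
    have n0: "0 < real n" using kn \<open>0 < real k\<close> by simp
    have lo: "\<alpha> \<le> x / real n" using n n0 ab by (simp add: divide_simps mult.commute)
    have "x < real n * \<alpha> + \<alpha>" using n ab by (simp add: divide_simps algebra_simps)
    moreover have "\<alpha> < real n * (\<beta> - \<alpha>)"
      using k' kn ab mult_right_mono[of "real k" "real n" "\<beta> - \<alpha>"] by linarith
    moreover have "real n * (\<beta> - \<alpha>) = real n * \<beta> - real n * \<alpha>" by (rule right_diff_distrib)
    ultimately have "x < real n * \<beta>" by linarith
    then have hi: "x / real n \<le> \<beta>" using n0 by (simp add: pos_divide_le_eq mult.commute)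
    have "w (real n * (x / real n)) \<le> real n * w (x / real n)"
      using subadditive_multiple[OF sub, of "x / real n" "n - 1"] x0 n0 by simp
    also have "\<dots> \<le> real n * \<bar>M\<bar>" using bd[OF lo hi] n0 by (intro mult_left_mono) auto
    also have "\<dots> \<le> (x / \<alpha>) * \<bar>M\<bar>" using n by (intro mult_right_mono) auto
    finally show ?thesis using n0 by (simp add: mult.commute)
  qed
  then show ?thesis
    using ab \<open>0 < real k\<close> that[of "real k * \<alpha>" "\<bar>M\<bar> / \<alpha>"] by simp
qed

text \<open>Fekete's lemma for a real variable; the limit is the infimum of the quotients.\<close>

lemma subadditive_limit:
  fixes w :: "real \<Rightarrow> real"
  assumes sub: "\<And>x y. 0 < x \<Longrightarrow> 0 < y \<Longrightarrow> w (x + y) \<le> w x + w y"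
    and A: "0 < A" and up: "\<And>x. A \<le> x \<Longrightarrow> w x \<le> K * x" and K: "0 \<le> K"
    and lo: "\<And>x. A \<le> x \<Longrightarrow> - L * x \<le> w x"
  obtains l where "((\<lambda>x. w x / x) \<longlongrightarrow> l) at_top"
proof -
  define l where "l = (INF x\<in>{A..}. w x / x)"
  have bdd: "bdd_below ((\<lambda>x. w x / x) ` {A..})"
    using lo A by (intro bdd_belowI2[of _ "- L"]) (auto simp: field_simps)
  have l_le: "l \<le> w x / x" if "A \<le> x" for x
    unfolding l_def using that by (intro cINF_lower[OF bdd]) auto
  have "((\<lambda>x. w x / x) \<longlongrightarrow> l) at_top"
  proof (rule tendstoI)
    fix e :: real
    assume "0 < e"
    then have "l < l + e / 2" by simp
    then obtain y where y: "A \<le> y" "w y / y < l + e / 2"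
      unfolding l_def by (subst (asm) cINF_less_iff[OF _ bdd]) auto
    have y0: "0 < y" using y A by simp
    define Q where "Q = 2 * y * (K + \<bar>l + e / 2\<bar>)"
    have "w x / x \<le> l + e / 2 + Q / x" if x: "2 * y \<le> x" for x
    proof -
      \<comment> \<open>One step less than the maximal number keeps the remainder in \<open>[y, 2 * y]\<close>, where \<open>w\<close> is bounded.\<close>
      define n where "n = nat \<lfloor>x / y\<rfloor> - 1"
      have x0: "0 < x" using x y0 by simp
      have "2 \<le> x / y" using x y0 by (simp add: divide_simps)
      then have "2 \<le> nat \<lfloor>x / y\<rfloor>" by (simp add: le_nat_floor)
      then have n1: "1 \<le> n" and Sn: "real (Suc n) = real (nat \<lfloor>x / y\<rfloor>)" unfolding n_def by auto
      have "real (Suc n) \<le> x / y" "x / y < real (Suc n) + 1"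
        unfolding Sn using x0 y0 by auto
      then have r: "y \<le> x - real n * y" "x - real n * y \<le> 2 * y"
        using y0 by (auto simp: field_simps)
      have "w (real n * y + (x - real n * y)) \<le> w (real n * y) + w (x - real n * y)"
        using n1 r y0 by (intro sub) auto
      also have "w (real n * y) \<le> real n * w y"
        using subadditive_multiple[OF sub y0, of "n - 1"] n1 by simp
      also have "w (x - real n * y) \<le> K * (x - real n * y)" using r y by (intro up) simp
      also have "\<dots> \<le> K * (2 * y)" using r K by (intro mult_left_mono) auto
      also have "real n * w y \<le> real n * ((l + e / 2) * y)"
        using y y0 by (intro mult_left_mono) (auto simp: field_simps)
      also have "\<dots> = (l + e / 2) * x - (l + e / 2) * (x - real n * y)" by (simp add: algebra_simps)
      also have "- ((l + e / 2) * (x - real n * y)) \<le> \<bar>l + e / 2\<bar> * (2 * y)"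
      proof -
        have "- ((l + e / 2) * (x - real n * y)) \<le> \<bar>(l + e / 2) * (x - real n * y)\<bar>" by (rule abs_ge_minus_self)
        also have "\<dots> \<le> \<bar>l + e / 2\<bar> * (2 * y)"
          unfolding abs_mult using r y0 by (intro mult_left_mono) auto
        finally show ?thesis .
      qed
      then have "(l + e / 2) * x - (l + e / 2) * (x - real n * y)
          \<le> (l + e / 2) * x + \<bar>l + e / 2\<bar> * (2 * y)" by simp
      finally have "w x \<le> (l + e / 2) * x + Q" by (simp add: Q_def algebra_simps)
      then show ?thesis using x0 by (simp add: field_simps)
    qed
    then have "eventually (\<lambda>x. w x / x \<le> l + e / 2 + Q / x) at_top"
      unfolding eventually_at_top_linorder by blast
    moreover have "((\<lambda>x. Q / x) \<longlongrightarrow> 0) at_top"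
      by (rule tendsto_divide_0[OF tendsto_const]) (simp add: filterlim_at_top_imp_at_infinity filterlim_ident)
    then have "eventually (\<lambda>x. dist (Q / x) 0 < e / 2) at_top"
      by (rule tendstoD) (use \<open>0 < e\<close> in simp)
    moreover have "eventually (\<lambda>x. A \<le> x) at_top" by (rule eventually_ge_at_top)
    ultimately show "eventually (\<lambda>x. dist (w x / x) l < e) at_top"
    proof eventually_elim
      case (elim x)
      have "Q / x < e / 2" using elim(2) unfolding dist_real_def by linarith
      then show ?case using elim l_le[of x] unfolding dist_real_def by linarith
    qed
  qed
  then show ?thesis by (rule that)
qed

text \<open>Baire's theorem: the sublevel sets exhaust the interval, so one of them is dense somewhere.\<close>

lemma dense_sublevel_interval:
  fixes W :: "real \<Rightarrow> real"
  assumes pq: "p < q"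
  obtains n :: nat and \<alpha> \<beta> where "p \<le> \<alpha>" "\<alpha> < \<beta>" "\<beta> \<le> q"
    "{\<alpha>..\<beta>} \<subseteq> closure {t \<in> {p..q}. W t \<le> real n}"
proof -
  let ?A = "\<lambda>n::nat. {t \<in> {p..q}. W t \<le> real n}"
  let ?T = "\<lambda>n. {p..q} - closure (?A n)"
  have "\<exists>n. \<not> {p..q} \<subseteq> closure (?T n)"
  proof (rule ccontr)
    assume "\<not> ?thesis"
    then have d: "{p..q} \<subseteq> closure (?T n)" for n by blast
    have "openin (top_of_set {p..q}) (?T n)" for n
      by (metis Diff_Int_distrib2 Int_commute Diff_eq closed_closure openin_open open_Compl inf.orderE)
    then have "{p..q} \<subseteq> closure (\<Inter> (range ?T))"
      using d by (intro Baire) auto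
    moreover have "\<Inter> (range ?T) = {}"
    proof -
      have False if "t \<in> \<Inter> (range ?T)" for t
      proof -
        obtain n :: nat where "W t \<le> real n" using real_arch_simple by blast
        then have "t \<in> ?A n" using that by auto
        then show False using that closure_subset[of "?A n"] by blast
      qed
      then show ?thesis by blast
    qed
    ultimately have "{p..q} \<subseteq> closure {}" by (simp only:)
    then show False using pq by simp
  qed
  then obtain n x where x: "x \<in> {p..q}" "x \<notin> closure (?T n)" by blast
  then obtain e where e: "0 < e" "\<And>y. y \<in> ?T n \<Longrightarrow> e \<le> dist y x"
    unfolding closure_approachable by (meson not_less)
  define \<alpha> where "\<alpha> = max p (x - e / 2)"
  define \<beta> where "\<beta> = min q (x + e / 2)"
  have ab: "p \<le> \<alpha>" "\<alpha> < \<beta>" "\<beta> \<le> q" using x pq e by (auto simp: \<alpha>_def \<beta>_def)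
  have "{\<alpha>..\<beta>} \<subseteq> closure (?A n)"
  proof
    fix y assume y: "y \<in> {\<alpha>..\<beta>}"
    then have "dist y x \<le> e / 2" unfolding \<alpha>_def \<beta>_def dist_real_def by (auto simp only: atLeastAtMost_iff max.bounded_iff min.bounded_iff abs_le_iff)
    then have "y \<notin> ?T n" using e by fastforce
    then show "y \<in> closure (?A n)" using y ab by auto
  qed
  with ab show ?thesis by (rule that)
qed

lemma dilation_sup_eq:
  assumes t: "0 < t"
  shows "dilation_sup a \<phi> t
    = (SUP s\<in>{s. 0 < s \<and> ereal s < a \<and> ereal (t * s) < a}. ennreal (\<phi> (t * s) / \<phi> s))"
proof -
  have "ereal s < a / ereal t \<longleftrightarrow> ereal (t * s) < a" for s
    using t ereal_less_divide_pos[of "ereal t" "ereal s" a] by simp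
  then show ?thesis unfolding dilation_sup_def by (simp add: conj_ac)
qed

text \<open>The real value of $m_\varphi(t)$, meaningful where $m_\varphi$ is finite.\<close>

definition dilation_norm :: "ereal \<Rightarrow> (real \<Rightarrow> real) \<Rightarrow> real \<Rightarrow> real" where
  "dilation_norm a \<phi> t = enn2real (dilation_sup a \<phi> t)"

text \<open>What Fekete's lemma asks of $\ln m_\varphi(e^{\pm x})$. A finite subadditive function need not
  satisfy it, and then the limits that define the indices may fail to exist.\<close>

definition dilation_locally_bounded :: "ereal \<Rightarrow> (real \<Rightarrow> real) \<Rightarrow> bool" where
  "dilation_locally_bounded a \<phi> \<longleftrightarrow>
    (\<exists>p q K. 1 < p \<and> p < q \<and> (\<forall>t\<in>{p..q}. dilation_norm a \<phi> t \<le> K)) \<and>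
    (\<exists>p q K. 1 < p \<and> p < q \<and> (\<forall>t\<in>{p..q}. dilation_norm a \<phi> (1 / t) \<le> K))"

context
  fixes a :: ereal and \<phi> :: "real \<Rightarrow> real"
  assumes a: "0 < a" and pos: "\<And>s. 0 < s \<Longrightarrow> ereal s < a \<Longrightarrow> 0 < \<phi> s"
    and finite: "has_extension_indices a \<phi>"
begin

abbreviation (input) "dil \<equiv> dilation_norm a \<phi>"

lemma dilation_norm_bound:
  assumes "0 < t" "0 < s" "ereal s < a" "ereal (t * s) < a"
  shows "\<phi> (t * s) \<le> dil t * \<phi> s"
proof -
  have "ennreal (\<phi> (t * s) / \<phi> s) \<le> dilation_sup a \<phi> t"
    unfolding dilation_sup_eq[OF assms(1)] using assms by (intro SUP_upper) auto
  moreover have "dilation_sup a \<phi> t < top"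
    using finite assms(1) by (simp add: has_extension_indices_def)
  ultimately have "enn2real (ennreal (\<phi> (t * s) / \<phi> s)) \<le> dil t"
    unfolding dilation_norm_def by (rule enn2real_mono)
  moreover have "0 \<le> \<phi> (t * s) / \<phi> s"
    using pos[of s] pos[of "t * s"] assms by simp
  ultimately have "\<phi> (t * s) / \<phi> s \<le> dil t" by simp
  then show ?thesis using pos[of s] assms by (simp add: divide_simps)
qed

lemma dilation_norm_least:
  assumes t: "0 < t" and C: "0 \<le> C"
    and le: "\<And>s. 0 < s \<Longrightarrow> ereal s < a \<Longrightarrow> ereal (t * s) < a \<Longrightarrow> \<phi> (t * s) \<le> C * \<phi> s"
  shows "dil t \<le> C"
proof -
  have "dilation_sup a \<phi> t \<le> ennreal C"
    unfolding dilation_sup_eq[OF t]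
  proof (rule SUP_least)
    fix s assume "s \<in> {s. 0 < s \<and> ereal s < a \<and> ereal (t * s) < a}"
    then have "\<phi> (t * s) \<le> C * \<phi> s" "0 < \<phi> s" using le pos by auto
    then show "ennreal (\<phi> (t * s) / \<phi> s) \<le> ennreal C"
      by (intro ennreal_leI) (simp add: divide_simps)
  qed
  then show ?thesis using C by (simp add: dilation_norm_def enn2real_leI)
qed

lemma dilation_domain_nonempty:
  assumes t: "0 < t"
  obtains s where "0 < s" "ereal s < a" "ereal (t * s) < a"
proof -
  obtain r where r: "0 < ereal r" "ereal r < a" using ereal_dense2[OF a] by blast
  define s where "s = min r (r / t)"
  have "0 < s" "s \<le> r" "t * s \<le> r"
    using r t by (auto simp: s_def min_def divide_simps mult.commute)
  with r show ?thesis
    by (intro that[of s]) (auto intro: le_less_trans[of "ereal s" "ereal r"] le_less_trans[of "ereal (t * s)" "ereal r"])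
qed

lemma dilation_norm_pos:
  assumes t: "0 < t"
  shows "0 < dil t"
proof -
  obtain s where s: "0 < s" "ereal s < a" "ereal (t * s) < a"
    using dilation_domain_nonempty[OF t] .
  have "0 < \<phi> (t * s)" using s t by (intro pos) auto
  also have "\<dots> \<le> dil t * \<phi> s" by (rule dilation_norm_bound[OF t s])
  finally show ?thesis using pos[OF s(1,2)] by (simp add: zero_less_mult_iff)
qed

lemma dilation_norm_submult:
  assumes "0 < t" "0 < r" "1 \<le> t \<and> 1 \<le> r \<or> t \<le> 1 \<and> r \<le> 1"
  shows "dil (t * r) \<le> dil t * dil r"
proof (rule dilation_norm_least)
  fix s
  assume s: "0 < s" "ereal s < a" "ereal (t * r * s) < a"
  have mid: "ereal (r * s) < a"
    using assms(3)
  proof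
    assume "1 \<le> t \<and> 1 \<le> r"
    then have "r * s \<le> t * r * s" using s assms by simp
    then show ?thesis using s(3) by (meson ereal_less_eq(3) le_less_trans)
  next
    assume "t \<le> 1 \<and> r \<le> 1"
    then have "r * s \<le> s" using s by simp
    then show ?thesis using s(2) by (meson ereal_less_eq(3) le_less_trans)
  qed
  have "\<phi> (t * (r * s)) \<le> dil t * \<phi> (r * s)"
    using assms s mid by (intro dilation_norm_bound) (auto simp: mult.assoc)
  also have "\<dots> \<le> dil t * (dil r * \<phi> s)"
    using assms s mid dilation_norm_pos[of t] by (intro mult_left_mono dilation_norm_bound) auto
  finally show "\<phi> (t * r * s) \<le> dil t * dil r * \<phi> s"
    by (simp add: mult.assoc)
qed (use assms dilation_norm_pos[of t] dilation_norm_pos[of r] in auto)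

text \<open>This links the two directions: an upper bound for $m_\varphi$ at $1/t$ is a lower bound at $t$, so
  that neither of the two limits can be $-\infty$.\<close>

lemma dilation_norm_inverse:
  assumes t: "0 < t"
  shows "1 \<le> dil t * dil (1 / t)"
proof -
  obtain s where s: "0 < s" "ereal s < a" "ereal (t * s) < a"
    using dilation_domain_nonempty[OF t] .
  have "\<phi> s = \<phi> ((1 / t) * (t * s))" using t by simp
  also have "\<dots> \<le> dil (1 / t) * \<phi> (t * s)"
    using s t by (intro dilation_norm_bound) auto
  also have "\<dots> \<le> dil (1 / t) * (dil t * \<phi> s)"
    using s t dilation_norm_pos[of "1 / t"] by (intro mult_left_mono dilation_norm_bound) auto
  finally show ?thesis using pos[OF s(1,2)] by (simp add: mult.commute mult.left_commute)
qed

lemma dilation_norm_limits: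
  assumes lb: "dilation_locally_bounded a \<phi>"
  obtains l l' where "((\<lambda>x. ln (dil (exp x)) / x) \<longlongrightarrow> l) at_top"
    "((\<lambda>x. ln (dil (exp (- x))) / x) \<longlongrightarrow> l') at_top"
proof -
  let ?w = "\<lambda>x. ln (dil (exp x))"
  let ?v = "\<lambda>x. ln (dil (exp (- x)))"
  \<comment> \<open>Submultiplicativity holds separately on each side of 1, hence two subadditive functions.\<close>
  have ln_sub: "ln (dil (t * r)) \<le> ln (dil t) + ln (dil r)"
    if "0 < t" "0 < r" "1 \<le> t \<and> 1 \<le> r \<or> t \<le> 1 \<and> r \<le> 1" for t r
    using dilation_norm_submult[OF that] dilation_norm_pos[of t] dilation_norm_pos[of r]
      dilation_norm_pos[of "t * r"] that
    by (subst ln_mult_pos[symmetric]) auto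
  have subw: "?w (x + y) \<le> ?w x + ?w y" if "0 < x" "0 < y" for x y
    using ln_sub[of "exp x" "exp y"] that by (simp add: exp_add)
  have subv: "?v (x + y) \<le> ?v x + ?v y" if "0 < x" "0 < y" for x y
    using ln_sub[of "exp (- x)" "exp (- y)"] that by (simp add: exp_add[symmetric])
  have wv: "0 \<le> ?w x + ?v x" for x
    using dilation_norm_inverse[of "exp x"] dilation_norm_pos[of "exp x"] dilation_norm_pos[of "exp (- x)"]
    by (subst ln_mult_pos[symmetric]) (auto simp: exp_minus divide_inverse)
  have bd: "\<exists>A K. 0 < A \<and> 0 \<le> K \<and> (\<forall>x\<ge>A. ln (f x) \<le> K * x)"
    if sub: "\<And>x y. 0 < x \<Longrightarrow> 0 < y \<Longrightarrow> ln (f (x + y)) \<le> ln (f x) + ln (f y)"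
      and fpos: "\<And>x. 0 < f x"
      and pq: "1 < p" "p < q" and fK: "\<And>t. t \<in> {p..q} \<Longrightarrow> f (ln t) \<le> K" for f :: "real \<Rightarrow> real" and p q K
  proof -
    obtain A K where "0 < A" "0 \<le> K" "\<And>x. A \<le> x \<Longrightarrow> ln (f x) \<le> K * x"
    proof (rule subadditive_linear_bound[of "\<lambda>x. ln (f x)" "ln p" "ln q" "ln K"])
      fix x assume x: "ln p \<le> x" "x \<le> ln q"
      then have "exp (ln p) \<le> exp x" "exp x \<le> exp (ln q)" by simp_all
      then have "p \<le> exp x" "exp x \<le> q" using \<open>1 < p\<close> \<open>p < q\<close> by simp_all
      then have "f (ln (exp x)) \<le> K" using fK[of "exp x"] by simp
      then show "ln (f x) \<le> ln K" using fpos[of x] by simp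
    qed (use sub pq in auto)
    then show ?thesis by blast
  qed
  obtain A K where AK: "0 < A" "0 \<le> K" "\<And>x. A \<le> x \<Longrightarrow> ?w x \<le> K * x"
  proof -
    obtain p q K where "1 < p" "p < q" "\<And>t. t \<in> {p..q} \<Longrightarrow> dil t \<le> K"
      using lb unfolding dilation_locally_bounded_def by blast
    then have "\<exists>A K. 0 < A \<and> 0 \<le> K \<and> (\<forall>x\<ge>A. ?w x \<le> K * x)"
      using subw dilation_norm_pos by (intro bd[of "\<lambda>x. dil (exp x)" p q K]) auto
    with that show ?thesis by blast
  qed
  obtain B L where BL: "0 < B" "0 \<le> L" "\<And>x. B \<le> x \<Longrightarrow> ?v x \<le> L * x"
  proof -
    obtain p q K where "1 < p" "p < q" "\<And>t. t \<in> {p..q} \<Longrightarrow> dil (1 / t) \<le> K"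
      using lb unfolding dilation_locally_bounded_def by blast
    then have "\<exists>A K. 0 < A \<and> 0 \<le> K \<and> (\<forall>x\<ge>A. ?v x \<le> K * x)"
      using subv dilation_norm_pos
      by (intro bd[of "\<lambda>x. dil (exp (- x))" p q K]) (auto simp: exp_minus divide_inverse)
    with that show ?thesis by blast
  qed
  have AB: "0 < max A B" using AK by simp
  have lw: "- L * x \<le> ?w x" if "max A B \<le> x" for x using wv[of x] BL(3)[of x] that by simp
  have lv: "- K * x \<le> ?v x" if "max A B \<le> x" for x using wv[of x] AK(3)[of x] that by simp
  obtain l where l: "((\<lambda>x. ?w x / x) \<longlongrightarrow> l) at_top"
    using subadditive_limit[OF subw AB _ AK(2) lw] AK(3) by auto
  obtain l' where l': "((\<lambda>x. ?v x / x) \<longlongrightarrow> l') at_top"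
    using subadditive_limit[OF subv AB _ BL(2) lv] BL(3) by auto
  from l l' show ?thesis by (rule that)
qed

text \<open>The limit gives $m_\varphi(t)\le t^\kappa$ only for $t\ge T$. For smaller $t$ go down by the factor
  $T$, which costs the constant $m_\varphi(1/T)$, and then up by $tT\ge T$.\<close>

lemma rho_index_bound:
  assumes lb: "dilation_locally_bounded a \<phi>" and k: "rho_index a \<phi> < \<kappa>"
  obtains C where "0 < C"
    "\<And>t s. 1 \<le> t \<Longrightarrow> 0 < s \<Longrightarrow> ereal (t * s) < a \<Longrightarrow> \<phi> (t * s) \<le> C * t powr \<kappa> * \<phi> s"
proof -
  obtain l where l: "((\<lambda>x. ln (dil (exp x)) / x) \<longlongrightarrow> l) at_top"
    using dilation_norm_limits[OF lb] by metis
  have "((\<lambda>t. ln (dil (exp (ln t))) / ln t) \<longlongrightarrow> l) at_top"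
    by (rule filterlim_compose[OF l ln_at_top])
  moreover have "eventually (\<lambda>t. ln (dil (exp (ln t))) / ln t
      = ln (enn2real (dilation_sup a \<phi> t)) / ln t) at_top"
    using eventually_gt_at_top[of "0::real"] by eventually_elim (simp add: dilation_norm_def)
  ultimately have "((\<lambda>t. ln (enn2real (dilation_sup a \<phi> t)) / ln t) \<longlongrightarrow> l) at_top"
    by (rule Lim_transform_eventually)
  then have lr: "l = rho_index a \<phi>" unfolding rho_index_def by (intro tendsto_Lim[symmetric]) auto
  have "eventually (\<lambda>x. ln (dil (exp x)) / x < \<kappa>) at_top"
    using l k lr by (auto intro: order_tendstoD)
  then obtain X where X: "\<And>x. X \<le> x \<Longrightarrow> ln (dil (exp x)) / x < \<kappa>"
    unfolding eventually_at_top_linorder by blast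
  define T where "T = exp (max X 1)"
  have T: "1 \<le> T" unfolding T_def by simp
  have big: "dil t \<le> t powr \<kappa>" if "T \<le> t" for t
  proof -
    have t: "0 < t" using that T by simp
    have "max X 1 \<le> ln t" using that t unfolding T_def by (simp only: ln_ge_iff)
    then have "0 < ln t" by linarith
    moreover have "ln (dil t) / ln t < \<kappa>"
      using X[of "ln t"] \<open>max X 1 \<le> ln t\<close> t by simp
    ultimately have "ln (dil t) \<le> \<kappa> * ln t" by (simp only: pos_divide_less_eq less_imp_le)
    then have "exp (ln (dil t)) \<le> exp (\<kappa> * ln t)" by simp
    then show ?thesis using t dilation_norm_pos[OF t] by (simp add: powr_def)
  qed
  let ?C = "T powr \<kappa> * dil (1 / T)"
  show ?thesis
  proof (rule that)
    show "0 < ?C" using T dilation_norm_pos[of "1 / T"] by simp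
    fix t s :: real
    assume ts: "1 \<le> t" "0 < s" "ereal (t * s) < a"
    have s_le: "s \<le> t * s" using ts by simp
    have sa: "ereal s < a" using s_le ts(3) by (meson ereal_less_eq(3) le_less_trans)
    have "1 / T * s \<le> s" using T ts by (simp add: divide_simps)
    then have sTa: "ereal (1 / T * s) < a" using sa by (meson ereal_less_eq(3) le_less_trans)
    have "\<phi> (t * s) = \<phi> ((t * T) * (1 / T * s))" using T by simp
    also have "\<dots> \<le> dil (t * T) * \<phi> (1 / T * s)"
      using ts T sTa by (intro dilation_norm_bound) auto
    also have "\<dots> \<le> (t * T) powr \<kappa> * (dil (1 / T) * \<phi> s)"
    proof (rule mult_mono)
      show "dil (t * T) \<le> (t * T) powr \<kappa>" using ts T by (intro big) simp
      show "\<phi> (1 / T * s) \<le> dil (1 / T) * \<phi> s"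
        using T ts sa sTa by (intro dilation_norm_bound) auto
      show "0 \<le> \<phi> (1 / T * s)" using pos[OF _ sTa] ts T by simp
    qed simp
    also have "\<dots> = ?C * t powr \<kappa> * \<phi> s" using ts T by (simp add: powr_mult)
    finally show "\<phi> (t * s) \<le> ?C * t powr \<kappa> * \<phi> s" .
  qed
qed

text \<open>Here the limit gives $m_\varphi(t)\le t^\kappa$ for $t\le T$ with some $T<1$, and the detour goes
  down by $tT\le T$ first and then up by $1/T$, so that all points stay in the domain.\<close>

lemma pi_index_bound:
  assumes lb: "dilation_locally_bounded a \<phi>" and k: "\<kappa> < pi_index a \<phi>"
  obtains C where "0 < C"
    "\<And>t s. 0 < t \<Longrightarrow> t \<le> 1 \<Longrightarrow> 0 < s \<Longrightarrow> ereal s < a \<Longrightarrow> \<phi> (t * s) \<le> C * t powr \<kappa> * \<phi> s"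
proof -
  obtain l where l: "((\<lambda>x. ln (dil (exp (- x))) / x) \<longlongrightarrow> l) at_top"
    using dilation_norm_limits[OF lb] by metis
  have "filterlim (\<lambda>t::real. - ln t) at_top (at_right 0)"
    using ln_at_0 by (simp add: filterlim_uminus_at_top)
  then have "((\<lambda>t. ln (dil (exp (- (- ln t)))) / (- ln t)) \<longlongrightarrow> l) (at_right 0)"
    by (rule filterlim_compose[OF l])
  then have "((\<lambda>t. - (ln (dil (exp (- (- ln t)))) / (- ln t))) \<longlongrightarrow> - l) (at_right 0)"
    by (rule tendsto_minus)
  moreover have "eventually (\<lambda>t. - (ln (dil (exp (- (- ln t)))) / (- ln t))
      = ln (enn2real (dilation_sup a \<phi> t)) / ln t) (at_right 0)"
    using eventually_at_right_less[of "0::real"] by eventually_elim (simp add: dilation_norm_def)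
  ultimately have "((\<lambda>t. ln (enn2real (dilation_sup a \<phi> t)) / ln t) \<longlongrightarrow> - l) (at_right 0)"
    by (rule Lim_transform_eventually)
  then have lr: "- l = pi_index a \<phi>" unfolding pi_index_def by (intro tendsto_Lim[symmetric]) auto
  have "eventually (\<lambda>x. ln (dil (exp (- x))) / x < - \<kappa>) at_top"
    using l k lr by (auto intro: order_tendstoD)
  then obtain X where X: "\<And>x. X \<le> x \<Longrightarrow> ln (dil (exp (- x))) / x < - \<kappa>"
    unfolding eventually_at_top_linorder by blast
  define T where "T = exp (- max X 1)"
  have T: "0 < T" "T \<le> 1" unfolding T_def by auto
  have small: "dil t \<le> t powr \<kappa>" if t: "0 < t" "t \<le> T" for t
  proof -
    have "ln t \<le> ln T" using t by simp
    then have "max X 1 \<le> - ln t" unfolding T_def by simp linarith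
    then have "0 < - ln t" by linarith
    moreover have "ln (dil t) / (- ln t) < - \<kappa>"
      using X[of "- ln t"] \<open>max X 1 \<le> - ln t\<close> t by simp
    ultimately have "ln (dil t) \<le> \<kappa> * ln t" by (simp only: pos_divide_less_eq less_imp_le)
    then have "exp (ln (dil t)) \<le> exp (\<kappa> * ln t)" by simp
    then show ?thesis using t dilation_norm_pos[OF t(1)] by (simp add: powr_def)
  qed
  let ?C = "dil (1 / T) * T powr \<kappa>"
  show ?thesis
  proof (rule that)
    show "0 < ?C" using T dilation_norm_pos[of "1 / T"] by simp
    fix t s :: real
    assume ts: "0 < t" "t \<le> 1" "0 < s" "ereal s < a"
    have 1: "t * s \<le> s" using ts by simp
    then have tsa: "ereal (t * s) < a" using ts(4) by (meson ereal_less_eq(3) le_less_trans)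
    have "t * T * s \<le> t * s" using T ts by (simp add: mult_left_le)
    then have tTsa: "ereal (t * T * s) < a" using tsa by (meson ereal_less_eq(3) le_less_trans)
    have "\<phi> (t * s) = \<phi> (1 / T * (t * T * s))" using T by simp
    also have "\<dots> \<le> dil (1 / T) * \<phi> (t * T * s)"
      using ts T tTsa tsa by (intro dilation_norm_bound) auto
    also have "\<dots> \<le> dil (1 / T) * (dil (t * T) * \<phi> s)"
      using ts T tTsa dilation_norm_pos[of "1 / T"]
      by (intro mult_left_mono dilation_norm_bound) auto
    also have "\<dots> \<le> dil (1 / T) * ((t * T) powr \<kappa> * \<phi> s)"
      using ts T dilation_norm_pos[of "1 / T"] pos[OF ts(3,4)] small[of "t * T"]
      by (intro mult_left_mono mult_right_mono) (auto simp: mult_left_le_one_le)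
    also have "\<dots> = ?C * t powr \<kappa> * \<phi> s" using ts T by (simp add: powr_mult)
    finally show "\<phi> (t * s) \<le> ?C * t powr \<kappa> * \<phi> s" .
  qed
qed

end

text \<open>The values of $\varphi$ at nearby points are comparable with a fixed constant, so a bound for
  $m_\varphi$ on a set extends, up to that constant, to the closure of the set.\<close>

lemma dilation_locally_boundedI:
  assumes pos: "\<And>s. 0 < s \<Longrightarrow> s < 1 \<Longrightarrow> 0 < \<phi> s"
    and ext: "has_extension_indices 1 \<phi>"
    and loc: "0 < C" "\<And>r. 0 < r \<Longrightarrow> r < 1 \<Longrightarrow>
       \<exists>d>0. \<forall>r'. 0 < r' \<longrightarrow> r' < 1 \<longrightarrow> \<bar>r' - r\<bar> < d \<longrightarrow> \<phi> r \<le> C * \<phi> r'"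
  shows "dilation_locally_bounded 1 \<phi>"
proof -
  define a :: ereal where "a = 1"
  then have a: "a = 1" .
  have finite: "has_extension_indices a \<phi>" using ext a by simp
  have pos1: "\<And>s. 0 < s \<Longrightarrow> ereal s < a \<Longrightarrow> 0 < \<phi> s" using pos a by simp
  have a0: "0 < a" using a by simp
  note bound = dilation_norm_bound[OF a0 pos1 finite] and least = dilation_norm_least[OF a0 pos1 finite]
  have extend: "dilation_norm a \<phi> t \<le> C * real n"
    if t: "0 < t" "t \<in> closure {t. 0 < t \<and> dilation_norm a \<phi> t \<le> real n}" for t n
  proof (rule least)
    fix s assume s: "0 < s" "ereal s < a" "ereal (t * s) < a"
    define r where "r = t * s"
    have r: "0 < r" "r < 1" using s t a by (auto simp: r_def)
    obtain d where d: "0 < d"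
      "\<And>r'. 0 < r' \<Longrightarrow> r' < 1 \<Longrightarrow> \<bar>r' - r\<bar> < d \<Longrightarrow> \<phi> r \<le> C * \<phi> r'"
      using loc(2)[OF r] by blast
    define e where "e = min d (1 - r) / s"
    have "0 < e" using d r s by (simp add: e_def)
    then obtain t' where t': "0 < t'" "dilation_norm a \<phi> t' \<le> real n" "dist t' t < e"
      using t(2) unfolding closure_approachable by blast
    have "\<bar>t' * s - r\<bar> = \<bar>t' - t\<bar> * s"
      using s(1) abs_mult[of "t' - t" s] by (simp add: r_def left_diff_distrib)
    also have "\<dots> < min d (1 - r)"
      using t'(3) s(1) by (simp only: dist_real_def e_def pos_less_divide_eq)
    finally have "\<bar>t' * s - r\<bar> < min d (1 - r)" .
    then have near: "\<bar>t' * s - r\<bar> < d" "t' * s < 1" by auto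
    have "\<phi> r \<le> C * \<phi> (t' * s)" using near t' s by (intro d) auto
    also have "\<phi> (t' * s) \<le> dilation_norm a \<phi> t' * \<phi> s"
      using near s t' a by (intro bound) auto
    also have "\<dots> \<le> real n * \<phi> s" using t' pos1[OF s(1,2)] by (intro mult_right_mono) auto
    finally show "\<phi> (t * s) \<le> C * real n * \<phi> s" using loc(1) by (simp add: r_def mult.assoc)
  qed (use t loc in auto)
  have "\<exists>p q K. 1 < p \<and> p < q \<and> (\<forall>t\<in>{p..q}. dilation_norm a \<phi> t \<le> K)"
  proof -
    obtain n :: nat and p q where pq: "2 \<le> p" "p < q" "q \<le> 3"
      "{p..q} \<subseteq> closure {t \<in> {2..3}. dilation_norm a \<phi> t \<le> real n}"
      by (rule dense_sublevel_interval[of 2 3 "dilation_norm a \<phi>"]) (simp, rule that)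
    have "{t \<in> {2..3}. dilation_norm a \<phi> t \<le> real n} \<subseteq> {t. 0 < t \<and> dilation_norm a \<phi> t \<le> real n}"
      by auto
    then have "{p..q} \<subseteq> closure {t. 0 < t \<and> dilation_norm a \<phi> t \<le> real n}"
      using pq(4) closure_mono by blast
    then have "\<forall>t\<in>{p..q}. dilation_norm a \<phi> t \<le> C * real n"
      by (intro ballI extend) (use pq in auto)
    then show ?thesis using pq by (intro exI[of _ p] exI[of _ q] exI[of _ "C * real n"]) auto
  qed
  moreover have "\<exists>p q K. 1 < p \<and> p < q \<and> (\<forall>t\<in>{p..q}. dilation_norm a \<phi> (1 / t) \<le> K)"
  proof -
    obtain n :: nat and p q where pq: "1 / 3 \<le> p" "p < q" "q \<le> 1 / 2"
      "{p..q} \<subseteq> closure {t \<in> {1/3..1/2}. dilation_norm a \<phi> t \<le> real n}"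
      by (rule dense_sublevel_interval[of "1/3" "1/2" "dilation_norm a \<phi>"]) (simp, rule that)
    have "{t \<in> {1/3..1/2}. dilation_norm a \<phi> t \<le> real n} \<subseteq> {t. 0 < t \<and> dilation_norm a \<phi> t \<le> real n}"
      by auto
    then have "{p..q} \<subseteq> closure {t. 0 < t \<and> dilation_norm a \<phi> t \<le> real n}"
      using pq(4) closure_mono by blast
    then have "\<forall>t\<in>{p..q}. dilation_norm a \<phi> t \<le> C * real n"
      by (intro ballI extend) (use pq in auto)
    then have "\<forall>t\<in>{1/q..1/p}. dilation_norm a \<phi> (1 / t) \<le> C * real n"
    proof (intro ballI)
      fix t assume H: "\<forall>t\<in>{p..q}. dilation_norm a \<phi> t \<le> C * real n" and t: "t \<in> {1/q..1/p}"
      have p0: "0 < p" "0 < q" using pq by auto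
      have t0: "0 < t" using t p0 by (auto intro: less_le_trans[of 0 "1/q"])
      have "1 / t \<in> {p..q}" using t p0 t0 by (auto simp: field_simps)
      then show "dilation_norm a \<phi> (1 / t) \<le> C * real n" using H by blast
    qed
    moreover have "1 < 1 / q" "1 / q < 1 / p" using pq by (auto simp: field_simps)
    ultimately show ?thesis by blast
  qed
  ultimately show ?thesis
    unfolding dilation_locally_bounded_def a[symmetric] by blast
qed

section \<open>Exponential decay from index conditions\<close>

text \<open>The last clause says that the function does not drop by an unbounded factor over a bounded distance;
  together with the decay it makes the values within bounded distance comparable.\<close>

definition exp_decay :: "(real \<Rightarrow> real) \<Rightarrow> bool" where
  "exp_decay f \<longleftrightarrow> (\<forall>x. 0 < f x) \<and>
    (\<exists>C>0. \<exists>\<delta>>0. \<forall>x y. 0 \<le> y \<longrightarrow> f (x + y) \<le> C * exp (- \<delta> * y) * f x) \<and>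
    (\<forall>y\<ge>0. \<exists>C>0. \<forall>x. f x \<le> C * f (x + y))"

text \<open>The index conditions speak about the two half-lines separately; comparability near 0 joins them.\<close>

lemma exp_decay_glue:
  assumes pos: "\<And>x. 0 < f x" and d: "0 < \<delta>" and C: "1 \<le> C" and C1: "1 \<le> C1"
    and decay_pos: "\<And>x y. 0 < x \<Longrightarrow> 0 \<le> y \<Longrightarrow> f (x + y) \<le> C * exp (- \<delta> * y) * f x"
    and decay_neg: "\<And>x y. x + y < 0 \<Longrightarrow> 0 \<le> y \<Longrightarrow> f (x + y) \<le> C * exp (- \<delta> * y) * f x"
    and loc: "\<And>x y. \<bar>x\<bar> \<le> 1 \<Longrightarrow> \<bar>y\<bar> \<le> 1 \<Longrightarrow> f x \<le> C1 * f y"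
    and rev_pos: "\<And>y. 0 \<le> y \<Longrightarrow> \<exists>K>0. \<forall>x>0. f x \<le> K * f (x + y)"
    and rev_neg: "\<And>y. 0 \<le> y \<Longrightarrow> \<exists>K>0. \<forall>x. x + y < 0 \<longrightarrow> f x \<le> K * f (x + y)"
  shows "exp_decay f"
proof -
  define D where "D = C * C1 * exp \<delta>"
  have "1 \<le> exp \<delta>" using d by simp
  moreover have "1 \<le> C * C1" using C C1 mult_mono[of 1 C 1 C1] by simp
  ultimately have D1: "1 \<le> D" unfolding D_def using mult_mono[of 1 "C * C1" 1 "exp \<delta>"] by simp
  have "C1 * 1 \<le> C1 * (C * 1)" using C C1 by (intro mult_left_mono) auto
  then have CC: "C1 \<le> C * C1" by (simp add: mult.commute)
  have "C * 1 \<le> C * C1" using C C1 by (intro mult_left_mono) auto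
  also have "\<dots> * 1 \<le> C * C1 * exp \<delta>" using C C1 d by (intro mult_left_mono) auto
  finally have CD: "C \<le> D" by (simp add: D_def)
  have small: "C1 \<le> D * exp (- \<delta> * y)" if "0 \<le> y" "y \<le> 1" for y
  proof -
    have "1 \<le> exp (\<delta> * (1 - y))" using d that by simp
    also have "\<dots> = exp \<delta> * exp (- \<delta> * y)" by (simp add: exp_add[symmetric] algebra_simps)
    finally have "C1 * 1 \<le> (C * C1) * (exp \<delta> * exp (- \<delta> * y))"
      using C1 C CC by (intro mult_mono) auto
    then show ?thesis by (simp add: D_def mult.assoc)
  qed
  have e1: "C * exp (- \<delta> * (y - 1)) * C1 = D * exp (- \<delta> * y)" for y
    by (simp add: D_def exp_add[symmetric] algebra_simps)
  have right: "f y \<le> D * exp (- \<delta> * y) * f 0" if y: "0 \<le> y" for y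
  proof (cases "y \<le> 1")
    case True
    have "f y \<le> C1 * f 0" using True y by (intro loc) auto
    also have "\<dots> \<le> D * exp (- \<delta> * y) * f 0"
      using small[OF y True] pos[of 0] by (intro mult_right_mono) auto
    finally show ?thesis .
  next
    case False
    have "f (1 + (y - 1)) \<le> C * exp (- \<delta> * (y - 1)) * f 1" using False by (intro decay_pos) auto
    also have "\<dots> \<le> C * exp (- \<delta> * (y - 1)) * (C1 * f 0)"
      using C by (intro mult_left_mono loc) auto
    also have "\<dots> = D * exp (- \<delta> * y) * f 0" by (simp only: e1[symmetric] mult.assoc)
    finally show ?thesis by simp
  qed
  have left: "f 0 \<le> D * exp (- \<delta> * y) * f (- y)" if y: "0 \<le> y" for y
  proof (cases "y \<le> 1")
    case True
    have "f 0 \<le> C1 * f (- y)" using True y by (intro loc) auto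
    also have "\<dots> \<le> D * exp (- \<delta> * y) * f (- y)"
      using small[OF y True] pos[of "- y"] by (intro mult_right_mono) auto
    finally show ?thesis .
  next
    case False
    have "f 0 \<le> C1 * f (- 1)" by (intro loc) auto
    also have "f (- 1) = f (- y + (y - 1))" by simp
    also have "C1 * \<dots> \<le> C1 * (C * exp (- \<delta> * (y - 1)) * f (- y))"
      using False C1 by (intro mult_left_mono decay_neg) auto
    also have "\<dots> = (C * exp (- \<delta> * (y - 1)) * C1) * f (- y)" by (simp only: ac_simps)
    also have "\<dots> = D * exp (- \<delta> * y) * f (- y)" by (simp only: e1)
    finally show ?thesis .
  qed
  have DD: "D \<le> D * D" using D1 mult_left_mono[of 1 D D] by simp
  have decay: "f (x + y) \<le> D * D * exp (- \<delta> * y) * f x" if y: "0 \<le> y" for x y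
  proof -
    consider "0 < x" | "x + y < 0" | "x \<le> 0" "0 \<le> x + y" by linarith
    then show ?thesis
    proof cases
      case 3
      have "f (x + y) \<le> D * exp (- \<delta> * (x + y)) * f 0" by (rule right) (use 3 in simp)
      also have "\<dots> \<le> D * exp (- \<delta> * (x + y)) * (D * exp (- \<delta> * (- x)) * f (- (- x)))"
        using 3 D1 by (intro mult_left_mono left) auto
      also have "\<dots> = D * D * (exp (- \<delta> * (x + y)) * exp (- \<delta> * (- x))) * f x"
        by (simp only: minus_minus ac_simps)
      also have "exp (- \<delta> * (x + y)) * exp (- \<delta> * (- x)) = exp (- \<delta> * y)"
        by (simp only: exp_add[symmetric]) (simp add: algebra_simps)
      finally show ?thesis .
    next
      case 1
      have "f (x + y) \<le> C * exp (- \<delta> * y) * f x" by (rule decay_pos[OF 1 y])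
      also have "\<dots> \<le> D * D * exp (- \<delta> * y) * f x"
        using CD DD pos[of x] by (intro mult_right_mono) auto
      finally show ?thesis .
    next
      case 2
      have "f (x + y) \<le> C * exp (- \<delta> * y) * f x" by (rule decay_neg[OF 2 y])
      also have "\<dots> \<le> D * D * exp (- \<delta> * y) * f x"
        using CD DD pos[of x] by (intro mult_right_mono) auto
      finally show ?thesis .
    qed
  qed
  have mono: "f (x + y) \<le> D * D * f x" if y: "0 \<le> y" for x y
  proof -
    have "f (x + y) \<le> D * D * exp (- \<delta> * y) * f x" by (rule decay[OF y])
    also have "\<dots> \<le> D * D * 1 * f x"
      using y d pos[of x] D1 by (intro mult_right_mono mult_left_mono) auto
    finally show ?thesis by simp
  qed
  have rev: "\<exists>K>0. \<forall>x. f x \<le> K * f (x + y)" if y: "0 \<le> y" for y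
  proof -
    obtain K where K: "0 < K" "\<And>x. 0 < x \<Longrightarrow> f x \<le> K * f (x + y)" using rev_pos[OF y] by blast
    obtain L where L: "0 < L" "\<And>x. x + y < 0 \<Longrightarrow> f x \<le> L * f (x + y)" using rev_neg[OF y] by blast
    have D0: "0 < D" using D1 by simp
    let ?M = "D * D * L * C1 * K * (D * D)"
    have "f x \<le> max (max K L) ?M * f (x + y)" for x
    proof -
      consider "0 < x" | "x + y < 0" | "x \<le> 0" "0 \<le> x + y" by linarith
      then show ?thesis
      proof cases
        case 1
        have "f x \<le> K * f (x + y)" by (rule K(2)[OF 1])
        also have "\<dots> \<le> max (max K L) ?M * f (x + y)"
          using pos[of "x + y"] by (intro mult_right_mono) auto
        finally show ?thesis .
      next
        case 2
        have "f x \<le> L * f (x + y)" by (rule L(2)[OF 2])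
        also have "\<dots> \<le> max (max K L) ?M * f (x + y)"
          using pos[of "x + y"] by (intro mult_right_mono) auto
        finally show ?thesis .
      next
        case 3
        \<comment> \<open>Leave the critical range: back to \<open>- y - 1\<close>, across 0 from \<open>- 1\<close> to \<open>1\<close>, on to \<open>1 + y\<close>.\<close>
        have "f x \<le> D * D * f (- y - 1)" using mono[of "x + y + 1" "- y - 1"] 3 by simp
        moreover have "f (- y - 1) \<le> L * f (- 1)" using L(2)[of "- y - 1"] by simp
        moreover have "f (- 1) \<le> C1 * f 1" by (intro loc) auto
        moreover have "f 1 \<le> K * f (1 + y)" by (rule K(2)) simp
        moreover have "f (1 + y) \<le> D * D * f (x + y)" using mono[of "1 - x" "x + y"] 3 by (simp add: add.commute)
        ultimately have "f x \<le> D * D * (L * (C1 * (K * (D * D * f (x + y)))))"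
          using D0 L(1) K(1) C1
          by (smt (verit) mult_left_mono mult_pos_pos)
        also have "\<dots> = ?M * f (x + y)" by (simp only: mult.assoc)
        also have "\<dots> \<le> max (max K L) ?M * f (x + y)"
          using pos[of "x + y"] by (intro mult_right_mono) auto
        finally show ?thesis .
      qed
    qed
    moreover have "0 < max (max K L) ?M" using K(1) by simp
    ultimately show ?thesis by blast
  qed
  have "0 < D * D" using D1 by simp
  then show ?thesis
    unfolding exp_decay_def using pos d decay rev by blast
qed

text \<open>Applied to \<open>c\<close>, in case i): with $C_0(e^x)$ for $x<0$ and $C_\infty(e^{-x})$ for $x>0$ as the two halves of
  one function of $\sigma$, a dilation of the argument is a translation in $\sigma$.\<close>

lemma exp_decay_of_indices:
  fixes f \<phi>n \<phi>p :: "real \<Rightarrow> real"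
  assumes pos: "\<And>x. 0 < f x"
    and n: "\<And>x. x < 0 \<Longrightarrow> \<phi>n (exp x) = f x" and p: "\<And>x. 0 < x \<Longrightarrow> \<phi>p (exp (- x)) = f x"
    and ext: "has_extension_indices 1 \<phi>n" "has_extension_indices 1 \<phi>p"
    and lb: "dilation_locally_bounded 1 \<phi>n" "dilation_locally_bounded 1 \<phi>p"
    and loc: "1 \<le> C1" "\<And>x y. \<bar>x\<bar> \<le> 1 \<Longrightarrow> \<bar>y\<bar> \<le> 1 \<Longrightarrow> f x \<le> C1 * f y"
    and idx: "rho_index 1 \<phi>n < 0" "0 < pi_index 1 \<phi>p"
  shows "exp_decay f"
proof -
  have one: "(0::ereal) < 1" by simp
  have posn: "0 < \<phi>n s" if "0 < s" "ereal s < 1" for s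
    using n[of "ln s"] pos[of "ln s"] that by simp
  have posp: "0 < \<phi>p s" if "0 < s" "ereal s < 1" for s
    using p[of "- ln s"] pos[of "- ln s"] that by simp
  define \<kappa> \<mu> where "\<kappa> = rho_index 1 \<phi>n / 2" and "\<mu> = pi_index 1 \<phi>p / 2"
  have \<kappa>: "rho_index 1 \<phi>n < \<kappa>" "\<kappa> < 0" and \<mu>: "\<mu> < pi_index 1 \<phi>p" "0 < \<mu>"
    using idx by (auto simp: \<kappa>_def \<mu>_def)
  obtain Cn where Cn: "0 < Cn" "\<And>t s. 1 \<le> t \<Longrightarrow> 0 < s \<Longrightarrow> ereal (t * s) < 1 \<Longrightarrow>
      \<phi>n (t * s) \<le> Cn * t powr \<kappa> * \<phi>n s"
    using rho_index_bound[OF one posn ext(1) lb(1) \<kappa>(1)] by metis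
  obtain Cp where Cp: "0 < Cp" "\<And>t s. 0 < t \<Longrightarrow> t \<le> 1 \<Longrightarrow> 0 < s \<Longrightarrow> ereal s < 1 \<Longrightarrow>
      \<phi>p (t * s) \<le> Cp * t powr \<mu> * \<phi>p s"
    using pi_index_bound[OF one posp ext(2) lb(2) \<mu>(1)] by metis
  define \<delta> where "\<delta> = min (- \<kappa>) \<mu>"
  define C where "C = max 1 (max Cn Cp)"
  show ?thesis
  proof (rule exp_decay_glue[OF pos _ _ loc(1) _ _ loc(2)])
    show "0 < \<delta>" "1 \<le> C" using \<kappa> \<mu> by (auto simp: \<delta>_def C_def)
    fix x y :: real
    assume "0 < x" "0 \<le> y"
    have "exp (- y) * exp (- x) = exp (- (x + y))" by (simp add: exp_add[symmetric])
    then have "f (x + y) = \<phi>p (exp (- y) * exp (- x))"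
      using p[of "x + y"] \<open>0 < x\<close> \<open>0 \<le> y\<close> by simp
    also have "\<dots> \<le> Cp * exp (- y) powr \<mu> * \<phi>p (exp (- x))"
      using \<open>0 < x\<close> \<open>0 \<le> y\<close> by (intro Cp) auto
    also have "\<phi>p (exp (- x)) = f x" by (rule p[OF \<open>0 < x\<close>])
    also have "Cp * exp (- y) powr \<mu> * f x \<le> C * exp (- \<delta> * y) * f x"
    proof -
      have "- \<mu> * y \<le> - \<delta> * y" using \<open>0 \<le> y\<close> by (intro mult_right_mono) (auto simp: \<delta>_def)
      then show ?thesis
        using pos[of x] Cp(1) by (intro mult_right_mono mult_mono) (auto simp: C_def powr_def)
    qed
    finally show "f (x + y) \<le> C * exp (- \<delta> * y) * f x" .
  next
    fix x y :: real
    assume "x + y < 0" "0 \<le> y"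
    have "f (x + y) = \<phi>n (exp y * exp x)"
      using n[of "x + y"] \<open>x + y < 0\<close> by (simp add: exp_add mult.commute)
    also have "\<dots> \<le> Cn * exp y powr \<kappa> * \<phi>n (exp x)"
      using \<open>x + y < 0\<close> \<open>0 \<le> y\<close> by (intro Cn) (auto simp: exp_add[symmetric])
    also have "\<phi>n (exp x) = f x" by (rule n) (use \<open>x + y < 0\<close> \<open>0 \<le> y\<close> in simp)
    also have "Cn * exp y powr \<kappa> * f x \<le> C * exp (- \<delta> * y) * f x"
    proof -
      have "\<kappa> * y \<le> - \<delta> * y" using \<open>0 \<le> y\<close> by (intro mult_right_mono) (auto simp: \<delta>_def)
      then show ?thesis
        using pos[of x] Cn by (intro mult_right_mono mult_mono) (auto simp: C_def powr_def)
    qed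
    finally show "f (x + y) \<le> C * exp (- \<delta> * y) * f x" .
  next
    fix y :: real
    assume y: "0 \<le> y"
    show "\<exists>K>0. \<forall>x>0. f x \<le> K * f (x + y)"
    proof (intro exI conjI allI impI)
      show "0 < dilation_norm 1 \<phi>p (exp y)"
        by (rule dilation_norm_pos[OF one posp ext(2)]) simp_all
      fix x :: real assume x: "0 < x"
      have "\<phi>p (exp y * exp (- (x + y))) \<le> dilation_norm 1 \<phi>p (exp y) * \<phi>p (exp (- (x + y)))"
        using x y by (intro dilation_norm_bound[OF one posp ext(2)]) (auto simp: exp_add[symmetric])
      moreover have "exp y * exp (- (x + y)) = exp (- x)" by (simp add: exp_add[symmetric])
      ultimately show "f x \<le> dilation_norm 1 \<phi>p (exp y) * f (x + y)"
        using p[of x] p[of "x + y"] x y by simp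
    qed
  next
    fix y :: real
    assume y: "0 \<le> y"
    show "\<exists>K>0. \<forall>x. x + y < 0 \<longrightarrow> f x \<le> K * f (x + y)"
    proof (intro exI conjI allI impI)
      show "0 < dilation_norm 1 \<phi>n (exp (- y))"
        by (rule dilation_norm_pos[OF one posn ext(1)]) simp_all
      fix x :: real assume x: "x + y < 0"
      have "\<phi>n (exp (- y) * exp (x + y)) \<le> dilation_norm 1 \<phi>n (exp (- y)) * \<phi>n (exp (x + y))"
        using x y by (intro dilation_norm_bound[OF one posn ext(1)]) (auto simp: exp_add[symmetric])
      moreover have "exp (- y) * exp (x + y) = exp x" by (simp add: exp_add[symmetric])
      ultimately show "f x \<le> dilation_norm 1 \<phi>n (exp (- y)) * f (x + y)"
        using n[of x] n[of "x + y"] x y by simp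
    qed
  qed
qed

text \<open>Applied to \<open>b\<close>: the gap between the index of \<open>b\<close> and the index of the fundamental function leaves
  room for an exponential rate at which $g(x)\psi(e^{|x|})$ grows. The reciprocal is taken in order to have the
  same notion of decay as for \<open>c\<close>.\<close>

lemma exp_decay_of_index_gap:
  fixes g \<psi> \<phi>n \<phi>p :: "real \<Rightarrow> real"
  assumes pos: "\<And>x. 0 < g x"
    and n: "\<And>x. x < 0 \<Longrightarrow> \<phi>n (exp x) = g x" and p: "\<And>x. 0 < x \<Longrightarrow> \<phi>p (exp (- x)) = g x"
    and ext: "has_extension_indices 1 \<phi>n" "has_extension_indices 1 \<phi>p"
    and lb: "dilation_locally_bounded 1 \<phi>n" "dilation_locally_bounded 1 \<phi>p"
    and loc: "1 \<le> C1" "\<And>x y. \<bar>x\<bar> \<le> 1 \<Longrightarrow> \<bar>y\<bar> \<le> 1 \<Longrightarrow> g x \<le> C1 * g y"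
    and \<psi>: "\<And>s. 0 < s \<Longrightarrow> 0 < \<psi> s" "\<And>s t. 0 < s \<Longrightarrow> s \<le> t \<Longrightarrow> \<psi> s \<le> \<psi> t"
    and ext\<psi>: "has_extension_indices \<infinity> \<psi>" and lb\<psi>: "dilation_locally_bounded \<infinity> \<psi>"
    and idx: "rho_index 1 \<phi>p < pi_index \<infinity> \<psi>" "rho_index \<infinity> \<psi> < pi_index 1 \<phi>n"
  shows "exp_decay (\<lambda>x. 1 / (g x * \<psi> (exp \<bar>x\<bar>)))"
proof -
  have one: "(0::ereal) < 1" "(0::ereal) < \<infinity>" by simp_all
  have posn: "0 < \<phi>n s" if "0 < s" "ereal s < 1" for s
    using n[of "ln s"] pos[of "ln s"] that by simp
  have posp: "0 < \<phi>p s" if "0 < s" "ereal s < 1" for s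
    using p[of "- ln s"] pos[of "- ln s"] that by simp
  have pos\<psi>: "0 < \<psi> s" if "0 < s" "ereal s < \<infinity>" for s by (rule \<psi>(1)[OF that(1)])
  note boundn = dilation_norm_bound[OF one(1) posn ext(1)]
    and boundp = dilation_norm_bound[OF one(1) posp ext(2)]
    and bound\<psi> = dilation_norm_bound[OF one(2) pos\<psi> ext\<psi>]
    and normn = dilation_norm_pos[OF one(1) posn ext(1)]
    and normp = dilation_norm_pos[OF one(1) posp ext(2)]
    and norm\<psi> = dilation_norm_pos[OF one(2) pos\<psi> ext\<psi>]
  obtain \<kappa>1 \<kappa>2 where \<kappa>12: "rho_index 1 \<phi>p < \<kappa>1" "\<kappa>1 < \<kappa>2" "\<kappa>2 < pi_index \<infinity> \<psi>"
    using dense[OF idx(1)] dense by meson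
  obtain \<kappa>3 \<kappa>4 where \<kappa>34: "rho_index \<infinity> \<psi> < \<kappa>3" "\<kappa>3 < \<kappa>4" "\<kappa>4 < pi_index 1 \<phi>n"
    using dense[OF idx(2)] dense by meson
  obtain A1 where A1: "0 < A1" "\<And>t s. 1 \<le> t \<Longrightarrow> 0 < s \<Longrightarrow> ereal (t * s) < 1 \<Longrightarrow>
      \<phi>p (t * s) \<le> A1 * t powr \<kappa>1 * \<phi>p s"
    using rho_index_bound[OF one(1) posp ext(2) lb(2) \<kappa>12(1)] by metis
  obtain A2 where A2: "0 < A2" "\<And>t s. 0 < t \<Longrightarrow> t \<le> 1 \<Longrightarrow> 0 < s \<Longrightarrow> ereal s < \<infinity> \<Longrightarrow>
      \<psi> (t * s) \<le> A2 * t powr \<kappa>2 * \<psi> s"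
    using pi_index_bound[OF one(2) pos\<psi> ext\<psi> lb\<psi> \<kappa>12(3)] by metis
  obtain A3 where A3: "0 < A3" "\<And>t s. 1 \<le> t \<Longrightarrow> 0 < s \<Longrightarrow> ereal (t * s) < \<infinity> \<Longrightarrow>
      \<psi> (t * s) \<le> A3 * t powr \<kappa>3 * \<psi> s"
    using rho_index_bound[OF one(2) pos\<psi> ext\<psi> lb\<psi> \<kappa>34(1)] by metis
  obtain A4 where A4: "0 < A4" "\<And>t s. 0 < t \<Longrightarrow> t \<le> 1 \<Longrightarrow> 0 < s \<Longrightarrow> ereal s < 1 \<Longrightarrow>
      \<phi>n (t * s) \<le> A4 * t powr \<kappa>4 * \<phi>n s"
    using pi_index_bound[OF one(1) posn ext(1) lb(1) \<kappa>34(3)] by metis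
  define h where "h = (\<lambda>x. g x * \<psi> (exp \<bar>x\<bar>))"
  have h0: "0 < h x" for x using pos \<psi>(1) by (simp add: h_def)
  define \<delta> where "\<delta> = min (\<kappa>2 - \<kappa>1) (\<kappa>4 - \<kappa>3)"
  define C where "C = max 1 (max (A1 * A2) (A3 * A4))"
  have "1 \<le> \<psi> (exp 1) / \<psi> 1" using \<psi>(1)[of 1] \<psi>(2)[of 1 "exp 1"] by simp
  then have C2: "1 \<le> C1 * (\<psi> (exp 1) / \<psi> 1)" using loc(1) mult_mono[of 1 C1 1 "\<psi> (exp 1) / \<psi> 1"] by simp
  have flip: "1 / h u \<le> K * (1 / h v)" if "h v \<le> K * h u" for u v K
    using that h0[of u] h0[of v] by (simp add: divide_simps mult.commute)
  have "exp_decay (\<lambda>x. 1 / h x)"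
  proof (rule exp_decay_glue[OF _ _ _ C2])
    show "0 < 1 / h x" for x using h0 by simp
    show "0 < \<delta>" "1 \<le> C" using \<kappa>12 \<kappa>34 by (auto simp: \<delta>_def C_def)
    fix x y :: real
    assume x: "0 < x" and y: "0 \<le> y"
    have "g x = \<phi>p (exp y * exp (- (x + y)))"
      using p[OF x] by (simp add: exp_add[symmetric])
    also have "\<dots> \<le> A1 * exp y powr \<kappa>1 * \<phi>p (exp (- (x + y)))"
      using x y by (intro A1) (auto simp: exp_add[symmetric])
    also have "\<dots> = A1 * exp (\<kappa>1 * y) * g (x + y)" using p[of "x + y"] x y by (simp add: powr_def)
    finally have 1: "g x \<le> A1 * exp (\<kappa>1 * y) * g (x + y)" .
    have "\<psi> (exp x) = \<psi> (exp (- y) * exp (x + y))" by (simp add: exp_add[symmetric])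
    also have "\<dots> \<le> A2 * exp (- y) powr \<kappa>2 * \<psi> (exp (x + y))" using y by (intro A2) auto
    also have "\<dots> = A2 * exp (- \<kappa>2 * y) * \<psi> (exp (x + y))" by (simp add: powr_def)
    finally have 2: "\<psi> (exp x) \<le> A2 * exp (- \<kappa>2 * y) * \<psi> (exp (x + y))" .
    have "h x \<le> (A1 * exp (\<kappa>1 * y) * g (x + y)) * (A2 * exp (- \<kappa>2 * y) * \<psi> (exp (x + y)))"
      unfolding h_def using 1 2 x \<psi>(1)[of "exp x"] A1(1) pos[of "x + y"]
      by (intro mult_mono) (auto intro: less_imp_le)
    also have "\<dots> = (A1 * A2) * (exp (\<kappa>1 * y) * exp (- \<kappa>2 * y)) * h (x + y)"
      using x y by (simp add: h_def)
    also have "exp (\<kappa>1 * y) * exp (- \<kappa>2 * y) = exp (- (\<kappa>2 - \<kappa>1) * y)"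
      by (simp add: exp_add[symmetric] algebra_simps)
    also have "(A1 * A2) * exp (- (\<kappa>2 - \<kappa>1) * y) * h (x + y) \<le> C * exp (- \<delta> * y) * h (x + y)"
    proof -
      have "- (\<kappa>2 - \<kappa>1) * y \<le> - \<delta> * y" using y by (intro mult_right_mono) (auto simp: \<delta>_def)
      then show ?thesis
        using h0[of "x + y"] by (intro mult_right_mono mult_mono) (auto simp: C_def)
    qed
    finally show "1 / h (x + y) \<le> C * exp (- \<delta> * y) * (1 / h x)" by (rule flip)
  next
    fix x y :: real
    assume x: "x + y < 0" and y: "0 \<le> y"
    have x': "x < 0" "x \<le> 0" "x + y \<le> 0" using x y by auto
    have "g x = \<phi>n (exp (- y) * exp (x + y))"
      using n[OF x'(1)] by (simp add: exp_add[symmetric])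
    also have "\<dots> \<le> A4 * exp (- y) powr \<kappa>4 * \<phi>n (exp (x + y))"
      using x y by (intro A4) auto
    also have "\<dots> = A4 * exp (- \<kappa>4 * y) * g (x + y)" using n[OF x] by (simp add: powr_def)
    finally have 1: "g x \<le> A4 * exp (- \<kappa>4 * y) * g (x + y)" .
    have "\<psi> (exp (- x)) = \<psi> (exp y * exp (- (x + y)))" by (simp add: exp_add[symmetric])
    also have "\<dots> \<le> A3 * exp y powr \<kappa>3 * \<psi> (exp (- (x + y)))" using y by (intro A3) auto
    also have "\<dots> = A3 * exp (\<kappa>3 * y) * \<psi> (exp (- (x + y)))" by (simp add: powr_def)
    finally have 2: "\<psi> (exp (- x)) \<le> A3 * exp (\<kappa>3 * y) * \<psi> (exp (- (x + y)))" .
    have "h x = g x * \<psi> (exp (- x))" using x' by (simp add: h_def)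
    also have "\<dots> \<le> (A4 * exp (- \<kappa>4 * y) * g (x + y)) * (A3 * exp (\<kappa>3 * y) * \<psi> (exp (- (x + y))))"
      using 1 2 \<psi>(1)[of "exp (- x)"] A4(1) pos[of "x + y"]
      by (intro mult_mono) (auto intro: less_imp_le)
    also have "\<dots> = (A3 * A4) * (exp (- \<kappa>4 * y) * exp (\<kappa>3 * y)) * h (x + y)"
      using x' by (simp add: h_def abs_of_nonpos)
    also have "exp (- \<kappa>4 * y) * exp (\<kappa>3 * y) = exp (- (\<kappa>4 - \<kappa>3) * y)"
      by (simp add: exp_add[symmetric] algebra_simps)
    also have "(A3 * A4) * exp (- (\<kappa>4 - \<kappa>3) * y) * h (x + y) \<le> C * exp (- \<delta> * y) * h (x + y)"
    proof -
      have "- (\<kappa>4 - \<kappa>3) * y \<le> - \<delta> * y" using y by (intro mult_right_mono) (auto simp: \<delta>_def)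
      then show ?thesis
        using h0[of "x + y"] by (intro mult_right_mono mult_mono) (auto simp: C_def)
    qed
    finally show "1 / h (x + y) \<le> C * exp (- \<delta> * y) * (1 / h x)" by (rule flip)
  next
    fix x y :: real
    assume x: "\<bar>x\<bar> \<le> 1" and y: "\<bar>y\<bar> \<le> 1"
    have "\<psi> (exp \<bar>y\<bar>) \<le> \<psi> (exp 1)" using y by (intro \<psi>) auto
    also have "\<dots> = (\<psi> (exp 1) / \<psi> 1) * \<psi> 1" using \<psi>(1)[of 1] by simp
    also have "\<dots> \<le> (\<psi> (exp 1) / \<psi> 1) * \<psi> (exp \<bar>x\<bar>)"
      using \<psi>(1)[of 1] \<psi>(1)[of "exp 1"] by (intro mult_left_mono \<psi>(2)) auto
    finally have "h y \<le> (C1 * g x) * ((\<psi> (exp 1) / \<psi> 1) * \<psi> (exp \<bar>x\<bar>))"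
      unfolding h_def using loc(2)[OF y x] \<psi>(1)[of "exp \<bar>y\<bar>"] pos[of x] loc(1)
      by (intro mult_mono) auto
    also have "\<dots> = C1 * (\<psi> (exp 1) / \<psi> 1) * h x" by (simp add: h_def)
    finally show "1 / h x \<le> C1 * (\<psi> (exp 1) / \<psi> 1) * (1 / h y)" by (rule flip)
  next
    fix y :: real
    assume y: "0 \<le> y"
    let ?P = "dilation_norm 1 \<phi>p (exp (- y))" and ?Q = "dilation_norm \<infinity> \<psi> (exp y)"
    have PQ: "0 < ?P" "0 < ?Q" by (rule normp norm\<psi>; simp)+
    show "\<exists>K>0. \<forall>x>0. 1 / h x \<le> K * (1 / h (x + y))"
    proof (intro exI conjI allI impI)
      show "0 < ?P * ?Q" using PQ by simp
      fix x :: real assume x: "0 < x"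
      have "\<phi>p (exp (- y) * exp (- x)) \<le> ?P * \<phi>p (exp (- x))"
        using x y by (intro boundp) (auto simp: exp_add[symmetric])
      moreover have "exp (- y) * exp (- x) = exp (- (x + y))" by (simp add: exp_add[symmetric])
      ultimately have 1: "g (x + y) \<le> ?P * g x"
        using p[OF x] p[of "x + y"] x y by simp
      have "\<psi> (exp y * exp x) \<le> ?Q * \<psi> (exp x)" by (intro bound\<psi>) auto
      then have 2: "\<psi> (exp (x + y)) \<le> ?Q * \<psi> (exp x)" by (simp add: exp_add mult.commute)
      have "h (x + y) \<le> (?P * g x) * (?Q * \<psi> (exp x))"
        unfolding h_def using 1 2 x y PQ pos[of x] \<psi>(1)[of "exp (x + y)"]
        by (intro mult_mono) (auto intro: less_imp_le)
      also have "\<dots> = ?P * ?Q * h x" using x by (simp add: h_def)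
      finally show "1 / h x \<le> ?P * ?Q * (1 / h (x + y))" by (rule flip)
    qed
  next
    fix y :: real
    assume y: "0 \<le> y"
    let ?P = "dilation_norm 1 \<phi>n (exp y)" and ?Q = "dilation_norm \<infinity> \<psi> (exp (- y))"
    have PQ: "0 < ?P" "0 < ?Q" by (rule normn norm\<psi>; simp)+
    show "\<exists>K>0. \<forall>x. x + y < 0 \<longrightarrow> 1 / h x \<le> K * (1 / h (x + y))"
    proof (intro exI conjI allI impI)
      show "0 < ?P * ?Q" using PQ by simp
      fix x :: real assume x: "x + y < 0"
      have x': "x < 0" "x \<le> 0" "x + y \<le> 0" using x y by auto
      have "\<phi>n (exp y * exp x) \<le> ?P * \<phi>n (exp x)"
        using x x' by (intro boundn) (auto simp: exp_add[symmetric])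
      then have 1: "g (x + y) \<le> ?P * g x"
        using n[OF x] n[OF x'(1)] by (simp add: exp_add mult.commute)
      have "\<psi> (exp (- y) * exp (- x)) \<le> ?Q * \<psi> (exp (- x))" by (intro bound\<psi>) auto
      moreover have "exp (- y) * exp (- x) = exp (- (x + y))" by (simp add: exp_add[symmetric])
      ultimately have 2: "\<psi> (exp (- (x + y))) \<le> ?Q * \<psi> (exp (- x))" by simp
      have "h (x + y) = g (x + y) * \<psi> (exp (- (x + y)))" using x' by (simp add: h_def abs_of_nonpos)
      also have "\<dots> \<le> (?P * g x) * (?Q * \<psi> (exp (- x)))"
        using 1 2 PQ pos[of x] \<psi>(1)[of "exp (- (x + y))"]
        by (intro mult_mono) (auto intro: less_imp_le)
      also have "\<dots> = ?P * ?Q * h x" using x' by (simp add: h_def)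
      finally show "1 / h x \<le> ?P * ?Q * (1 / h (x + y))" by (rule flip)
    qed
  qed
  then show ?thesis by (simp add: h_def)
qed

section \<open>Slowly varying functions\<close>

lemma slowly_varying_pos: "slowly_varying b \<Longrightarrow> 0 < t \<Longrightarrow> 0 < b t"
  by (simp add: slowly_varying_def)

lemma slowly_varying_measurable: "slowly_varying b \<Longrightarrow> b \<in> borel_measurable halfline"
  by (simp add: slowly_varying_def)

text \<open>Take $\varepsilon=1$ in the definition: $t\,\mathrm b(t)$ handles $x\le y$ and
  $t^{-1}\mathrm b(t)$ handles $y\le x$.\<close>

lemma slowly_varying_comparable:
  assumes b: "slowly_varying b" and K: "1 \<le> K"
  obtains C where "1 \<le> C" "\<And>x y. 0 < x \<Longrightarrow> 0 < y \<Longrightarrow> x \<le> K * y \<Longrightarrow> y \<le> K * x \<Longrightarrow> b x \<le> C * b y"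
proof -
  have "almost_increasing_on {0<..} (\<lambda>t. t powr 1 * b t)"
    "almost_decreasing_on {0<..} (\<lambda>t. t powr (- 1) * b t)"
    using b unfolding slowly_varying_def by (blast intro: zero_less_one)+
  then obtain g h A B A' B' where g: "mono_on {0<..} g" and h: "antimono_on {0<..} h"
    and c: "0 < A" "0 < B" "0 < A'" "0 < B'"
    and gA: "\<And>t. 0 < t \<Longrightarrow> t powr 1 * b t \<le> A * g t" and gB: "\<And>t. 0 < t \<Longrightarrow> g t \<le> B * (t powr 1 * b t)"
    and hA: "\<And>t. 0 < t \<Longrightarrow> t powr (- 1) * b t \<le> A' * h t"
    and hB: "\<And>t. 0 < t \<Longrightarrow> h t \<le> B' * (t powr (- 1) * b t)"
    unfolding almost_increasing_on_def almost_decreasing_on_def equiv_on_def lesssim_on_def by auto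
  define C where "C = max 1 (max (A * B * K) (A' * B' * K))"
  have "b x \<le> C * b y" if xy: "0 < x" "0 < y" "x \<le> K * y" "y \<le> K * x" for x y
  proof -
    have bx: "0 < b x" and by': "0 < b y" using slowly_varying_pos[OF b] xy by auto
    show ?thesis
    proof (cases "x \<le> y")
      case True
      have "x * b x \<le> A * g x" using gA[of x] xy by simp
      also have "\<dots> \<le> A * g y" using g xy True c by (intro mult_left_mono) (auto simp: monotone_on_def)
      also have "\<dots> \<le> A * (B * (y * b y))" using gB[of y] c xy by (intro mult_left_mono) auto
      also have "\<dots> \<le> A * (B * ((K * x) * b y))"
        using c xy by' by (intro mult_left_mono mult_right_mono) auto
      also have "\<dots> = x * (A * B * K * b y)" by simp
      finally have "b x \<le> A * B * K * b y" using xy by simp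
      also have "\<dots> \<le> C * b y" using by' by (intro mult_right_mono) (auto simp: C_def)
      finally show ?thesis .
    next
      case False
      have "b x / x \<le> A' * h x" using hA[of x] xy by (simp add: powr_minus divide_inverse mult.commute)
      also have "\<dots> \<le> A' * h y" using h xy False c by (intro mult_left_mono) (auto simp: monotone_on_def)
      also have "\<dots> \<le> A' * (B' * (b y / y))"
        using hB[of y] c xy by (intro mult_left_mono) (auto simp: powr_minus divide_inverse mult.commute)
      finally have "b x \<le> x * (A' * (B' * (b y / y)))" using xy by (simp add: divide_simps mult.commute)
      also have "\<dots> \<le> (K * y) * (A' * (B' * (b y / y)))"
        using c xy by' by (intro mult_right_mono) auto
      also have "\<dots> = A' * B' * K * b y" using xy by simp
      also have "\<dots> \<le> C * b y" using by' by (intro mult_right_mono) (auto simp: C_def)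
      finally show ?thesis .
    qed
  qed
  moreover have "1 \<le> C" by (simp add: C_def)
  ultimately show ?thesis using that by blast
qed

lemma slowly_varying_local:
  assumes b: "slowly_varying b" and sg: "\<bar>e\<bar> = 1"
  obtains C where "1 \<le> C"
    "\<And>x y. \<bar>x\<bar> \<le> 1 \<Longrightarrow> \<bar>y\<bar> \<le> 1 \<Longrightarrow> b (exp_scale (e * x)) \<le> C * b (exp_scale (e * y))"
proof -
  define K where "K = exp (2 * exp 1 :: real)"
  have K: "1 \<le> K" by (simp add: K_def)
  obtain C where C: "1 \<le> C"
    "\<And>x y. 0 < x \<Longrightarrow> 0 < y \<Longrightarrow> x \<le> K * y \<Longrightarrow> y \<le> K * x \<Longrightarrow> b x \<le> C * b y"
    using slowly_varying_comparable[OF b K] by metis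
  have sm: "\<bar>signed_expm1 (e * x)\<bar> \<le> exp 1" if "\<bar>x\<bar> \<le> 1" for x
  proof -
    have ex: "\<bar>e * x\<bar> \<le> 1" using that sg by (simp add: abs_mult)
    have "\<bar>signed_expm1 (e * x)\<bar> = \<bar>sgn (e * x)\<bar> * \<bar>exp \<bar>e * x\<bar> - 1\<bar>"
      unfolding signed_expm1_def by (rule abs_mult)
    also have "\<dots> \<le> 1 * \<bar>exp \<bar>e * x\<bar> - 1\<bar>" by (intro mult_right_mono) (auto simp: abs_sgn_eq)
    also have "\<dots> \<le> exp \<bar>e * x\<bar>" by simp
    also have "\<dots> \<le> exp 1" using ex by simp
    finally show ?thesis .
  qed
  have near: "exp_scale (e * x) \<le> K * exp_scale (e * y)" if "\<bar>x\<bar> \<le> 1" "\<bar>y\<bar> \<le> 1" for x y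
    using sm[OF that(1)] sm[OF that(2)] by (simp add: K_def exp_scale_def exp_add[symmetric] abs_le_iff)
  show ?thesis by (rule that[OF C(1)]) (use near in \<open>auto intro!: C(2)\<close>)
qed

text \<open>$B_0$ and $B_\infty$ vary by a bounded factor as long as $1/u$ varies by at most 1.\<close>

lemma slowly_varying_dilation_locally_bounded:
  assumes b: "slowly_varying b" and sg: "\<bar>e\<bar> = 1"
    and B: "\<And>u. 0 < u \<Longrightarrow> u < 1 \<Longrightarrow> B u = b (exp (e * (1 - 1 / u)))" and ext: "has_extension_indices 1 B"
  shows "dilation_locally_bounded 1 B"
proof -
  obtain C where C: "1 \<le> C"
    "\<And>x y. 0 < x \<Longrightarrow> 0 < y \<Longrightarrow> x \<le> exp 1 * y \<Longrightarrow> y \<le> exp 1 * x \<Longrightarrow> b x \<le> C * b y"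
    using slowly_varying_comparable[OF b, of "exp 1"] by (metis one_le_exp_iff zero_le_one)
  show ?thesis
  proof (rule dilation_locally_boundedI[OF _ ext])
    show "0 < B s" if "0 < s" "s < 1" for s
      using B[OF that] slowly_varying_pos[OF b] by simp
    show "0 < C" using C(1) by simp
    fix r :: real assume r: "0 < r" "r < 1"
    have "isCont (\<lambda>u. 1 / u) r" using r by (intro continuous_intros) auto
    then obtain d where d: "0 < d" "\<And>r'. \<bar>r' - r\<bar> < d \<Longrightarrow> \<bar>1 / r' - 1 / r\<bar> < 1"
      unfolding continuous_at_eps_delta dist_real_def by (meson zero_less_one)
    have "B r \<le> C * B r'" if r': "0 < r'" "r' < 1" "\<bar>r' - r\<bar> < d" for r'
    proof -
      have "\<bar>e * (1 - 1 / r) - e * (1 - 1 / r')\<bar> = \<bar>e\<bar> * \<bar>1 / r' - 1 / r\<bar>"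
        by (simp add: abs_mult[symmetric] algebra_simps)
      also have "\<dots> \<le> 1" using d(2)[OF r'(3)] sg by simp
      finally have "e * (1 - 1 / r) \<le> 1 + e * (1 - 1 / r')" "e * (1 - 1 / r') \<le> 1 + e * (1 - 1 / r)"
        by auto
      then show ?thesis
        unfolding B[OF r] B[OF r'(1,2)] by (intro C(2)) (auto simp: exp_add[symmetric])
    qed
    then show "\<exists>d>0. \<forall>r'. 0 < r' \<longrightarrow> r' < 1 \<longrightarrow> \<bar>r' - r\<bar> < d \<longrightarrow> B r \<le> C * B r'"
      using d(1) by blast
  qed
qed

section \<open>The fundamental function\<close>

lemma is_K_parameterD:
  assumes "is_K_parameter D E"
  shows is_K_parameter_lattice: "banach_lattice halfline D"
    and is_K_parameter_min: "D (\<lambda>t. ennreal (min 1 t)) < \<infinity>"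
    and is_K_parameter_eq: "f \<in> borel_measurable halfline \<Longrightarrow> E f = K_space_norm halfline D f"
  using assms unfolding is_K_parameter_def by auto

text \<open>The levels $l=0$ and $l=1$ give $K(t,\chi_A)\le\min(|A|,t)\lesssim\min(1,t)$.\<close>

lemma K_space_norm_indicator_finite:
  assumes DE: "is_K_parameter D E" and A: "A \<in> sets M" "emeasure M A < \<infinity>"
  shows "K_space_norm M D (indicator A) < \<infinity>"
proof -
  note D = is_K_parameter_lattice[OF DE]
  obtain r where r: "0 \<le> r" "emeasure M A = ennreal r"
    using A(2) by (cases "emeasure M A") auto
  have "K_space_norm M D (indicator A) \<le> D (\<lambda>t. ennreal (max 1 r) * ennreal (min 1 t))"
    unfolding K_space_norm_def
  proof (intro banach_lattice_mono[OF D] AE_halflineI)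
    fix t :: real assume t: "0 < t"
    have "K_L1_Linf M t (indicator A) \<le> (1 - 0) * emeasure M A + ennreal t * 0"
      unfolding K_L1_Linf_indicator[OF A(1) t] by (rule INF_lower) simp
    then have 1: "K_L1_Linf M t (indicator A) \<le> ennreal r" using r by simp
    have "K_L1_Linf M t (indicator A) \<le> (1 - 1) * emeasure M A + ennreal t * 1"
      unfolding K_L1_Linf_indicator[OF A(1) t] by (rule INF_lower) simp
    then have "K_L1_Linf M t (indicator A) \<le> ennreal t" by simp
    with 1 have "K_L1_Linf M t (indicator A) \<le> ennreal (min r t)" by (simp add: min_def)
    also have "\<dots> \<le> ennreal (max 1 r * min 1 t)"
    proof (intro ennreal_leI)
      show "min r t \<le> max 1 r * min 1 t"
      proof (cases "t \<le> 1")
        case True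
        then have "min r t \<le> 1 * t" by simp
        also have "\<dots> \<le> max 1 r * t" using t by (intro mult_right_mono) auto
        finally show ?thesis using True by simp
      qed simp
    qed
    also have "\<dots> = ennreal (max 1 r) * ennreal (min 1 t)" using t by (simp add: ennreal_mult)
    finally show "K_L1_Linf M t (indicator A) \<le> ennreal (max 1 r) * ennreal (min 1 t)" .
  qed (auto intro!: measurable_halfline_borel)
  also have "\<dots> = ennreal (max 1 r) * D (\<lambda>t. ennreal (min 1 t))"
    by (rule banach_lattice_cmult[OF D]) (auto intro!: measurable_halfline_borel)
  also have "\<dots> < \<infinity>"
    using is_K_parameter_min[OF DE] by (simp add: ennreal_mult_less_top)
  finally show ?thesis .
qed

lemma not_AE_halfline_False: "\<not> (AE x in halfline. False)"
proof
  assume "AE x in halfline. False"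
  then have "emeasure halfline (space halfline) = 0"
    using ae_filter_eq_bot_iff[of halfline] by (simp add: trivial_limit_def)
  moreover have "emeasure halfline {0<..<1} \<le> emeasure halfline (space halfline)"
    by (intro emeasure_mono sets.top) auto
  ultimately show False using emeasure_halfline_interval[of 1] by simp
qed

text \<open>$K(t,\chi_A)\ge\min(|A|,t)$, since $(1-l)_++l\ge1$ for every level.\<close>

lemma K_space_norm_indicator_pos:
  assumes D: "banach_lattice halfline D" and A: "A \<in> sets M" "0 < emeasure M A"
  shows "0 < K_space_norm M D (indicator A)"
proof (rule ccontr)
  assume "\<not> ?thesis"
  then have "D (\<lambda>t. K_L1_Linf M t (indicator A)) = 0" by (simp add: K_space_norm_def)
  then have ae: "AE t in halfline. K_L1_Linf M t (indicator A) = 0"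
    by (simp add: banach_lattice_zero_iff[OF D])
  have "K_L1_Linf M t (indicator A) \<noteq> 0" if t: "0 < t" for t
  proof -
    have "min (emeasure M A) (ennreal t) \<le> K_L1_Linf M t (indicator A)"
      unfolding K_L1_Linf_indicator[OF A(1) t]
    proof (rule INF_greatest)
      fix l :: ennreal
      let ?m = "min (emeasure M A) (ennreal t)"
      have "1 \<le> (1 - l) + l" by (metis add.commute add_diff_self_ennreal linear order_refl)
      then have "?m * 1 \<le> ?m * ((1 - l) + l)" by (rule mult_left_mono) simp
      also have "\<dots> = (1 - l) * ?m + ?m * l" by (subst distrib_left) (simp only: mult.commute)
      also have "\<dots> \<le> (1 - l) * emeasure M A + ennreal t * l"
        by (intro add_mono mult_left_mono mult_right_mono) auto
      finally show "?m \<le> (1 - l) * emeasure M A + ennreal t * l" by simp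
    qed
    moreover have "0 < min (emeasure M A) (ennreal t)" using A t by (auto simp: min_less_iff_conj)
    ultimately show ?thesis by (metis not_less_zero order_less_le_trans)
  qed
  then have "AE x in halfline. K_L1_Linf M x (indicator A) \<noteq> 0" by (intro AE_halflineI)
  with ae have "AE x in halfline. False" by eventually_elim simp
  then show False using not_AE_halfline_False by simp
qed

context
  fixes D E :: fnorm
  assumes DE: "is_K_parameter D E"
begin

lemma fundamental_function_eq:
  assumes "0 < r"
  shows "ennreal (fundamental_function E r) = K_space_norm halfline D (indicator {0<..<r})"
    and "0 < fundamental_function E r"
proof -
  have m: "{0<..<r} \<in> sets halfline" by (intro sets_halfline_borel) auto
  have e: "E (indicator {0<..<r}) = K_space_norm halfline D (indicator {0<..<r})"
    using m by (intro is_K_parameter_eq[OF DE]) simp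
  have fin: "K_space_norm halfline D (indicator {0<..<r}) < \<infinity>"
    using assms by (intro K_space_norm_indicator_finite[OF DE m]) (simp add: emeasure_halfline_interval)
  have pos: "0 < K_space_norm halfline D (indicator {0<..<r})"
    using assms by (intro K_space_norm_indicator_pos[OF is_K_parameter_lattice[OF DE] m])
      (simp add: emeasure_halfline_interval)
  show "ennreal (fundamental_function E r) = K_space_norm halfline D (indicator {0<..<r})"
    using fin by (simp add: fundamental_function_def e)
  with pos show "0 < fundamental_function E r" by (metis ennreal_0 ennreal_eq_0_iff less_irrefl not_le)
qed

text \<open>The norm of an indicator depends only on the measure of the set, whichever of the measures $dt$,
  $dt/t$ is used. In this way $\varphi_E$ measures indicators in $\widetilde E$.\<close>

lemma K_space_norm_indicator_le:
  assumes "A \<in> sets M" "0 < r" "emeasure M A \<le> ennreal r"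
  shows "K_space_norm M D (indicator A) \<le> ennreal (fundamental_function E r)"
  unfolding fundamental_function_eq(1)[OF assms(2)]
  using assms by (intro K_space_norm_indicator_mono[OF is_K_parameter_lattice[OF DE]])
    (auto simp: emeasure_halfline_interval intro!: sets_halfline_borel)

lemma K_space_norm_indicator_ge:
  assumes "A \<in> sets M" "0 < r" "ennreal r \<le> emeasure M A"
  shows "ennreal (fundamental_function E r) \<le> K_space_norm M D (indicator A)"
  unfolding fundamental_function_eq(1)[OF assms(2)]
  using assms by (intro K_space_norm_indicator_mono[OF is_K_parameter_lattice[OF DE]])
    (auto simp: emeasure_halfline_interval intro!: sets_halfline_borel)

lemma fundamental_function_mono:
  assumes "0 < r" "r \<le> s"
  shows "fundamental_function E r \<le> fundamental_function E s"
proof -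
  have "ennreal (fundamental_function E r) \<le> ennreal (fundamental_function E s)"
    unfolding fundamental_function_eq(1)[OF assms(1)]
    using assms by (intro K_space_norm_indicator_le)
      (auto simp: emeasure_halfline_interval intro!: sets_halfline_borel)
  then show ?thesis
    using fundamental_function_eq(2)[of s] assms by simp
qed

text \<open>$K(x,\chi_{(0,tr)})\le t\,K(x,\chi_{(0,r)})$ for $t\ge1$, level by level.\<close>

lemma fundamental_function_mult:
  assumes "1 \<le> t" "0 < r"
  shows "fundamental_function E (t * r) \<le> t * fundamental_function E r"
proof -
  note D = is_K_parameter_lattice[OF DE]
  have m: "{0<..<q} \<in> sets halfline" for q :: real by (intro sets_halfline_borel) auto
  have tr: "0 < t * r" using assms by simp
  have "K_space_norm halfline D (indicator {0<..<t * r})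
      \<le> D (\<lambda>x. ennreal t * K_L1_Linf halfline x (indicator {0<..<r}))"
    unfolding K_space_norm_def
  proof (intro banach_lattice_mono[OF D] AE_halflineI)
    fix x :: real assume x: "0 < x"
    have "ennreal (1 / t) * K_L1_Linf halfline x (indicator {0<..<t * r})
        \<le> K_L1_Linf halfline x (indicator {0<..<r})"
      unfolding K_L1_Linf_indicator[OF m x]
    proof (rule INF_greatest)
      fix l :: ennreal
      have "ennreal (1 / t) * (INF l. (1 - l) * emeasure halfline {0<..<t * r} + ennreal x * l)
          \<le> ennreal (1 / t) * ((1 - l) * emeasure halfline {0<..<t * r} + ennreal x * l)"
        by (intro mult_left_mono INF_lower) auto
      also have "\<dots> = (1 - l) * (ennreal (1 / t) * ennreal (t * r)) + ennreal (1 / t) * (ennreal x * l)"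
        using tr by (simp add: emeasure_halfline_interval distrib_left ac_simps)
      also have "ennreal (1 / t) * ennreal (t * r) = ennreal r"
        using assms by (simp add: ennreal_mult[symmetric])
      also have "ennreal (1 / t) * (ennreal x * l) \<le> 1 * (ennreal x * l)"
        using assms by (intro mult_right_mono) (auto simp: divide_simps)
      finally show "ennreal (1 / t) * (INF l. (1 - l) * emeasure halfline {0<..<t * r} + ennreal x * l)
          \<le> (1 - l) * emeasure halfline {0<..<r} + ennreal x * l"
        using assms by (simp add: emeasure_halfline_interval add_left_mono)
    qed
    then have "ennreal t * (ennreal (1 / t) * K_L1_Linf halfline x (indicator {0<..<t * r}))
        \<le> ennreal t * K_L1_Linf halfline x (indicator {0<..<r})" by (rule mult_left_mono) simp
    moreover have "ennreal t * (ennreal (1 / t) * y) = y" for y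
      using assms by (simp add: mult.assoc[symmetric] ennreal_mult[symmetric])
    ultimately show "K_L1_Linf halfline x (indicator {0<..<t * r})
        \<le> ennreal t * K_L1_Linf halfline x (indicator {0<..<r})" by simp
  qed auto
  also have "\<dots> = ennreal t * K_space_norm halfline D (indicator {0<..<r})"
    unfolding K_space_norm_def using assms by (intro banach_lattice_cmult[OF D]) auto
  finally have "ennreal (fundamental_function E (t * r)) \<le> ennreal (t * fundamental_function E r)"
    using assms fundamental_function_eq(2)[of r]
    by (simp add: fundamental_function_eq(1) tr ennreal_mult)
  then show ?thesis using assms fundamental_function_eq(2)[of r] by simp
qed

lemma fundamental_function_extension_indices:
  "has_extension_indices \<infinity> (fundamental_function E)"
  "dilation_locally_bounded \<infinity> (fundamental_function E)"
proof -
  have le: "fundamental_function E (t * s) \<le> max 1 t * fundamental_function E s" if "0 < t" "0 < s" for t s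
  proof (cases "1 \<le> t")
    case False
    then have "t * s \<le> s" using that by simp
    then show ?thesis using fundamental_function_mono[of "t * s" s] that False by simp
  qed (use fundamental_function_mult that in simp)
  show ext: "has_extension_indices \<infinity> (fundamental_function E)"
    unfolding has_extension_indices_def
  proof (intro allI impI)
    fix t :: real assume t: "0 < t"
    have "dilation_sup \<infinity> (fundamental_function E) t \<le> ennreal (max 1 t)"
      unfolding dilation_sup_eq[OF t]
    proof (rule SUP_least)
      fix s assume "s \<in> {s. 0 < s \<and> ereal s < \<infinity> \<and> ereal (t * s) < \<infinity>}"
      then show "ennreal (fundamental_function E (t * s) / fundamental_function E s) \<le> ennreal (max 1 t)"
        using le[OF t, of s] fundamental_function_eq(2)[of s]
        by (intro ennreal_leI) (auto simp: pos_divide_le_eq)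
    qed
    then show "dilation_sup \<infinity> (fundamental_function E) t < \<infinity>"
      by (rule le_less_trans) simp
  qed
  have norm: "dilation_norm \<infinity> (fundamental_function E) t \<le> max 1 t" if "0 < t" for t
    using that fundamental_function_eq(2) le by (intro dilation_norm_least[OF _ _ ext]) auto
  have "\<forall>t\<in>{2..3}. dilation_norm \<infinity> (fundamental_function E) t \<le> 3"
  proof
    fix t :: real assume "t \<in> {2..3}"
    then show "dilation_norm \<infinity> (fundamental_function E) t \<le> 3"
      using norm[of t] by auto
  qed
  moreover have "\<forall>t\<in>{2..3}. dilation_norm \<infinity> (fundamental_function E) (1 / t) \<le> 1"
  proof
    fix t :: real assume "t \<in> {2..3}"
    then show "dilation_norm \<infinity> (fundamental_function E) (1 / t) \<le> 1"
      using norm[of "1 / t"] by (auto simp: max_def)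
  qed
  ultimately show "dilation_locally_bounded \<infinity> (fundamental_function E)"
    unfolding dilation_locally_bounded_def
    by (intro conjI exI[of _ "2::real"] exI[of _ "3::real"]) auto
qed

end

section \<open>Iterated norms on an abstract cell decomposition\<close>

text \<open>The factor may be infinite here, as the norm of a function over a cell can be.\<close>

lemma K_space_norm_cmult_ge:
  assumes D: "banach_lattice halfline D" and f: "f \<in> borel_measurable M"
  shows "y * K_space_norm M D f \<le> K_space_norm M D (\<lambda>x. y * f x)"
proof -
  have scale: "ennreal r * K_space_norm M D f \<le> K_space_norm M D (\<lambda>x. ennreal r * f x)" if "0 \<le> r" for r
  proof (cases "r = 0")
    case False
    with that have r: "0 < r" by simp
    have inv: "ennreal (1 / r) * (ennreal r * z) = z" "ennreal r * (ennreal (1 / r) * z) = z" for z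
      using r by (simp_all add: mult.assoc[symmetric] ennreal_mult[symmetric])
    have "K_space_norm M D (\<lambda>x. ennreal (1 / r) * (ennreal r * f x))
        \<le> ennreal (1 / r) * K_space_norm M D (\<lambda>x. ennreal r * f x)"
      using f r by (intro K_space_norm_cmult[OF D]) auto
    then have "ennreal r * K_space_norm M D f
        \<le> ennreal r * (ennreal (1 / r) * K_space_norm M D (\<lambda>x. ennreal r * f x))"
      by (intro mult_left_mono) (simp_all only: inv zero_le)
    then show ?thesis by (simp only: inv)
  qed simp
  show ?thesis
  proof (cases y)
    case (real r)
    then show ?thesis using scale[of r] by simp
  next
    case top
    have "of_nat n * K_space_norm M D f \<le> K_space_norm M D (\<lambda>x. top * f x)" for n :: nat
    proof -
      have "ennreal (real n) * K_space_norm M D f \<le> K_space_norm M D (\<lambda>x. ennreal (real n) * f x)"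
        by (rule scale) simp
      also have "\<dots> \<le> K_space_norm M D (\<lambda>x. top * f x)"
        using f by (intro K_space_norm_mono[OF D]) (auto intro!: mult_right_mono)
      finally show ?thesis by (simp add: ennreal_of_nat_eq_real_of_nat)
    qed
    then have "(SUP n. of_nat n * K_space_norm M D f) \<le> K_space_norm M D (\<lambda>x. top * f x)"
      by (intro SUP_least)
    then show ?thesis using top by (simp add: SUP_mult_right_ennreal[symmetric] ennreal_SUP_of_nat_eq_top)
  qed
qed

text \<open>Measurability matters: for a non-measurable function the set of decompositions is empty and the norm
  is that of the constant $\infty$.\<close>

lemma tilde_norm_mono_set:
  assumes D: "banach_lattice halfline D" and g: "g \<in> borel_measurable halfline"
    and S: "S \<in> sets halfline" "T \<in> sets halfline" "S \<subseteq> T"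
  shows "tilde_norm D S g \<le> tilde_norm D T g"
  unfolding tilde_norm_def
  by (intro K_space_norm_mono[OF D] AE_I2) (use g S in \<open>auto simp: indicator_def\<close>)

text \<open>The two sides of the theorem are compared in terms of an index \<open>J\<close> of cells: \<open>A u\<close> stands for
  $(0,u)$ or $(u,\infty)$, and \<open>B u t\<close> for the interval between \<open>t\<close> and \<open>u\<close>. All that is used of them is
  which cells they contain and which cells they meet. The number \<open>cJ j\<close> represents the weight \<open>c\<close> on the
  cell \<open>j\<close>. The last hypothesis says that up to a constant the norm of \<open>b\<close> over \<open>A u\<close> is already
  attained on the cells before the one that precedes the cell of \<open>u\<close>.\<close>

context
  fixes DE DF DG :: fnorm and J :: "real \<Rightarrow> int"
    and A :: "real \<Rightarrow> real set" and B :: "real \<Rightarrow> real \<Rightarrow> real set"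
    and b c :: "real \<Rightarrow> real" and cJ :: "int \<Rightarrow> real" and \<delta> C :: real
  assumes DE: "banach_lattice halfline DE" and DF: "banach_lattice halfline DF"
    and DG: "banach_lattice halfline DG"
    and J [measurable]: "J \<in> halfline \<rightarrow>\<^sub>M count_space UNIV"
    and mJ: "\<And>j. emeasure hat_measure {x \<in> space hat_measure. J x = j} = 1"
    and A_sets: "\<And>u. 0 < u \<Longrightarrow> A u \<in> sets halfline"
    and A_J: "\<And>u s. 0 < u \<Longrightarrow> s \<in> A u \<Longrightarrow> 0 < s \<and> J s \<le> J u"
    and J_A: "\<And>u s. 0 < u \<Longrightarrow> 0 < s \<Longrightarrow> J s < J u \<Longrightarrow> s \<in> A u"
    and B_sets: "\<And>u t. 0 < u \<Longrightarrow> 0 < t \<Longrightarrow> B u t \<in> sets halfline"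
    and B_A: "\<And>u t. 0 < u \<Longrightarrow> 0 < t \<Longrightarrow> B u t \<subseteq> A u"
    and J_B: "\<And>u s t. 0 < u \<Longrightarrow> 0 < s \<Longrightarrow> 0 < t \<Longrightarrow> J t < J s \<Longrightarrow> J s < J u \<Longrightarrow> s \<in> B u t"
    and b [measurable]: "b \<in> borel_measurable halfline" and c_pos: "\<And>u. 0 < u \<Longrightarrow> 0 < c u"
    and \<delta>: "0 < \<delta>" and C: "0 < C"
    and c_decay: "\<And>u n. 0 < u \<Longrightarrow> c u \<le> C * exp (- \<delta> * real n) * cJ (J u - int n)"
    and c_rev: "\<And>u. 0 < u \<Longrightarrow> cJ (J u - 1) \<le> C * c u"
    and \<beta>_pos: "\<And>u. 0 < u \<Longrightarrow> 0 < tilde_norm DF (A u) (\<lambda>t. ennreal (b t))"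
    and \<beta>_fin: "\<And>u. 0 < u \<Longrightarrow> tilde_norm DF (A u) (\<lambda>t. ennreal (b t)) < \<infinity>"
    and \<beta>_rev: "\<And>u. 0 < u \<Longrightarrow> tilde_norm DF (A u) (\<lambda>t. ennreal (b t))
        \<le> ennreal C * tilde_norm DF {t. 0 < t \<and> J t < J u - 1} (\<lambda>t. ennreal (b t))"
begin

abbreviation (input) "outer_weight u \<equiv> c u / enn2real (tilde_norm DF (A u) (\<lambda>t. ennreal (b t)))"

abbreviation (input) "iterated_norm g u \<equiv>
  tilde_norm DF (A u) (\<lambda>t. ennreal (b t) * tilde_norm DG (B u t) g)"

text \<open>The set \<open>B u t\<close> lies in \<open>A u\<close>, so the inner norm has a bound independent of \<open>t\<close>, and the outer
  weight compensates the norm of \<open>b\<close> that remains.\<close>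

lemma iterated_norm_le:
  assumes g: "g \<in> borel_measurable halfline"
    and mR: "(\<lambda>u. ennreal (outer_weight u) * iterated_norm g u) \<in> borel_measurable halfline"
    and mN: "(\<lambda>u. ennreal (c u) * tilde_norm DG (A u) g) \<in> borel_measurable halfline"
    and mB: "\<And>u. 0 < u \<Longrightarrow> (\<lambda>t. tilde_norm DG (B u t) g) \<in> borel_measurable halfline"
  shows "hat_norm DE (\<lambda>u. ennreal (outer_weight u) * iterated_norm g u)
    \<le> hat_norm DE (\<lambda>u. ennreal (c u) * tilde_norm DG (A u) g)"
  unfolding hat_norm_def
proof (rule K_space_norm_mono[OF DE _ _ AE_I2])
  show "(\<lambda>u. ennreal (outer_weight u) * iterated_norm g u) \<in> borel_measurable hat_measure"
    "(\<lambda>u. ennreal (c u) * tilde_norm DG (A u) g) \<in> borel_measurable hat_measure"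
    using mR mN by (simp_all cong: measurable_cong_sets)
  fix u assume "u \<in> space hat_measure"
  then have u: "0 < u" by simp
  let ?N = "tilde_norm DG (A u) g" and ?\<beta> = "tilde_norm DF (A u) (\<lambda>t. ennreal (b t))"
  note [measurable] = A_sets[OF u] mB[OF u]
  show "ennreal (outer_weight u) * iterated_norm g u \<le> ennreal (c u) * ?N"
  proof (cases "?N = top")
    case True
    then show ?thesis using c_pos[OF u] by (simp add: ennreal_mult_top)
  next
    case False
    then obtain r where r: "0 \<le> r" "?N = ennreal r" by (cases ?N) auto
    obtain q where q: "0 < q" "?\<beta> = ennreal q"
      using \<beta>_pos[OF u] \<beta>_fin[OF u] by (cases ?\<beta>) auto
    have "iterated_norm g u
        \<le> K_space_norm tilde_measure DF (\<lambda>t. ennreal r * (ennreal (b t) * indicator (A u) t))"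
      unfolding tilde_norm_def[of DF]
    proof (intro K_space_norm_mono[OF DF] AE_I2)
      fix t assume "t \<in> space tilde_measure"
      then have t: "0 < t" by simp
      have "tilde_norm DG (B u t) g \<le> ennreal r"
        unfolding r(2)[symmetric] using u t
        by (intro tilde_norm_mono_set[OF DG g] B_sets A_sets B_A) auto
      then have "ennreal (b t) * tilde_norm DG (B u t) g \<le> ennreal (b t) * ennreal r"
        by (rule mult_left_mono) simp
      then show "ennreal (b t) * tilde_norm DG (B u t) g * indicator (A u) t
          \<le> ennreal r * (ennreal (b t) * indicator (A u) t)"
        by (auto simp: indicator_def mult.commute)
    qed measurable
    also have "\<dots> \<le> ennreal r * ?\<beta>"
      unfolding tilde_norm_def by (intro K_space_norm_cmult[OF DF _ r(1)]) measurable
    finally have "ennreal (outer_weight u) * iterated_norm g u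
        \<le> ennreal (outer_weight u) * (ennreal r * ?\<beta>)" by (rule mult_left_mono) simp
    also have "\<dots> = ennreal (c u) * ?N"
      using q r c_pos[OF u] by (simp add: ennreal_mult[symmetric])
    finally show ?thesis .
  qed
qed

text \<open>Both sides are compared with the step function whose value on the cell \<open>j\<close> is \<open>cJ j * e j\<close>,
  where \<open>e j\<close> is the norm of \<open>g\<close> over that cell.\<close>

lemma iterated_norm_ge:
  assumes g: "g \<in> borel_measurable halfline"
    and mR: "(\<lambda>u. ennreal (outer_weight u) * iterated_norm g u) \<in> borel_measurable halfline"
    and mN: "(\<lambda>u. ennreal (c u) * tilde_norm DG (A u) g) \<in> borel_measurable halfline"
    and mB: "\<And>u. 0 < u \<Longrightarrow> (\<lambda>t. tilde_norm DG (B u t) g) \<in> borel_measurable halfline"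
  shows "hat_norm DE (\<lambda>u. ennreal (c u) * tilde_norm DG (A u) g)
    \<le> ennreal (C / (1 - exp (- \<delta>)) * (C * C))
      * hat_norm DE (\<lambda>u. ennreal (outer_weight u) * iterated_norm g u)"
proof -
  define I where "I = (\<lambda>j. {s \<in> space halfline. J s = j})"
  have I [measurable]: "I j \<in> sets halfline" for j unfolding I_def by measurable
  define e where "e = (\<lambda>j. tilde_norm DG (I j) g)"
  define S where "S = (\<lambda>j. ennreal (cJ j) * e j)"
  have J': "J \<in> hat_measure \<rightarrow>\<^sub>M count_space UNIV" using J by (simp cong: measurable_cong_sets)
  have mS: "(\<lambda>u. s (J u)) \<in> borel_measurable hat_measure" for s :: "int \<Rightarrow> ennreal"
    using J' by (rule measurable_compose) simp
  note shift = K_space_norm_shift[OF DE J' mJ]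
  have cut: "ennreal (c u) * tilde_norm DG (A u) g
      \<le> (\<Sum>n. ennreal (C * exp (- \<delta> * real n)) * S (J u - int n))" if u: "0 < u" for u
  proof -
    have "tilde_norm DG (A u) g
        \<le> K_space_norm tilde_measure DG (\<lambda>s. \<Sum>n. g s * indicator (I (J u - int n)) s)"
      unfolding tilde_norm_def
    proof (intro K_space_norm_mono[OF DG] AE_I2)
      fix s :: real
      show "g s * indicator (A u) s \<le> (\<Sum>n. g s * indicator (I (J u - int n)) s)"
      proof (cases "s \<in> A u")
        case True
        define n where "n = nat (J u - J s)"
        have "s \<in> I (J u - int n)" using A_J[OF u True] by (simp add: I_def n_def)
        then have "g s * indicator (A u) s = (\<Sum>n\<in>{n}. g s * indicator (I (J u - int n)) s)"
          using True by simp
        also have "\<dots> \<le> (\<Sum>n. g s * indicator (I (J u - int n)) s)" by (rule sum_le_suminf) auto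
        finally show ?thesis .
      qed simp
    qed (use g A_sets[OF u] in measurable)
    also have "\<dots> \<le> (\<Sum>n. e (J u - int n))"
      unfolding e_def tilde_norm_def
      by (intro K_space_norm_suminf[OF DG]) (use g in measurable)
    finally have "ennreal (c u) * tilde_norm DG (A u) g \<le> ennreal (c u) * (\<Sum>n. e (J u - int n))"
      by (rule mult_left_mono) simp
    also have "\<dots> = (\<Sum>n. ennreal (c u) * e (J u - int n))" by (simp add: ennreal_suminf_cmult)
    also have "\<dots> \<le> (\<Sum>n. ennreal (C * exp (- \<delta> * real n)) * S (J u - int n))"
    proof (intro suminf_le)
      fix n
      have "ennreal (c u) \<le> ennreal (C * exp (- \<delta> * real n) * cJ (J u - int n))"
        using c_decay[OF u] by (rule ennreal_leI)
      also have "\<dots> = ennreal (C * exp (- \<delta> * real n)) * ennreal (cJ (J u - int n))"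
        using C by (intro ennreal_mult') (simp add: mult_pos_pos less_imp_le)
      finally show "ennreal (c u) * e (J u - int n)
          \<le> ennreal (C * exp (- \<delta> * real n)) * S (J u - int n)"
        unfolding S_def mult.assoc[symmetric] by (rule mult_right_mono) simp
    qed auto
    finally show ?thesis .
  qed
  have geom: "(\<Sum>n. ennreal (C * exp (- \<delta> * real n))) = ennreal (C / (1 - exp (- \<delta>)))"
  proof (rule suminf_ennreal_eq)
    have "(\<lambda>n. exp (- \<delta>) ^ n) sums (1 / (1 - exp (- \<delta>)))" using \<delta> by (intro geometric_sums) simp
    then have "(\<lambda>n. C * exp (- \<delta>) ^ n) sums (C * (1 / (1 - exp (- \<delta>))))" by (rule sums_mult)
    then show "(\<lambda>n. C * exp (- \<delta> * real n)) sums (C / (1 - exp (- \<delta>)))"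
      by (simp add: exp_of_nat_mult[symmetric] mult.commute)
  qed (use C in simp)
  have "hat_norm DE (\<lambda>u. ennreal (c u) * tilde_norm DG (A u) g)
      \<le> K_space_norm hat_measure DE (\<lambda>u. \<Sum>n. ennreal (C * exp (- \<delta> * real n)) * S (J u - int n))"
    unfolding hat_norm_def
    by (intro K_space_norm_mono[OF DE] AE_I2 cut borel_measurable_suminf_order
          mS[of "\<lambda>j. \<Sum>n. ennreal (C * exp (- \<delta> * real n)) * S (j - int n)"])
       (use mN in \<open>auto cong: measurable_cong_sets\<close>)
  also have "\<dots> \<le> (\<Sum>n. K_space_norm hat_measure DE (\<lambda>u. ennreal (C * exp (- \<delta> * real n)) * S (J u - int n)))"
    by (intro K_space_norm_suminf[OF DE] mS[of "\<lambda>j. ennreal _ * S (j - int _)"])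
  also have "\<dots> \<le> (\<Sum>n. ennreal (C * exp (- \<delta> * real n)) * K_space_norm hat_measure DE (\<lambda>u. S (J u)))"
  proof (intro suminf_le)
    fix n
    have "K_space_norm hat_measure DE (\<lambda>u. ennreal (C * exp (- \<delta> * real n)) * S (J u - int n))
        \<le> ennreal (C * exp (- \<delta> * real n)) * K_space_norm hat_measure DE (\<lambda>u. S (J u - int n))"
      using C by (intro K_space_norm_cmult[OF DE] mS[of "\<lambda>j. S (j - int n)"]) simp
    also have "\<dots> \<le> ennreal (C * exp (- \<delta> * real n)) * K_space_norm hat_measure DE (\<lambda>u. S (J u))"
      by (intro mult_left_mono shift) simp
    finally show "K_space_norm hat_measure DE (\<lambda>u. ennreal (C * exp (- \<delta> * real n)) * S (J u - int n))
        \<le> ennreal (C * exp (- \<delta> * real n)) * K_space_norm hat_measure DE (\<lambda>u. S (J u))" .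
  qed auto
  also have "\<dots> = ennreal (C / (1 - exp (- \<delta>))) * K_space_norm hat_measure DE (\<lambda>u. S (J u))"
    by (simp only: ennreal_suminf_multc geom)
  \<comment> \<open>Another shift: below \<open>u\<close> only the cells before \<open>J u\<close> are fully contained in \<open>A u\<close>.\<close>
  also have "K_space_norm hat_measure DE (\<lambda>u. S (J u))
      \<le> K_space_norm hat_measure DE (\<lambda>u. S (J u - 1))"
    using shift[of "\<lambda>j. S (j - 1)" "- 1"] by simp
  also have "\<dots> \<le> ennreal (C * C) * hat_norm DE (\<lambda>u. ennreal (outer_weight u) * iterated_norm g u)"
  proof -
    have "K_space_norm hat_measure DE (\<lambda>u. S (J u - 1)) \<le> K_space_norm hat_measure DE
        (\<lambda>u. ennreal (C * C) * (ennreal (outer_weight u) * iterated_norm g u))"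
    proof (intro K_space_norm_mono[OF DE] AE_I2)
      show "(\<lambda>u. S (J u - 1)) \<in> borel_measurable hat_measure" by (rule mS[of "\<lambda>j. S (j - 1)"])
      show "(\<lambda>u. ennreal (C * C) * (ennreal (outer_weight u) * iterated_norm g u))
          \<in> borel_measurable hat_measure"
        using mR by (auto cong: measurable_cong_sets)
      fix u assume "u \<in> space hat_measure"
      then have u: "0 < u" by simp
      let ?\<beta> = "tilde_norm DF (A u) (\<lambda>t. ennreal (b t))"
      define T where "T = {t. 0 < t \<and> J t < J u - 1}"
      let ?X = "tilde_norm DF T (\<lambda>t. ennreal (b t))"
      note [measurable] = A_sets[OF u] mB[OF u]
      have "{t \<in> space halfline. J t < J u - 1} \<in> sets halfline" by measurable
      then have T [measurable]: "T \<in> sets halfline" by (simp add: T_def greaterThan_def)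
      have "e (J u - 1) * ?X \<le> K_space_norm tilde_measure DF
          (\<lambda>t. e (J u - 1) * (ennreal (b t) * indicator T t))"
        unfolding tilde_norm_def[of DF] by (rule K_space_norm_cmult_ge[OF DF]) measurable
      also have "\<dots> \<le> iterated_norm g u"
        unfolding tilde_norm_def[of DF]
      proof (intro K_space_norm_mono[OF DF] AE_I2)
        fix t assume "t \<in> space tilde_measure"
        then have t: "0 < t" by simp
        show "e (J u - 1) * (ennreal (b t) * indicator T t)
            \<le> ennreal (b t) * tilde_norm DG (B u t) g * indicator (A u) t"
        proof (cases "t \<in> T")
          case True
          then have Jt: "J t < J u - 1" by (simp add: T_def)
          have "I (J u - 1) \<subseteq> B u t"
            using u t Jt by (auto simp: I_def intro!: J_B)
          then have "e (J u - 1) \<le> tilde_norm DG (B u t) g"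
            unfolding e_def by (intro tilde_norm_mono_set[OF DG g I B_sets[OF u t]])
          then have "e (J u - 1) * ennreal (b t) \<le> tilde_norm DG (B u t) g * ennreal (b t)"
            by (rule mult_right_mono) simp
          moreover have "t \<in> A u" using u t Jt by (intro J_A) auto
          ultimately show ?thesis using True by (simp add: mult.commute)
        qed simp
      qed measurable
      finally have it: "e (J u - 1) * ?X \<le> iterated_norm g u" .
      obtain q where q: "0 < q" "?\<beta> = ennreal q"
        using \<beta>_pos[OF u] \<beta>_fin[OF u] by (cases ?\<beta>) auto
      have "S (J u - 1) \<le> ennreal (C * c u) * e (J u - 1)"
        unfolding S_def using c_rev[OF u] by (intro mult_right_mono ennreal_leI) auto
      also have "\<dots> = ennreal C * ennreal (c u / q) * (ennreal q * e (J u - 1))"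
        using C q c_pos[OF u] by (simp add: mult.assoc[symmetric] ennreal_mult[symmetric])
      also have "\<dots> \<le> ennreal C * ennreal (c u / q) * (ennreal C * ?X * e (J u - 1))"
        using \<beta>_rev[OF u] unfolding q(2) T_def by (intro mult_left_mono mult_right_mono) auto
      also have "\<dots> = (ennreal C * ennreal C) * (ennreal (c u / q) * (e (J u - 1) * ?X))"
        by (simp only: ac_simps)
      also have "\<dots> \<le> (ennreal C * ennreal C) * (ennreal (c u / q) * iterated_norm g u)"
        by (intro mult_left_mono it) auto
      also have "\<dots> = ennreal (C * C) * (ennreal (outer_weight u) * iterated_norm g u)"
        using q C by (simp add: ennreal_mult)
      finally show "S (J u - 1) \<le> ennreal (C * C) * (ennreal (outer_weight u) * iterated_norm g u)" .
    qed
    also have "\<dots> \<le> ennreal (C * C) * hat_norm DE (\<lambda>u. ennreal (outer_weight u) * iterated_norm g u)"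
      unfolding hat_norm_def using mR C by (intro K_space_norm_cmult[OF DE]) (auto cong: measurable_cong_sets)
    finally show ?thesis .
  qed
  finally have "hat_norm DE (\<lambda>u. ennreal (c u) * tilde_norm DG (A u) g)
      \<le> ennreal (C / (1 - exp (- \<delta>))) * (ennreal (C * C) *
        hat_norm DE (\<lambda>u. ennreal (outer_weight u) * iterated_norm g u))"
    by (simp add: mult_left_mono)
  moreover have "ennreal (C / (1 - exp (- \<delta>)) * (C * C)) = ennreal (C / (1 - exp (- \<delta>))) * ennreal (C * C)"
    using C by (intro ennreal_mult'') simp
  ultimately show ?thesis by (simp only: mult.assoc)
qed

end

section \<open>Unit cells in the logarithmic coordinate\<close>

text \<open>The sign \<open>e\<close> orients the coordinate: with \<open>e = - 1\<close> the cells are numbered from infinity down to 0.\<close>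

definition unit_index :: "real \<Rightarrow> real \<Rightarrow> int" where
  "unit_index e u = \<lfloor>e * log_scale u\<rfloor>"

lemma measurable_unit_index [measurable]: "unit_index e \<in> halfline \<rightarrow>\<^sub>M count_space UNIV"
  unfolding unit_index_def[abs_def] by measurable

definition unit_cell :: "real \<Rightarrow> int \<Rightarrow> real set" where
  "unit_cell e j = {u. 0 < u \<and> unit_index e u = j}"

lemma sets_unit_cell [measurable]: "unit_cell e j \<in> sets halfline"
proof -
  have "{u \<in> space halfline. unit_index e u = j} \<in> sets halfline" by measurable
  then show ?thesis by (simp add: unit_cell_def greaterThan_def)
qed

text \<open>The $du/u$-measure of a cell is of order $e^{|j|}$ (see the next lemma); the constants come from
  $2\le e\le3$.\<close>

lemma signed_expm1_unit_step:
  "exp \<bar>real_of_int j\<bar> / 2 \<le> signed_expm1 (real_of_int j + 1) - signed_expm1 (real_of_int j)"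
  "signed_expm1 (real_of_int j + 1) - signed_expm1 (real_of_int j) \<le> 2 * exp \<bar>real_of_int j\<bar>"
proof -
  have e: "2 \<le> exp (1::real)" "exp 1 \<le> (3::real)" using exp_ge_add_one_self[of "1::real"] exp_le by auto
  have "exp \<bar>real_of_int j\<bar> / 2 \<le> signed_expm1 (real_of_int j + 1) - signed_expm1 (real_of_int j)
    \<and> signed_expm1 (real_of_int j + 1) - signed_expm1 (real_of_int j) \<le> 2 * exp \<bar>real_of_int j\<bar>"
  proof (cases "0 \<le> j")
    case True
    let ?E = "exp (real_of_int j)"
    have "signed_expm1 (real_of_int j + 1) - signed_expm1 (real_of_int j) = (exp 1 - 1) * ?E"
      using True by (simp add: signed_expm1_nonneg exp_add algebra_simps)
    moreover have "1 / 2 * ?E \<le> (exp 1 - 1) * ?E" "(exp 1 - 1) * ?E \<le> 2 * ?E"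
      using e by (intro mult_right_mono; simp)+
    ultimately show ?thesis using True by simp
  next
    case False
    then have j: "real_of_int j + 1 \<le> 0" "real_of_int j \<le> 0" by auto
    let ?E = "exp (- real_of_int j)"
    have "signed_expm1 (real_of_int j + 1) - signed_expm1 (real_of_int j) = (1 - exp (- 1)) * ?E"
      using j by (simp add: signed_expm1_nonpos algebra_simps exp_add[symmetric])
    moreover have "1 / 2 * ?E \<le> (1 - exp (- 1)) * ?E" "(1 - exp (- 1)) * ?E \<le> 2 * ?E"
      using e by (intro mult_right_mono; simp add: exp_minus divide_simps)+
    ultimately show ?thesis using j by (simp add: abs_of_nonpos)
  qed
  then show "exp \<bar>real_of_int j\<bar> / 2 \<le> signed_expm1 (real_of_int j + 1) - signed_expm1 (real_of_int j)"
    "signed_expm1 (real_of_int j + 1) - signed_expm1 (real_of_int j) \<le> 2 * exp \<bar>real_of_int j\<bar>"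
    by auto
qed

text \<open>For both orientations a cell is an interval $[x,x+1]$ in the coordinate $\sigma$, up to end points,
  with $x$ an integer.\<close>

lemma unit_cell_measures:
  assumes sg: "e = 1 \<or> e = - 1"
  shows "emeasure hat_measure (unit_cell e j) = 1"
    and "emeasure tilde_measure (unit_cell e j)
      = ennreal (signed_expm1 (real_of_int j + 1) - signed_expm1 (real_of_int j))"
proof -
  define x where "x = (if e = 1 then real_of_int j else - real_of_int j - 1)"
  have x: "0 \<le> x \<or> x + 1 \<le> 0" by (auto simp: x_def)
  have sub: "{exp_scale x<..<exp_scale (x + 1)} \<subseteq> unit_cell e j"
    "unit_cell e j \<subseteq> {exp_scale x..exp_scale (x + 1)}"
  proof -
    show "{exp_scale x<..<exp_scale (x + 1)} \<subseteq> unit_cell e j"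
    proof
      fix u assume u: "u \<in> {exp_scale x<..<exp_scale (x + 1)}"
      then have u0: "0 < u" using less_trans[OF exp_scale_pos[of x], of u] by simp
      with u have "x < log_scale u" "log_scale u < x + 1"
        by (simp_all add: log_less_exp_scale_iff exp_scale_less_log_iff)
      then show "u \<in> unit_cell e j"
        using sg u0 by (auto simp: unit_cell_def unit_index_def x_def floor_eq_iff split: if_splits)
    qed
    show "unit_cell e j \<subseteq> {exp_scale x..exp_scale (x + 1)}"
    proof
      fix u assume u: "u \<in> unit_cell e j"
      then have u0: "0 < u" by (simp add: unit_cell_def)
      have "x \<le> log_scale u" "log_scale u \<le> x + 1"
        using u sg by (auto simp: unit_cell_def unit_index_def x_def floor_eq_iff split: if_splits)
      then have "\<not> u < exp_scale x" "\<not> exp_scale (x + 1) < u"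
        using u0 by (simp_all add: log_less_exp_scale_iff exp_scale_less_log_iff)
      then show "u \<in> {exp_scale x..exp_scale (x + 1)}" by auto
    qed
  qed
  show "emeasure hat_measure (unit_cell e j) = 1"
    using emeasure_hat_interval[OF _ x sets_unit_cell sub] by simp
  have "exp_scale x \<le> exp_scale (x + 1)" using exp_scale_less_iff[of x "x + 1"] by (intro less_imp_le) simp
  then have "emeasure tilde_measure (unit_cell e j) = ennreal (signed_expm1 (x + 1) - signed_expm1 x)"
    using emeasure_tilde_interval[OF exp_scale_pos _ sets_unit_cell sub] by (simp add: ln_exp_scale)
  also have "signed_expm1 (x + 1) - signed_expm1 x
      = signed_expm1 (real_of_int j + 1) - signed_expm1 (real_of_int j)"
    using signed_expm1_minus[of "real_of_int j"] signed_expm1_minus[of "real_of_int j + 1"] sg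
    by (auto simp: x_def)
  finally show "emeasure tilde_measure (unit_cell e j)
      = ennreal (signed_expm1 (real_of_int j + 1) - signed_expm1 (real_of_int j))" .
qed

lemma exp_decayE:
  assumes "exp_decay f"
  obtains C \<delta> where "1 \<le> C" "0 < \<delta>" "\<And>x y. x \<le> y \<Longrightarrow> f y \<le> C * exp (- \<delta> * (y - x)) * f x"
    "\<And>x y. x \<le> y \<Longrightarrow> f y \<le> C * f x"
proof -
  obtain C \<delta> where C: "0 < C" "0 < \<delta>"
    "\<And>x y. 0 \<le> y \<Longrightarrow> f (x + y) \<le> C * exp (- \<delta> * y) * f x" and pos: "\<And>x. 0 < f x"
    using assms unfolding exp_decay_def by blast
  have 1: "f y \<le> max 1 C * exp (- \<delta> * (y - x)) * f x" if "x \<le> y" for x y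
  proof -
    have "f y \<le> C * exp (- \<delta> * (y - x)) * f x" using C(3)[of "y - x" x] that by simp
    also have "\<dots> \<le> max 1 C * exp (- \<delta> * (y - x)) * f x"
      using pos[of x] by (intro mult_right_mono) auto
    finally show ?thesis .
  qed
  have 2: "f y \<le> max 1 C * f x" if "x \<le> y" for x y
  proof -
    have "f y \<le> max 1 C * exp (- \<delta> * (y - x)) * f x" by (rule 1[OF that])
    also have "\<dots> \<le> max 1 C * 1 * f x"
      using pos[of x] that C(2) by (intro mult_right_mono mult_left_mono) auto
    finally show ?thesis by simp
  qed
  show ?thesis by (rule that[of "max 1 C" \<delta>]) (use C(2) 1 2 in auto)
qed

lemma exp_decay_reverseE:
  assumes "exp_decay f" "0 \<le> y"
  obtains C where "1 \<le> C" "\<And>x. f x \<le> C * f (x + y)"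
proof -
  obtain C where C: "0 < C" "\<And>x. f x \<le> C * f (x + y)" and pos: "\<And>x. 0 < f x"
    using assms unfolding exp_decay_def by blast
  have "f x \<le> max 1 C * f (x + y)" for x
    by (rule order_trans[OF C(2)]) (use pos[of "x + y"] in \<open>auto intro: mult_right_mono\<close>)
  then show ?thesis using that[of "max 1 C"] by auto
qed

lemma unit_index_bounds:
  "real_of_int (unit_index e u) \<le> e * log_scale u" "e * log_scale u \<le> real_of_int (unit_index e u) + 1"
  unfolding unit_index_def by linarith+

lemma exp_scale_oriented:
  assumes "e = 1 \<or> e = - 1" "0 < u"
  shows "exp_scale (e * (e * log_scale u)) = u"
  using assms by auto

lemma outer_weight_discrete:
  assumes sg: "e = 1 \<or> e = - 1" and f: "exp_decay (\<lambda>x. c (exp_scale (e * x)))"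
  obtains C \<delta> where "1 \<le> C" "0 < \<delta>"
    "\<And>u n. 0 < u \<Longrightarrow> c u \<le> C * exp (- \<delta> * real n) * c (exp_scale (e * real_of_int (unit_index e u - int n)))"
    "\<And>u. 0 < u \<Longrightarrow> c (exp_scale (e * real_of_int (unit_index e u - 1))) \<le> C * c u"
proof -
  let ?f = "\<lambda>x. c (exp_scale (e * x))"
  have pos: "0 < ?f x" for x using f unfolding exp_decay_def by blast
  obtain C \<delta> where C: "1 \<le> C" "0 < \<delta>" "\<And>x y. x \<le> y \<Longrightarrow> ?f y \<le> C * exp (- \<delta> * (y - x)) * ?f x"
    "\<And>x y. x \<le> y \<Longrightarrow> ?f y \<le> C * ?f x" using exp_decayE[OF f] by metis
  obtain K where K: "1 \<le> K" "\<And>x. ?f x \<le> K * ?f (x + 2)" using exp_decay_reverseE[OF f, of 2] by auto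
  have CK1: "C \<le> K * C" using C(1) K(1) mult_right_mono[of 1 K C] by simp
  note CK = CK1 order_trans[OF C(1) CK1]
  show ?thesis
  proof (rule that[OF CK(2) C(2)])
    fix u :: real and n assume u: "0 < u"
    let ?x = "e * log_scale u" and ?j = "real_of_int (unit_index e u - int n)"
    have cu: "c u = ?f ?x" using exp_scale_oriented[OF sg u] by simp
    have le: "?j \<le> ?x" "real n \<le> ?x - ?j" using unit_index_bounds[of e u] by auto
    have "c u \<le> C * exp (- \<delta> * (?x - ?j)) * ?f ?j" unfolding cu by (rule C(3)[OF le(1)])
    also have "\<dots> \<le> (K * C) * exp (- \<delta> * real n) * ?f ?j"
      using pos[of ?j] le C CK by (intro mult_right_mono mult_mono) auto
    finally show "c u \<le> (K * C) * exp (- \<delta> * real n) * ?f ?j" .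
  next
    fix u :: real assume u: "0 < u"
    let ?x = "e * log_scale u" and ?j = "real_of_int (unit_index e u - 1)"
    have cu: "c u = ?f ?x" using exp_scale_oriented[OF sg u] by simp
    have le: "?x \<le> ?j + 2" using unit_index_bounds[of e u] by auto
    have "?f ?j \<le> K * ?f (?j + 2)" by (rule K)
    also have "\<dots> \<le> K * (C * ?f ?x)" using K by (intro mult_left_mono C(4) le) auto
    finally show "?f ?j \<le> K * C * c u" by (simp add: cu)
  qed
qed

text \<open>On a cell \<open>b\<close> is comparable to a constant and the norm of the indicator is comparable to
  $\varphi_E(e^{|j|})$.\<close>

lemma cell_weight_norm:
  assumes sg: "e = 1 \<or> e = - 1" and DE: "is_K_parameter D E"
    and b: "b \<in> borel_measurable halfline" "\<And>t. 0 < t \<Longrightarrow> 0 < b t"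
    and k: "exp_decay (\<lambda>x. 1 / (b (exp_scale (e * x)) * fundamental_function E (exp \<bar>x\<bar>)))"
  defines "w \<equiv> \<lambda>x. b (exp_scale (e * x)) * fundamental_function E (exp \<bar>x\<bar>)"
  obtains C where "1 \<le> C"
    "\<And>j. tilde_norm D (unit_cell e j) (\<lambda>t. ennreal (b t)) \<le> ennreal (C * w (real_of_int j))"
    "\<And>j. ennreal (w (real_of_int j)) \<le> ennreal C * tilde_norm D (unit_cell e j) (\<lambda>t. ennreal (b t))"
proof -
  let ?\<psi> = "fundamental_function E"
  let ?k = "\<lambda>x. 1 / w x"
  note lat = is_K_parameter_lattice[OF DE]
  note \<psi>pos = fundamental_function_eq(2)[OF DE] and \<psi>mono = fundamental_function_mono[OF DE]
    and \<psi>mult = fundamental_function_mult[OF DE]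
  have k': "exp_decay ?k" using k by (simp add: w_def)
  have w: "0 < w x" for x using b(2) \<psi>pos by (simp add: w_def)
  obtain C where C: "1 \<le> C" "\<And>x y. x \<le> y \<Longrightarrow> ?k y \<le> C * ?k x" using exp_decayE[OF k'] by metis
  obtain K where K: "1 \<le> K" "\<And>x. ?k x \<le> K * ?k (x + 1)" using exp_decay_reverseE[OF k', of 1] by auto
  have up: "w x \<le> C * w y" if "x \<le> y" for x y
    using C(2)[OF that] w[of x] w[of y] by (simp add: divide_simps mult.commute)
  have down: "w (x + 1) \<le> K * w x" for x
    using K(2)[of x] w[of x] w[of "x + 1"] by (simp add: divide_simps mult.commute)
  define L where "L = exp 1 * (C * K)"
  have L: "1 \<le> L" "exp 1 * C \<le> L"
  proof -
    have "C * 1 \<le> C * K" using C K by (intro mult_left_mono) auto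
    then show "exp 1 * C \<le> L" unfolding L_def by (intro mult_left_mono) auto
    moreover have "1 * 1 \<le> exp 1 * C" using C by (intro mult_mono) auto
    ultimately show "1 \<le> L" by simp
  qed
  have \<psi>near: "?\<psi> (exp \<bar>x\<bar>) \<le> exp 1 * ?\<psi> (exp \<bar>y\<bar>)" if "\<bar>x - y\<bar> \<le> 1" for x y
  proof -
    have "?\<psi> (exp \<bar>x\<bar>) \<le> ?\<psi> (exp 1 * exp \<bar>y\<bar>)"
      using that by (intro \<psi>mono) (auto simp: exp_add[symmetric])
    also have "\<dots> \<le> exp 1 * ?\<psi> (exp \<bar>y\<bar>)" by (intro \<psi>mult) auto
    finally show ?thesis .
  qed
  have cell: "b u * ?\<psi> (exp \<bar>real_of_int j\<bar>) \<le> L * w (real_of_int j)"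
    "w (real_of_int j) \<le> L * (b u * ?\<psi> (exp \<bar>real_of_int j\<bar>))"
    if "u \<in> unit_cell e j" for u j
  proof -
    let ?x = "e * log_scale u" and ?j = "real_of_int j"
    have u: "0 < u" using that by (simp add: unit_cell_def)
    have jx: "?j \<le> ?x" "?x \<le> ?j + 1"
      using that unit_index_bounds[of e u] by (auto simp: unit_cell_def)
    have wx: "w ?x = b u * ?\<psi> (exp \<bar>?x\<bar>)" using exp_scale_oriented[OF sg u] by (simp add: w_def)
    have "b u * ?\<psi> (exp \<bar>?j\<bar>) \<le> b u * (exp 1 * ?\<psi> (exp \<bar>?x\<bar>))"
      using jx b(2)[OF u] by (intro mult_left_mono \<psi>near) auto
    also have "\<dots> = exp 1 * w ?x" by (simp add: wx)
    also have "\<dots> \<le> exp 1 * (C * w (?j + 1))" using jx by (intro mult_left_mono up) auto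
    also have "\<dots> \<le> exp 1 * (C * (K * w ?j))" using C by (intro mult_left_mono down) auto
    finally show "b u * ?\<psi> (exp \<bar>?j\<bar>) \<le> L * w ?j" by (simp add: L_def mult.assoc)
    have "w ?j \<le> C * w ?x" by (rule up[OF jx(1)])
    also have "\<dots> \<le> C * (b u * (exp 1 * ?\<psi> (exp \<bar>?j\<bar>)))"
      unfolding wx using jx b(2)[OF u] C by (intro mult_left_mono \<psi>near) auto
    also have "\<dots> = (exp 1 * C) * (b u * ?\<psi> (exp \<bar>?j\<bar>))" by simp
    also have "\<dots> \<le> L * (b u * ?\<psi> (exp \<bar>?j\<bar>))"
      using b(2)[OF u] \<psi>pos[of "exp \<bar>?j\<bar>"] by (intro mult_right_mono L) auto
    finally show "w ?j \<le> L * (b u * ?\<psi> (exp \<bar>?j\<bar>))" .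
  qed
  show ?thesis
  proof (rule that[of "L * 2"])
    show "1 \<le> L * 2" using L by simp
    fix j
    let ?j = "real_of_int j" and ?I = "unit_cell e j"
    let ?p = "?\<psi> (exp \<bar>?j\<bar>)"
    have p: "0 < ?p" by (rule \<psi>pos) simp
    have m: "?I \<in> sets tilde_measure" by simp
    have "tilde_norm D ?I (\<lambda>t. ennreal (b t))
        \<le> K_space_norm tilde_measure D (\<lambda>t. ennreal (L * w ?j / ?p) * indicator ?I t)"
      unfolding tilde_norm_def
    proof (intro K_space_norm_mono[OF lat] AE_I2)
      fix t
      show "ennreal (b t) * indicator ?I t \<le> ennreal (L * w ?j / ?p) * indicator ?I t"
        using cell(1)[of t j] p by (auto simp: indicator_def pos_le_divide_eq intro!: ennreal_leI)
    qed (use b in measurable)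
    also have "\<dots> \<le> ennreal (L * w ?j / ?p) * K_space_norm tilde_measure D (indicator ?I)"
      using L w[of ?j] p by (intro K_space_norm_cmult[OF lat]) auto
    also have "\<dots> \<le> ennreal (L * w ?j / ?p) * ennreal (?\<psi> (2 * exp \<bar>?j\<bar>))"
      by (intro mult_left_mono K_space_norm_indicator_le[OF DE m])
         (auto simp: unit_cell_measures[OF sg] intro!: ennreal_leI signed_expm1_unit_step)
    also have "\<dots> \<le> ennreal (L * w ?j / ?p) * ennreal (2 * ?p)"
      by (intro mult_left_mono ennreal_leI \<psi>mult) auto
    also have "\<dots> = ennreal (L * 2 * w ?j)"
      using L w[of ?j] p by (simp add: ennreal_mult[symmetric])
    finally show "tilde_norm D ?I (\<lambda>t. ennreal (b t)) \<le> ennreal (L * 2 * w ?j)" .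
    have "?p = ?\<psi> (2 * (exp \<bar>?j\<bar> / 2))" by simp
    also have "\<dots> \<le> 2 * ?\<psi> (exp \<bar>?j\<bar> / 2)" by (intro \<psi>mult) auto
    finally have half: "?p \<le> 2 * ?\<psi> (exp \<bar>?j\<bar> / 2)" .
    have Lp: "0 < L * ?p" using L p by simp
    have "ennreal (w ?j / (L * ?p)) * K_space_norm tilde_measure D (indicator ?I)
        \<le> K_space_norm tilde_measure D (\<lambda>t. ennreal (w ?j / (L * ?p)) * indicator ?I t)"
      by (intro K_space_norm_cmult_ge[OF lat]) measurable
    also have "\<dots> \<le> tilde_norm D ?I (\<lambda>t. ennreal (b t))"
      unfolding tilde_norm_def
    proof (intro K_space_norm_mono[OF lat] AE_I2)
      fix t
      show "ennreal (w ?j / (L * ?p)) * indicator ?I t \<le> ennreal (b t) * indicator ?I t"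
        using cell(2)[of t j] Lp by (auto simp: indicator_def pos_divide_le_eq ac_simps intro!: ennreal_leI)
    qed (use b in measurable)
    finally have lower: "ennreal (w ?j / (L * ?p)) * K_space_norm tilde_measure D (indicator ?I)
        \<le> tilde_norm D ?I (\<lambda>t. ennreal (b t))" .
    have "ennreal (w ?j) = ennreal L * (ennreal (w ?j / (L * ?p)) * ennreal ?p)"
      using L w[of ?j] p by (simp add: ennreal_mult[symmetric])
    also have "\<dots> \<le> ennreal L * (ennreal (w ?j / (L * ?p)) * ennreal (2 * ?\<psi> (exp \<bar>?j\<bar> / 2)))"
      by (intro mult_left_mono ennreal_leI half) auto
    also have "\<dots> = ennreal (L * 2) * (ennreal (w ?j / (L * ?p)) * ennreal (?\<psi> (exp \<bar>?j\<bar> / 2)))"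
      using L w[of ?j] p \<psi>pos[of "exp \<bar>?j\<bar> / 2"] by (simp add: ennreal_mult[symmetric])
    also have "\<dots> \<le> ennreal (L * 2) * (ennreal (w ?j / (L * ?p)) * K_space_norm tilde_measure D (indicator ?I))"
      by (intro mult_left_mono K_space_norm_indicator_ge[OF DE m])
         (auto simp: unit_cell_measures[OF sg] intro!: ennreal_leI signed_expm1_unit_step)
    also have "\<dots> \<le> ennreal (L * 2) * tilde_norm D ?I (\<lambda>t. ennreal (b t))"
      by (intro mult_left_mono lower) simp
    finally show "ennreal (w ?j) \<le> ennreal (L * 2) * tilde_norm D ?I (\<lambda>t. ennreal (b t))" .
  qed
qed

text \<open>What precedes \<open>u\<close> (and, in the next definition, lies between \<open>t\<close> and \<open>u\<close>) in the orientation given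
  by the sign \<open>e\<close>. Both cases are spelled out for every real \<open>u\<close>, so that the sets are literally
  the intervals in the norms of the theorem.\<close>

definition tail_set :: "real \<Rightarrow> real \<Rightarrow> real set" where
  "tail_set e u = (if e = 1 then {0<..<u} else {u<..})"

definition gap_set :: "real \<Rightarrow> real \<Rightarrow> real \<Rightarrow> real set" where
  "gap_set e u t = (if e = 1 then {t<..<u} else {u<..<t})"

lemma tail_set_iff: "e = 1 \<or> e = - 1 \<Longrightarrow> 0 < u \<Longrightarrow> s \<in> tail_set e u \<longleftrightarrow> 0 < s \<and> e * s < e * u"
  by (auto simp: tail_set_def)

lemma gap_set_iff: "e = 1 \<or> e = - 1 \<Longrightarrow> s \<in> gap_set e u t \<longleftrightarrow> e * t < e * s \<and> e * s < e * u"
  by (auto simp: gap_set_def)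

lemma sets_tail_set: "0 < u \<Longrightarrow> tail_set e u \<in> sets halfline"
  unfolding tail_set_def by (auto intro!: sets_halfline_borel)

lemma sets_gap_set: "0 < u \<Longrightarrow> 0 < t \<Longrightarrow> gap_set e u t \<in> sets halfline"
  unfolding gap_set_def by (auto intro!: sets_halfline_borel)

lemma unit_index_less:
  assumes "e = 1 \<or> e = - 1" "0 < s" "0 < t" "unit_index e s < unit_index e t"
  shows "e * s < e * t"
proof -
  have "e * log_scale s < e * log_scale t" using assms(4) unfolding unit_index_def by linarith
  then show ?thesis using assms(1-3) log_scale_less_iff[of s t] log_scale_less_iff[of t s] by auto
qed

lemma unit_index_mono:
  assumes "e = 1 \<or> e = - 1" "0 < s" "0 < t" "e * s < e * t"
  shows "unit_index e s \<le> unit_index e t"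
  using unit_index_less[OF assms(1,3,2)] assms(4) by (meson leI less_asym)

text \<open>The weights of the cells grow geometrically in \<open>j\<close>. The norm of \<open>b\<close> over all cells up to the one
  of \<open>u\<close> is therefore of the order of the last weight, and so is the weight of the cell two steps
  before.\<close>

lemma cumulative_weight_norm:
  assumes sg: "e = 1 \<or> e = - 1" and DE: "is_K_parameter D E"
    and b: "b \<in> borel_measurable halfline" "\<And>t. 0 < t \<Longrightarrow> 0 < b t"
    and k: "exp_decay (\<lambda>x. 1 / (b (exp_scale (e * x)) * fundamental_function E (exp \<bar>x\<bar>)))"
  obtains C where "1 \<le> C"
    "\<And>u. 0 < u \<Longrightarrow> 0 < tilde_norm D (tail_set e u) (\<lambda>t. ennreal (b t))"
    "\<And>u. 0 < u \<Longrightarrow> tilde_norm D (tail_set e u) (\<lambda>t. ennreal (b t)) < \<infinity>"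
    "\<And>u. 0 < u \<Longrightarrow> tilde_norm D (tail_set e u) (\<lambda>t. ennreal (b t))
      \<le> ennreal C * tilde_norm D {t. 0 < t \<and> unit_index e t < unit_index e u - 1} (\<lambda>t. ennreal (b t))"
proof -
  define w where "w = (\<lambda>x. b (exp_scale (e * x)) * fundamental_function E (exp \<bar>x\<bar>))"
  let ?N = "\<lambda>S. tilde_norm D S (\<lambda>t. ennreal (b t))"
  note lat = is_K_parameter_lattice[OF DE]
  have bm: "(\<lambda>t. ennreal (b t)) \<in> borel_measurable halfline" using b by measurable
  have k': "exp_decay (\<lambda>x. 1 / w x)" using k by (simp add: w_def)
  have w: "0 < w x" for x using b(2) fundamental_function_eq(2)[OF DE] by (simp add: w_def)
  obtain A where A: "1 \<le> A" "\<And>j. ?N (unit_cell e j) \<le> ennreal (A * w (real_of_int j))"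
    "\<And>j. ennreal (w (real_of_int j)) \<le> ennreal A * ?N (unit_cell e j)"
    using cell_weight_norm[OF sg DE b k] unfolding w_def by metis
  obtain C \<delta> where C: "1 \<le> C" "0 < \<delta>"
    "\<And>x y. x \<le> y \<Longrightarrow> 1 / w y \<le> C * exp (- \<delta> * (y - x)) * (1 / w x)"
    using exp_decayE[OF k'] by metis
  obtain K where K: "1 \<le> K" "\<And>x. 1 / w x \<le> K * (1 / w (x + 2))"
    using exp_decay_reverseE[OF k', of 2] by auto
  define Q where "Q = A * C / (1 - exp (- \<delta>))"
  have e1: "0 < 1 - exp (- \<delta>)" using C by simp
  have Q: "0 < Q" using A(1) C(1) e1 by (simp add: Q_def)
  have upper: "?N (tail_set e u) \<le> ennreal (Q * w (real_of_int (unit_index e u)))" if u: "0 < u" for u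
  proof -
    let ?j = "unit_index e u"
    have "?N (tail_set e u) \<le> K_space_norm tilde_measure D
        (\<lambda>t. \<Sum>n. ennreal (b t) * indicator (unit_cell e (?j - int n)) t)"
      unfolding tilde_norm_def
    proof (intro K_space_norm_mono[OF lat] AE_I2)
      fix t
      show "ennreal (b t) * indicator (tail_set e u) t
          \<le> (\<Sum>n. ennreal (b t) * indicator (unit_cell e (?j - int n)) t)"
      proof (cases "t \<in> tail_set e u")
        case True
        then have t: "0 < t" "e * t < e * u" using tail_set_iff[OF sg u] by auto
        define n where "n = nat (?j - unit_index e t)"
        have "t \<in> unit_cell e (?j - int n)"
          using t unit_index_mono[OF sg t(1) u t(2)] by (simp add: unit_cell_def n_def)
        then have "ennreal (b t) * indicator (tail_set e u) t
            = (\<Sum>n\<in>{n}. ennreal (b t) * indicator (unit_cell e (?j - int n)) t)"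
          using True by simp
        also have "\<dots> \<le> (\<Sum>n. ennreal (b t) * indicator (unit_cell e (?j - int n)) t)"
          by (rule sum_le_suminf) auto
        finally show ?thesis .
      qed simp
    qed (use bm sets_tail_set[OF u] in measurable)
    also have "\<dots> \<le> (\<Sum>n. ?N (unit_cell e (?j - int n)))"
      unfolding tilde_norm_def by (intro K_space_norm_suminf[OF lat]) (use bm in measurable)
    also have "\<dots> \<le> (\<Sum>n. ennreal (A * (C * exp (- \<delta> * real n) * w (real_of_int ?j))))"
    proof (intro suminf_le)
      fix n
      have "w (real_of_int (?j - int n)) \<le> C * exp (- \<delta> * real n) * w (real_of_int ?j)"
        using C(3)[of "real_of_int (?j - int n)" "real_of_int ?j"]
          w[of "real_of_int (?j - int n)"] w[of "real_of_int ?j"]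
        by (simp add: divide_simps mult.commute mult.left_commute)
      then have "ennreal (A * w (real_of_int (?j - int n)))
          \<le> ennreal (A * (C * exp (- \<delta> * real n) * w (real_of_int ?j)))"
        using A(1) by (intro ennreal_leI mult_left_mono) auto
      with A(2)[of "?j - int n"] show "?N (unit_cell e (?j - int n))
          \<le> ennreal (A * (C * exp (- \<delta> * real n) * w (real_of_int ?j)))" by (rule order_trans)
    qed auto
    also have "\<dots> = ennreal (Q * w (real_of_int ?j))"
    proof (rule suminf_ennreal_eq)
      have "(\<lambda>n. exp (- \<delta>) ^ n) sums (1 / (1 - exp (- \<delta>)))" using C(2) by (intro geometric_sums) simp
      then have "(\<lambda>n. (A * C * w (real_of_int ?j)) * exp (- \<delta>) ^ n)
          sums ((A * C * w (real_of_int ?j)) * (1 / (1 - exp (- \<delta>))))" by (rule sums_mult)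
      then show "(\<lambda>n. A * (C * exp (- \<delta> * real n) * w (real_of_int ?j))) sums (Q * w (real_of_int ?j))"
        by (simp add: exp_of_nat_mult[symmetric] Q_def ac_simps)
    qed (use A(1) C(1) w[of "real_of_int ?j"] in simp)
    finally show ?thesis .
  qed
  have lower: "ennreal (w (real_of_int (unit_index e u)))
      \<le> ennreal (K * A) * ?N {t. 0 < t \<and> unit_index e t < unit_index e u - 1}" if u: "0 < u" for u
  proof -
    let ?j = "unit_index e u"
    let ?T = "{t. 0 < t \<and> unit_index e t < ?j - 1}"
    have "{t \<in> space halfline. unit_index e t < ?j - 1} \<in> sets halfline" by measurable
    then have T: "?T \<in> sets halfline" by (simp add: greaterThan_def)
    have "w (real_of_int ?j) \<le> K * w (real_of_int (?j - 2))"
      using K(2)[of "real_of_int (?j - 2)"] w[of "real_of_int (?j - 2)"] w[of "real_of_int ?j"]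
      by (simp add: divide_simps mult.commute)
    then have "ennreal (w (real_of_int ?j)) \<le> ennreal K * ennreal (w (real_of_int (?j - 2)))"
      using K(1) w[of "real_of_int (?j - 2)"] by (simp add: ennreal_mult[symmetric] ennreal_leI)
    also have "\<dots> \<le> ennreal K * (ennreal A * ?N (unit_cell e (?j - 2)))"
      by (intro mult_left_mono A) simp
    also have "\<dots> \<le> ennreal K * (ennreal A * ?N ?T)"
      by (intro mult_left_mono tilde_norm_mono_set[OF lat bm sets_unit_cell T])
         (auto simp: unit_cell_def)
    finally show ?thesis using K(1) A(1) by (simp add: ennreal_mult mult.assoc)
  qed
  have rev: "?N (tail_set e u) \<le> ennreal (max 1 (Q * (K * A)))
      * ?N {t. 0 < t \<and> unit_index e t < unit_index e u - 1}" if u: "0 < u" for u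
  proof -
    let ?T = "{t. 0 < t \<and> unit_index e t < unit_index e u - 1}"
    have "?N (tail_set e u) \<le> ennreal Q * ennreal (w (real_of_int (unit_index e u)))"
      using upper[OF u] Q w by (simp add: ennreal_mult less_imp_le)
    also have "\<dots> \<le> ennreal Q * (ennreal (K * A) * ?N ?T)" by (intro mult_left_mono lower u) simp
    also have "\<dots> = ennreal (Q * (K * A)) * ?N ?T"
      using Q K(1) A(1) by (simp add: ennreal_mult mult.assoc)
    also have "\<dots> \<le> ennreal (max 1 (Q * (K * A))) * ?N ?T"
      by (intro mult_right_mono ennreal_leI) auto
    finally show ?thesis .
  qed
  show ?thesis
  proof (rule that[OF _ _ _ rev])
    fix u :: real assume u: "0 < u"
    show "?N (tail_set e u) < \<infinity>" using upper[OF u] by (simp add: le_less_trans)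
    let ?T = "{t. 0 < t \<and> unit_index e t < unit_index e u - 1}"
    have "{t \<in> space halfline. unit_index e t < unit_index e u - 1} \<in> sets halfline" by measurable
    then have T: "?T \<in> sets halfline" by (simp add: greaterThan_def)
    have "0 < ennreal (w (real_of_int (unit_index e u)))" using w by simp
    then have "0 < ennreal (K * A) * ?N ?T" using lower[OF u] by (rule less_le_trans)
    then have "0 < ?N ?T" by (simp add: zero_less_iff_neq_zero)
    also have "?N ?T \<le> ?N (tail_set e u)"
      using unit_index_less[OF sg _ u] u
      by (intro tilde_norm_mono_set[OF lat bm T sets_tail_set[OF u]]) (auto simp: tail_set_iff[OF sg u])
    finally show "0 < ?N (tail_set e u)" .
  qed auto
qed

text \<open>The unit cells satisfy the hypotheses of the abstract comparison. Measurability in \<open>u\<close> and in \<open>t\<close>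
  holds because all norms involved are monotone there.\<close>

lemma iterated_norm_equivalence:
  assumes sg: "e = 1 \<or> e = - 1"
    and DE: "banach_lattice halfline DE" and DF: "is_K_parameter DF F" and DG: "banach_lattice halfline DG"
    and b: "b \<in> borel_measurable halfline" "\<And>t. 0 < t \<Longrightarrow> 0 < b t"
    and c: "c \<in> borel_measurable halfline" "\<And>t. 0 < t \<Longrightarrow> 0 < c t"
    and kb: "exp_decay (\<lambda>x. 1 / (b (exp_scale (e * x)) * fundamental_function F (exp \<bar>x\<bar>)))"
    and kc: "exp_decay (\<lambda>x. c (exp_scale (e * x)))"
  defines "d \<equiv> \<lambda>u. c u / enn2real (tilde_norm DF (tail_set e u) (\<lambda>t. ennreal (b t)))"
  obtains C where "0 < C"
    "\<And>g. g \<in> borel_measurable halfline \<Longrightarrow>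
      hat_norm DE (\<lambda>u. ennreal (d u) * tilde_norm DF (tail_set e u)
          (\<lambda>t. ennreal (b t) * tilde_norm DG (gap_set e u t) g))
        \<le> hat_norm DE (\<lambda>u. ennreal (c u) * tilde_norm DG (tail_set e u) g)"
    "\<And>g. g \<in> borel_measurable halfline \<Longrightarrow>
      hat_norm DE (\<lambda>u. ennreal (c u) * tilde_norm DG (tail_set e u) g)
        \<le> ennreal C * hat_norm DE (\<lambda>u. ennreal (d u) * tilde_norm DF (tail_set e u)
            (\<lambda>t. ennreal (b t) * tilde_norm DG (gap_set e u t) g))"
proof -
  note latF = is_K_parameter_lattice[OF DF]
  obtain Cb where Cb: "1 \<le> Cb"
    "\<And>u. 0 < u \<Longrightarrow> 0 < tilde_norm DF (tail_set e u) (\<lambda>t. ennreal (b t))"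
    "\<And>u. 0 < u \<Longrightarrow> tilde_norm DF (tail_set e u) (\<lambda>t. ennreal (b t)) < \<infinity>"
    "\<And>u. 0 < u \<Longrightarrow> tilde_norm DF (tail_set e u) (\<lambda>t. ennreal (b t))
      \<le> ennreal Cb * tilde_norm DF {t. 0 < t \<and> unit_index e t < unit_index e u - 1} (\<lambda>t. ennreal (b t))"
    by (rule cumulative_weight_norm[OF sg DF b kb]) (assumption, rule that)
  obtain Cc \<delta> where Cc: "1 \<le> Cc" "0 < \<delta>"
    "\<And>u n. 0 < u \<Longrightarrow> c u \<le> Cc * exp (- \<delta> * real n) * c (exp_scale (e * real_of_int (unit_index e u - int n)))"
    "\<And>u. 0 < u \<Longrightarrow> c (exp_scale (e * real_of_int (unit_index e u - 1))) \<le> Cc * c u"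
    by (rule outer_weight_discrete[OF sg kc]) (rule that)
  define C where "C = max Cb Cc"
  define cJ where "cJ = (\<lambda>j. c (exp_scale (e * real_of_int j)))"
  have cJ: "0 < cJ j" for j using c(2) by (simp add: cJ_def)
  have bm: "(\<lambda>t. ennreal (b t)) \<in> borel_measurable halfline" using b by measurable
  have tail_set_mono: "tail_set e u \<subseteq> tail_set e v" if "0 < u" "0 < v" "e * u \<le> e * v" for u v
    using that by (auto simp: tail_set_iff[OF sg])
  have gap_set_mono: "gap_set e u t \<subseteq> gap_set e v t" if "e * u \<le> e * v" for u v t
    using that by (auto simp: gap_set_iff[OF sg])
  have mB: "(\<lambda>t. tilde_norm DG (gap_set e u t) g) \<in> borel_measurable halfline"
    if g: "g \<in> borel_measurable halfline" and u: "0 < u" for g u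
  proof (rule measurable_oriented_mono[of "- e"])
    fix t t' assume t: "0 < t" "0 < t'" "- e * t \<le> - e * t'"
    then have "gap_set e u t \<subseteq> gap_set e u t'" by (auto simp: gap_set_iff[OF sg])
    then show "tilde_norm DG (gap_set e u t) g \<le> tilde_norm DG (gap_set e u t') g"
      using t u by (intro tilde_norm_mono_set[OF DG g] sets_gap_set)
  qed (use sg in auto)
  have mN: "(\<lambda>u. tilde_norm DG (tail_set e u) g) \<in> borel_measurable halfline"
    if "g \<in> borel_measurable halfline" for g
    by (intro measurable_oriented_mono[OF sg] tilde_norm_mono_set[OF DG that] sets_tail_set tail_set_mono)
  have m\<beta>: "(\<lambda>u. tilde_norm DF (tail_set e u) (\<lambda>t. ennreal (b t))) \<in> borel_measurable halfline"
    by (intro measurable_oriented_mono[OF sg] tilde_norm_mono_set[OF latF bm] sets_tail_set tail_set_mono)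
  have mR: "(\<lambda>u. tilde_norm DF (tail_set e u) (\<lambda>t. ennreal (b t) * tilde_norm DG (gap_set e u t) g))
      \<in> borel_measurable halfline" if g: "g \<in> borel_measurable halfline" for g
  proof (rule measurable_oriented_mono[OF sg])
    fix u v assume uv: "0 < u" "0 < v" "e * u \<le> e * v"
    note [measurable] = mB[OF g uv(1)] mB[OF g uv(2)] b(1) sets_tail_set[OF uv(1)] sets_tail_set[OF uv(2)]
    show "tilde_norm DF (tail_set e u) (\<lambda>t. ennreal (b t) * tilde_norm DG (gap_set e u t) g)
      \<le> tilde_norm DF (tail_set e v) (\<lambda>t. ennreal (b t) * tilde_norm DG (gap_set e v t) g)"
      unfolding tilde_norm_def[of DF]
    proof (intro K_space_norm_mono[OF latF] AE_I2)
      fix t assume "t \<in> space tilde_measure"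
      then have t: "0 < t" by simp
      have "tilde_norm DG (gap_set e u t) g \<le> tilde_norm DG (gap_set e v t) g"
        using uv t by (intro tilde_norm_mono_set[OF DG g] sets_gap_set gap_set_mono)
      then show "ennreal (b t) * tilde_norm DG (gap_set e u t) g * indicator (tail_set e u) t
          \<le> ennreal (b t) * tilde_norm DG (gap_set e v t) g * indicator (tail_set e v) t"
        using tail_set_mono[OF uv] by (auto simp: indicator_def intro!: mult_left_mono)
    qed measurable
  qed
  have C0: "0 < C" "0 < \<delta>" using Cb(1) Cc(2) by (auto simp: C_def)
  have cell: "emeasure hat_measure {u \<in> space hat_measure. unit_index e u = j} = 1" for j
    using unit_cell_measures(1)[OF sg, of j] by (simp add: unit_cell_def greaterThan_def)
  have A_J: "0 < s \<and> unit_index e s \<le> unit_index e u" if "0 < u" "s \<in> tail_set e u" for u s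
    using that unit_index_mono[OF sg _ that(1)] by (auto simp: tail_set_iff[OF sg])
  have J_A: "s \<in> tail_set e u" if "0 < u" "0 < s" "unit_index e s < unit_index e u" for u s
    using that unit_index_less[OF sg] by (auto simp: tail_set_iff[OF sg])
  have B_A: "gap_set e u t \<subseteq> tail_set e u" if "0 < u" "0 < t" for u t
    using that by (auto simp: gap_set_def tail_set_def)
  have J_B: "s \<in> gap_set e u t"
    if "0 < u" "0 < s" "0 < t" "unit_index e t < unit_index e s" "unit_index e s < unit_index e u" for u s t
    using that unit_index_less[OF sg] by (auto simp: gap_set_iff[OF sg])
  have decay: "c u \<le> C * exp (- \<delta> * real n) * cJ (unit_index e u - int n)" if u: "0 < u" for u n
  proof -
    have "c u \<le> Cc * exp (- \<delta> * real n) * cJ (unit_index e u - int n)"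
      using Cc(3)[OF u] by (simp add: cJ_def)
    also have "\<dots> \<le> C * exp (- \<delta> * real n) * cJ (unit_index e u - int n)"
      using cJ[of "unit_index e u - int n"] by (intro mult_right_mono) (auto simp: C_def)
    finally show ?thesis .
  qed
  have c_rev: "cJ (unit_index e u - 1) \<le> C * c u" if u: "0 < u" for u
  proof -
    have "cJ (unit_index e u - 1) \<le> Cc * c u" using Cc(4)[OF u] by (simp add: cJ_def)
    also have "\<dots> \<le> C * c u" using c(2)[OF u] by (intro mult_right_mono) (auto simp: C_def)
    finally show ?thesis .
  qed
  have \<beta>_rev: "tilde_norm DF (tail_set e u) (\<lambda>t. ennreal (b t))
      \<le> ennreal C * tilde_norm DF {t. 0 < t \<and> unit_index e t < unit_index e u - 1} (\<lambda>t. ennreal (b t))"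
    if u: "0 < u" for u
    by (rule order_trans[OF Cb(4)[OF u]]) (auto simp: C_def intro!: mult_right_mono ennreal_leI)
  note core = DE latF DG measurable_unit_index cell sets_tail_set A_J J_A sets_gap_set B_A J_B b(1) c(2)
    C0(2,1) decay c_rev Cb(2,3) \<beta>_rev
  show ?thesis
  proof (rule that)
    show "0 < C / (1 - exp (- \<delta>)) * (C * C)" using C0 by simp
    fix g :: "real \<Rightarrow> ennreal" assume g: "g \<in> borel_measurable halfline"
    note [measurable] = mN[OF g] m\<beta> mR[OF g] c(1)
    have m1: "(\<lambda>u. ennreal (d u) * tilde_norm DF (tail_set e u)
        (\<lambda>t. ennreal (b t) * tilde_norm DG (gap_set e u t) g)) \<in> borel_measurable halfline"
      unfolding d_def by measurable
    have m2: "(\<lambda>u. ennreal (c u) * tilde_norm DG (tail_set e u) g) \<in> borel_measurable halfline"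
      by measurable
    show "hat_norm DE (\<lambda>u. ennreal (d u) * tilde_norm DF (tail_set e u)
          (\<lambda>t. ennreal (b t) * tilde_norm DG (gap_set e u t) g))
        \<le> hat_norm DE (\<lambda>u. ennreal (c u) * tilde_norm DG (tail_set e u) g)"
      unfolding d_def
      by (rule iterated_norm_le[OF core g m1[unfolded d_def] m2 mB[OF g]])
    show "hat_norm DE (\<lambda>u. ennreal (c u) * tilde_norm DG (tail_set e u) g)
        \<le> ennreal (C / (1 - exp (- \<delta>)) * (C * C)) * hat_norm DE (\<lambda>u. ennreal (d u) *
          tilde_norm DF (tail_set e u) (\<lambda>t. ennreal (b t) * tilde_norm DG (gap_set e u t) g))"
      unfolding d_def
      by (rule iterated_norm_ge[OF core g m1[unfolded d_def] m2 mB[OF g]])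
  qed
qed

section \<open>The interpolation spaces\<close>

lemma K_functional_mono:
  assumes X1: "quasi_banach_space X1 n1" and "s \<le> t"
  shows "K_functional X0 n0 X1 n1 s f \<le> K_functional X0 n0 X1 n1 t f"
  unfolding K_functional_def
proof (intro INF_superset_mono order_refl, clarify)
  fix f0 f1 assume "f1 \<in> X1"
  then have "0 \<le> n1 f1" using X1 unfolding quasi_banach_space_def by blast
  then show "ennreal (n0 f0 + s * n1 f1) \<le> ennreal (n0 f0 + t * n1 f1)"
    using assms(2) by (intro ennreal_leI add_left_mono mult_right_mono)
qed

text \<open>A functional on measurable functions is applied to $K(\cdot,f)$, which is measurable because it is
  nondecreasing.\<close>

lemma same_interpolation_spaceI:
  assumes X1: "quasi_banach_space X1 n1" and C: "0 < C"
    and le: "\<And>k. k \<in> borel_measurable halfline \<Longrightarrow> \<Phi> k \<le> \<Psi> k"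
    and ge: "\<And>k. k \<in> borel_measurable halfline \<Longrightarrow> \<Psi> k \<le> ennreal C * \<Phi> k"
  shows "same_space (interpolation_space X0 n0 X1 n1 \<Phi>) (interpolation_space X0 n0 X1 n1 \<Psi>)"
proof -
  let ?k = "\<lambda>f s. K_functional X0 n0 X1 n1 s f"
  have m: "?k f \<in> borel_measurable halfline" for f
    by (intro measurable_mono_halfline K_functional_mono[OF X1])
  have "\<Phi> (?k f) < \<infinity> \<longleftrightarrow> \<Psi> (?k f) < \<infinity>" for f
  proof
    assume "\<Phi> (?k f) < \<infinity>"
    then have "ennreal C * \<Phi> (?k f) < \<infinity>" by (simp add: ennreal_mult_less_top)
    then show "\<Psi> (?k f) < \<infinity>" using ge[OF m, of f] by (rule le_less_trans[rotated])
  next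
    assume "\<Psi> (?k f) < \<infinity>"
    then show "\<Phi> (?k f) < \<infinity>" using le[OF m, of f] by (rule le_less_trans[rotated])
  qed
  moreover have "\<Phi> (?k f) \<le> ennreal (max 1 C) * \<Psi> (?k f) \<and> \<Psi> (?k f) \<le> ennreal (max 1 C) * \<Phi> (?k f)" for f
  proof
    have "1 * \<Psi> (?k f) \<le> ennreal (max 1 C) * \<Psi> (?k f)"
      by (intro mult_right_mono) (auto simp flip: ennreal_1 intro!: ennreal_leI)
    with le[OF m, of f] show "\<Phi> (?k f) \<le> ennreal (max 1 C) * \<Psi> (?k f)" by simp
    have "ennreal C * \<Phi> (?k f) \<le> ennreal (max 1 C) * \<Phi> (?k f)"
      by (intro mult_right_mono ennreal_leI) auto
    with ge[OF m, of f] show "\<Psi> (?k f) \<le> ennreal (max 1 C) * \<Phi> (?k f)" by (rule order_trans)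
  qed
  ultimately show ?thesis
    unfolding same_space_def interpolation_space_def
    by (auto intro!: exI[of _ "max 1 C"])
qed

text \<open>For \<open>e = 1\<close> the functions \<open>Bn\<close>, \<open>Bp\<close> are $B_0$, $B_\infty$; for \<open>e = - 1\<close> they are exchanged, and
  the hypotheses on the indices become those of ii).\<close>

lemma oriented_norm_equivalence:
  assumes sg: "e = 1 \<or> e = - 1"
    and DE: "banach_lattice halfline DE" and DF: "is_K_parameter DF F" and DG: "banach_lattice halfline DG"
    and b: "slowly_varying b" and c: "slowly_varying c"
    and Bn: "Bn = (\<lambda>u. b (exp (e * (1 - 1 / u))))" and Bp: "Bp = (\<lambda>u. b (exp (- e * (1 - 1 / u))))"
    and Cn: "Cn = (\<lambda>u. c (exp (e * (1 - 1 / u))))" and Cp: "Cp = (\<lambda>u. c (exp (- e * (1 - 1 / u))))"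
    and ext: "has_extension_indices 1 Bn" "has_extension_indices 1 Bp"
      "has_extension_indices 1 Cn" "has_extension_indices 1 Cp"
    and idx: "rho_index 1 Bp < pi_index \<infinity> (fundamental_function F)"
      "rho_index \<infinity> (fundamental_function F) < pi_index 1 Bn"
      "rho_index 1 Cn < 0" "0 < pi_index 1 Cp"
  defines "d \<equiv> \<lambda>u. c u / enn2real (tilde_norm DF (tail_set e u) (\<lambda>t. ennreal (b t)))"
  obtains C where "0 < C"
    "\<And>g. g \<in> borel_measurable halfline \<Longrightarrow>
      hat_norm DE (\<lambda>u. ennreal (d u) * tilde_norm DF (tail_set e u)
          (\<lambda>t. ennreal (b t) * tilde_norm DG (gap_set e u t) g))
        \<le> hat_norm DE (\<lambda>u. ennreal (c u) * tilde_norm DG (tail_set e u) g)"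
    "\<And>g. g \<in> borel_measurable halfline \<Longrightarrow>
      hat_norm DE (\<lambda>u. ennreal (c u) * tilde_norm DG (tail_set e u) g)
        \<le> ennreal C * hat_norm DE (\<lambda>u. ennreal (d u) * tilde_norm DF (tail_set e u)
            (\<lambda>t. ennreal (b t) * tilde_norm DG (gap_set e u t) g))"
proof -
  have ab: "\<bar>e\<bar> = 1" "\<bar>- e\<bar> = 1" using sg by auto
  have neg: "h (exp (e * (1 - 1 / exp x))) = h (exp_scale (e * x))" if "x < 0" for h :: "real \<Rightarrow> real" and x
    using sg that signed_expm1_minus[of x]
    by (auto simp: exp_scale_def signed_expm1_nonpos exp_minus divide_inverse)
  have pos: "h (exp (- e * (1 - 1 / exp (- x)))) = h (exp_scale (e * x))" if "0 < x" for h :: "real \<Rightarrow> real" and x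
  proof -
    have "1 / exp (- x) = exp x" by (simp add: exp_minus divide_inverse)
    then show ?thesis
      using sg that signed_expm1_minus[of x] by (auto simp: exp_scale_def signed_expm1_nonneg)
  qed
  note lb = slowly_varying_dilation_locally_bounded
  obtain C1 where C1: "1 \<le> C1"
    "\<And>x y. \<bar>x\<bar> \<le> 1 \<Longrightarrow> \<bar>y\<bar> \<le> 1 \<Longrightarrow> c (exp_scale (e * x)) \<le> C1 * c (exp_scale (e * y))"
    by (rule slowly_varying_local[OF c ab(1)]) (rule that)
  have kc: "exp_decay (\<lambda>x. c (exp_scale (e * x)))"
    by (rule exp_decay_of_indices[OF _ _ _ ext(3,4) lb[OF c ab(1) _ ext(3)] lb[OF c ab(2) _ ext(4)] C1 idx(3,4)])
       (simp_all add: slowly_varying_pos[OF c] Cn Cp neg pos[unfolded minus_mult_left[symmetric]])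
  obtain C2 where C2: "1 \<le> C2"
    "\<And>x y. \<bar>x\<bar> \<le> 1 \<Longrightarrow> \<bar>y\<bar> \<le> 1 \<Longrightarrow> b (exp_scale (e * x)) \<le> C2 * b (exp_scale (e * y))"
    by (rule slowly_varying_local[OF b ab(1)]) (rule that)
  have kb: "exp_decay (\<lambda>x. 1 / (b (exp_scale (e * x)) * fundamental_function F (exp \<bar>x\<bar>)))"
    by (rule exp_decay_of_index_gap[OF _ _ _ ext(1,2) lb[OF b ab(1) _ ext(1)] lb[OF b ab(2) _ ext(2)] C2
          fundamental_function_eq(2)[OF DF] fundamental_function_mono[OF DF]
          fundamental_function_extension_indices[OF DF] idx(1,2)])
       (simp_all add: slowly_varying_pos[OF b] Bn Bp neg pos[unfolded minus_mult_left[symmetric]])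
  show ?thesis
    by (rule iterated_norm_equivalence[OF sg DE DF DG slowly_varying_measurable[OF b] slowly_varying_pos[OF b]
          slowly_varying_measurable[OF c] slowly_varying_pos[OF c] kb kc])
       (assumption, assumption, rule that[unfolded d_def])
qed

theorem corollary4p5:
  fixes X0 X1 :: "'a::{real_vector,t2_space,topological_ab_group_add} set"
    and n0 n1 :: "'a \<Rightarrow> real"
    and \<theta> :: real
    and E F G DE DF DG :: "(real \<Rightarrow> ennreal) \<Rightarrow> ennreal"
    and a b c B\<^sub>0 B\<^sub>i\<^sub>n\<^sub>f C\<^sub>0 C\<^sub>i\<^sub>n\<^sub>f :: "real \<Rightarrow> real"
  assumes couple: "compatible_couple X0 n0 X1 n1"
    and theta: "0 < \<theta>" "\<theta> < 1"
    and ri: "ri_norm E" "ri_norm F" "ri_norm G"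
    and params: "is_K_parameter DE E" "is_K_parameter DF F" "is_K_parameter DG G"
    and sv: "slowly_varying a" "slowly_varying b" "slowly_varying c"
    and b_square: "equiv_on {0<..} (\<lambda>t. b (t\<^sup>2)) b"
    and c_square: "equiv_on {0<..} (\<lambda>t. c (t\<^sup>2)) c"
    and B0: "B\<^sub>0 = (\<lambda>u. b (exp (1 - 1 / u)))"
    and Binf: "B\<^sub>i\<^sub>n\<^sub>f = (\<lambda>u. b (exp (1 / u - 1)))"
    and C0: "C\<^sub>0 = (\<lambda>u. c (exp (1 - 1 / u)))"
    and Cinf: "C\<^sub>i\<^sub>n\<^sub>f = (\<lambda>u. c (exp (1 / u - 1)))"
    and indices_defined:
      "has_extension_indices 1 B\<^sub>0" "has_extension_indices 1 B\<^sub>i\<^sub>n\<^sub>f"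
      "has_extension_indices 1 C\<^sub>0" "has_extension_indices 1 C\<^sub>i\<^sub>n\<^sub>f"
  shows
    "(rho_index 1 B\<^sub>i\<^sub>n\<^sub>f < pi_index \<infinity> (fundamental_function F) \<and>
      pi_index \<infinity> (fundamental_function F) \<le> rho_index \<infinity> (fundamental_function F) \<and>
      rho_index \<infinity> (fundamental_function F) < pi_index 1 B\<^sub>0 \<and>
      rho_index 1 C\<^sub>0 < 0 \<and> 0 < pi_index 1 C\<^sub>i\<^sub>n\<^sub>f \<longrightarrow>
      same_space
        (interpolation_space X0 n0 X1 n1
          (RL_norm \<theta> (\<lambda>u. c u / enn2real (tilde_norm DF {0<..<u} (\<lambda>t. ennreal (b t)))) DE b DF a DG))
        (interpolation_space X0 n0 X1 n1 (L_norm \<theta> c DE a DG)))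
     \<and>
     (rho_index 1 B\<^sub>0 < pi_index \<infinity> (fundamental_function F) \<and>
      pi_index \<infinity> (fundamental_function F) \<le> rho_index \<infinity> (fundamental_function F) \<and>
      rho_index \<infinity> (fundamental_function F) < pi_index 1 B\<^sub>i\<^sub>n\<^sub>f \<and>
      rho_index 1 C\<^sub>i\<^sub>n\<^sub>f < 0 \<and> 0 < pi_index 1 C\<^sub>0 \<longrightarrow>
      same_space
        (interpolation_space X0 n0 X1 n1
          (LR_norm \<theta> (\<lambda>u. c u / enn2real (tilde_norm DF {u<..} (\<lambda>t. ennreal (b t)))) DE b DF a DG))
        (interpolation_space X0 n0 X1 n1 (R_norm \<theta> c DE a DG)))"
proof -
  note lat = is_K_parameter_lattice[OF params(1)] params(2) is_K_parameter_lattice[OF params(3)]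
  have X1: "quasi_banach_space X1 n1" using couple unfolding compatible_couple_def by blast
  have weighted: "(\<lambda>s. ennreal (s powr (- \<theta>) * a s) * k s) \<in> borel_measurable halfline"
    if k: "k \<in> borel_measurable halfline" for k
  proof -
    have "(\<lambda>s::real. s powr (- \<theta>)) \<in> borel_measurable halfline"
      by (intro measurable_halfline_borel) measurable
    then show ?thesis using k slowly_varying_measurable[OF sv(1)] by measurable
  qed
  have set: "tail_set 1 u = {0<..<u}" "gap_set 1 u t = {t<..<u}"
    "tail_set (- 1) u = {u<..}" "gap_set (- 1) u t = {u<..<t}" for u t
    by (simp_all add: tail_set_def gap_set_def)
  show ?thesis
  proof (intro conjI impI, goal_cases)
    case 1
    obtain C where C: "0 < C"
      "\<And>k. k \<in> borel_measurable halfline \<Longrightarrow>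
        RL_norm \<theta> (\<lambda>u. c u / enn2real (tilde_norm DF {0<..<u} (\<lambda>t. ennreal (b t)))) DE b DF a DG k
          \<le> L_norm \<theta> c DE a DG k"
      "\<And>k. k \<in> borel_measurable halfline \<Longrightarrow> L_norm \<theta> c DE a DG k \<le> ennreal C *
        RL_norm \<theta> (\<lambda>u. c u / enn2real (tilde_norm DF {0<..<u} (\<lambda>t. ennreal (b t)))) DE b DF a DG k"
    proof (rule oriented_norm_equivalence[OF _ lat sv(2,3), of 1 "B\<^sub>0" "B\<^sub>i\<^sub>n\<^sub>f" "C\<^sub>0" "C\<^sub>i\<^sub>n\<^sub>f"], goal_cases)
      case (14 C)
      show ?case
      proof (rule that)
        show "0 < C" by (rule 14(2))
      qed (use 14(3,4)[OF weighted] in \<open>simp_all add: set RL_norm_def L_norm_def\<close>)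
    qed (use 1 indices_defined in \<open>simp_all add: B0 Binf C0 Cinf\<close>)
    show ?case by (rule same_interpolation_spaceI[OF X1 C])
  next
    case 2
    obtain C where C: "0 < C"
      "\<And>k. k \<in> borel_measurable halfline \<Longrightarrow>
        LR_norm \<theta> (\<lambda>u. c u / enn2real (tilde_norm DF {u<..} (\<lambda>t. ennreal (b t)))) DE b DF a DG k
          \<le> R_norm \<theta> c DE a DG k"
      "\<And>k. k \<in> borel_measurable halfline \<Longrightarrow> R_norm \<theta> c DE a DG k \<le> ennreal C *
        LR_norm \<theta> (\<lambda>u. c u / enn2real (tilde_norm DF {u<..} (\<lambda>t. ennreal (b t)))) DE b DF a DG k"
    proof (rule oriented_norm_equivalence[OF _ lat sv(2,3), of "- 1" "B\<^sub>i\<^sub>n\<^sub>f" "B\<^sub>0" "C\<^sub>i\<^sub>n\<^sub>f" "C\<^sub>0"], goal_cases)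
      case (14 C)
      show ?case
      proof (rule that)
        show "0 < C" by (rule 14(2))
      qed (use 14(3,4)[OF weighted] in \<open>simp_all add: set LR_norm_def R_norm_def\<close>)
    qed (use 2 indices_defined in \<open>simp_all add: B0 Binf C0 Cinf\<close>)
    show ?case by (rule same_interpolation_spaceI[OF X1 C])
  qed
qed

end
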